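(* Let $\overline N$ be a Poisson process on $\mathbb{R}\times\mathbb{R}_+$ with mean measure $\mathrm{d}t\,\mathrm{d}z$, let $\varphi:\mathbb{R}\times\mathcal N\to\mathbb{R}_+$ be a measurable functional, let $\lambda(t):=\varphi(t,\overline N|_{(-\infty,t)})$, $t\in\mathbb{R}$, be such that $\int_a^b\lambda(s)\,\mathrm{d}s<\infty$ a.s. for all $a,b\in\mathbb{R}$, and let $N$ be the point process on $\mathbb{R}$ defined by $N(\mathrm{d}t):=\overline N(\mathrm{d}t\times(0,\lambda(t)])$. Let $u:\mathbb{R}\to\mathbb{R}$ be a measurable function such that $$\mathrm{E}\Big[\int_{\mathbb{R}}|u(t)|\lambda(t)\,\mathrm{d}t\Big]<\infty,\qquad \mathrm{E}\Big[\int_{\mathbb{R}}|u(t)|^2\lambda(t)\,\mathrm{d}t\Big]<\infty,$$ $$\int_{\mathbb{R}\times\mathbb{R}_+}\Big(\int_t^\infty|u(s)|\,\mathrm{E}[|D_{(t,z)}\lambda(s)|]\,\mathrm{d}s\Big)\mathrm{d}t\,\mathrm{d}z<\infty,$$ $$\int_{\mathbb{R}\times\mathbb{R}_+}\Big(\int_t^\infty|u(s)|^2\,\mathrm{E}[|D_{(t,z)}\lambda(s)|]\,\mathrm{d}s\Big)\mathrm{d}t\,\mathrm{d}z<\infty,$$ and $$\int_{\mathbb{R}\times\mathbb{R}_+}|u(t)|^2\Big(\int_t^\infty|u(s)|\,\mathrm{E}[\mathbf 1_{(0,\lambda(t)]}(z)|D_{(t,z)}\lambda(s)|]\,\mathrm{d}s\Big)\mathrm{d}t\,\mathrm{d}z<\infty.$$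 In addition, assume that, for Lebesgue-almost all $(t,z)\in\mathbb{R}\times\mathbb{R}_+$, the random function $s\mapsto|D_{(t,z)}\lambda(s)|$ is a.s. locally integrable on $(t,\infty)$ with respect to the Lebesgue measure. Let $\delta(u):=\int_{\mathbb{R}}u(t)\,(N(\mathrm{d}t)-\lambda(t)\,\mathrm{d}t)$ and let $Z$ be a standard normal random variable. Then $$\begin{aligned} d_W(\delta(u),Z)\le{}&\sqrt{2/\pi}\,\mathrm{E}\Big[\Big|1-\int_{\mathbb{R}}|u(t)|^2\lambda(t)\,\mathrm{d}t\Big|\Big]+\mathrm{E}\Big[\int_{\mathbb{R}}|u(t)|^3\lambda(t)\,\mathrm{d}t\Big]\\ &+2\sqrt{2/\pi}\int_{\mathbb{R}\times\mathbb{R}_+}|u(t)|\Big(\int_t^{+\infty}|u(s)|\,\mathrm{E}[\mathbf 1_{(0,\lambda(t)]}(z)|D_{(t,z)}\lambda(s)|]\,\mathrm{d}s\Big)\mathrm{d}t\,\mathrm{d}z\\ &+\int_{\mathbb{R}\times\mathbb{R}_+}|u(t)|\Big(\int_t^{+\infty}|u(s)|^2\,\mathrm{E}[\mathbf 1_{(0,\lambda(t)]}(z)|D_{(t,z)}\lambda(s)|]\,\mathrm{d}s\Big)\mathrm{d}t\,\mathrm{d}z. \end{aligned}$$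
   Context: $\mathcal N$ denotes the space of simple and locally finite counting measures on $\mathbb{R}\times\mathbb{R}_+$, endowed with the vague topology (and its Borel $\sigma$-field). $\overline N$ is defined on a probability space $(\Omega,\mathcal A,P)$. The restriction of $\overline N$ is $\overline N|_{(-\infty,t)}(A):=\overline N(A\cap((-\infty,t)\times\mathbb{R}_+))$ for Borel $A\subseteq\mathbb{R}\times\mathbb{R}_+$. Finite difference operator: for a measurable $\psi:\mathcal N\to\mathbb{R}$ and $(t,z)\in\mathbb{R}\times\mathbb{R}_+$, $D_{(t,z)}\psi(\overline N):=\psi(\overline N+\varepsilon_{(t,z)})-\psi(\overline N)$, where $\varepsilon_{(t,z)}$ is the Dirac measure at $(t,z)$. In particular $D_{(t,z)}\lambda(s)=\varphi(s,(\overline N+\varepsilon_{(t,z)})|_{(-\infty,s)})-\varphi(s,\overline N|_{(-\infty,s)})$. The notation $N(\mathrm{d}t):=\overline N(\mathrm{d}t\times(0,\lambda(t)])$ means $N(A)=\int_{A\times\mathbb{R}_+}\mathbf 1_{(0,\lambda(t)]}(z)\,\overline N(\mathrm{d}t\times\mathrm{d}z)$ for Borel $A\subseteq\mathbb{R}$. Wasserstein distance: $d_W(X,Y):=\sup_{g\in\mathrm{Lip}(1)}|\mathrm{E}[g(X)]-\mathrm{E}[g(Y)]|$, where $\mathrm{Lip}(1)$ is the class of real-valued Lipschitz functions on $\mathbb{R}$ with Lipschitz constant less than or equal to $1$. *)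

theory Defs
  imports "HOL-Probability.Probability"
begin

section \<open>Simple locally finite counting measures on the closed half plane\<close>

definition half_plane :: "(real \<times> real) set" where
  "half_plane = UNIV \<times> {0..}"

definition half_plane_lebesgue :: "(real \<times> real) measure" where
  "half_plane_lebesgue = restrict_space lborel half_plane"

definition counting_measures :: "(real \<times> real) measure set" where
  "counting_measures = {\<mu>.
     sets \<mu> = sets (restrict_space borel half_plane) \<and>
     (\<forall>A\<in>sets \<mu>. emeasure \<mu> A \<in> range ennreal_of_enat) \<and>
     (\<forall>K. compact K \<and> K \<subseteq> half_plane \<longrightarrow> emeasure \<mu> K < \<infinity>) \<and>
     (\<forall>x\<in>half_plane. emeasure \<mu> {x} \<le> 1)}"

definition test_functions :: "(real \<times> real \<Rightarrow> real) set" where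
  "test_functions = {f. continuous_on half_plane f \<and>
     (\<exists>K. compact K \<and> K \<subseteq> half_plane \<and> (\<forall>x\<in>half_plane - K. f x = 0))}"

text \<open>The coarsest topology on \<^const>\<open>counting_measures\<close> that makes all the maps
  \<open>\<mu> \<mapsto> \<integral>f d\<mu>\<close> continuous, where \<open>f\<close> is continuous with compact support.\<close>

definition vague_topology :: "(real \<times> real) measure topology" where
  "vague_topology = topology_generated_by
     {{\<mu> \<in> counting_measures. (\<integral>x. f x \<partial>\<mu>) \<in> U} | f U. f \<in> test_functions \<and> open U}"

definition counting_space :: "(real \<times> real) measure measure" where
  "counting_space = sigma counting_measures {U. openin vague_topology U}"

lemma topspace_vague_topology: "topspace vague_topology = counting_measures"
proof -
  have "(\<lambda>_. 0) \<in> test_functions"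
    by (auto simp: test_functions_def)
  then have "counting_measures \<in>
      {{\<mu> \<in> counting_measures. (\<integral>x. f x \<partial>\<mu>) \<in> U} | f U. f \<in> test_functions \<and> open U}"
    by (intro CollectI exI[of _ "\<lambda>_. 0"] exI[of _ UNIV]) auto
  then show ?thesis
    unfolding vague_topology_def topology_generated_by_topspace by blast
qed

lemma space_counting_space: "space counting_space = counting_measures"
  unfolding counting_space_def by (rule space_measure_of_conv)

lemma sets_counting_space:
  "sets counting_space = sigma_sets counting_measures {U. openin vague_topology U}"
  unfolding counting_space_def
  by (rule sets_measure_of) (use openin_subset topspace_vague_topology in blast)


section \<open>Restriction, adding an atom, difference operator\<close>

definition restrict_before :: "real \<Rightarrow> (real \<times> real) measure \<Rightarrow> (real \<times> real) measure" where
  "restrict_before t \<mu> = density \<mu> (indicator ({..<t} \<times> {0..}))"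

lemma emeasure_restrict_before:
  assumes sets: "sets \<mu> = sets (restrict_space borel half_plane)" and A: "A \<in> sets \<mu>"
  shows "emeasure (restrict_before t \<mu>) A = emeasure \<mu> (A \<inter> ({..<t} \<times> {0..}))"
proof -
  have "{..<t} \<times> {0..} = half_plane \<inter> ({..<t} \<times> (UNIV :: real set))"
    by (auto simp: half_plane_def)
  moreover have "{..<t} \<times> (UNIV :: real set) \<in> sets borel"
    by (intro borel_open open_Times) auto
  ultimately have B: "{..<t} \<times> {0..} \<in> sets \<mu>"
    unfolding sets sets_restrict_space by blast
  then have "emeasure (restrict_before t \<mu>) A = (\<integral>\<^sup>+x. indicator (A \<inter> ({..<t} \<times> {0..})) x \<partial>\<mu>)"
    unfolding restrict_before_def using A
    by (subst emeasure_density)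
       (auto intro!: nn_integral_cong simp: indicator_def simp del: nn_integral_indicator)
  also have "\<dots> = emeasure \<mu> (A \<inter> ({..<t} \<times> {0..}))"
    using A B by (intro nn_integral_indicator) auto
  finally show ?thesis .
qed

definition add_atom :: "'a measure \<Rightarrow> 'a \<Rightarrow> 'a measure" where
  "add_atom \<mu> x = measure_of (space \<mu>) (sets \<mu>) (\<lambda>A. emeasure \<mu> A + emeasure (return \<mu> x) A)"

lemma emeasure_add_atom:
  assumes "A \<in> sets \<mu>"
  shows "emeasure (add_atom \<mu> x) A = emeasure \<mu> A + indicator A x"
proof -
  have "countably_additive (sets \<mu>) (\<lambda>A. emeasure \<mu> A + emeasure (return \<mu> x) A)"
  proof (rule countably_additiveI)
    fix F :: "nat \<Rightarrow> 'a set"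
    assume F: "range F \<subseteq> sets \<mu>" "disjoint_family F"
    have "(\<Sum>i. emeasure \<mu> (F i) + emeasure (return \<mu> x) (F i)) =
        (\<Sum>i. emeasure \<mu> (F i)) + (\<Sum>i. emeasure (return \<mu> x) (F i))"
      by (intro suminf_add[symmetric]) auto
    also have "\<dots> = emeasure \<mu> (\<Union> (range F)) + emeasure (return \<mu> x) (\<Union> (range F))"
      using F by (simp add: suminf_emeasure del: emeasure_return)
    finally show "(\<Sum>i. emeasure \<mu> (F i) + emeasure (return \<mu> x) (F i)) =
        emeasure \<mu> (\<Union> (range F)) + emeasure (return \<mu> x) (\<Union> (range F))" .
  qed
  then have "emeasure (add_atom \<mu> x) A = emeasure \<mu> A + emeasure (return \<mu> x) A"
    using assms sets.space_closed[of \<mu>]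
    by (intro emeasure_measure_of[OF add_atom_def])
       (auto simp: add_atom_def positive_def sets.sigma_sets_eq)
  then show ?thesis
    using assms by simp
qed

text \<open>\<open>\<psi>\<close> is a total HOL function. When \<open>\<mu>\<close> already has an atom at \<open>x\<close>, the measure
  \<open>\<mu> + \<epsilon>\<^sub>x\<close> is not simple and \<open>\<psi>\<close> is evaluated outside \<^const>\<open>counting_measures\<close>. For a Poisson
  process with diffuse mean measure and a fixed \<open>x\<close> this has probability zero.\<close>

definition difference_operator ::
    "'a \<Rightarrow> ('a measure \<Rightarrow> real) \<Rightarrow> 'a measure \<Rightarrow> real" where
  "difference_operator x \<psi> \<mu> = \<psi> (add_atom \<mu> x) - \<psi> \<mu>"

definition intensity ::
    "(real \<Rightarrow> (real \<times> real) measure \<Rightarrow> real) \<Rightarrow> real \<Rightarrow> (real \<times> real) measure \<Rightarrow> real" where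
  "intensity \<phi> t \<mu> = \<phi> t (restrict_before t \<mu>)"


section \<open>Poisson processes and thinning\<close>

definition poisson_process ::
    "'a measure \<Rightarrow> (real \<times> real) measure \<Rightarrow> ('a \<Rightarrow> (real \<times> real) measure) \<Rightarrow> bool" where
  "poisson_process M \<nu> N \<longleftrightarrow>
     N \<in> M \<rightarrow>\<^sub>M counting_space \<and>
     (\<forall>A\<in>sets \<nu>. emeasure \<nu> A < \<infinity> \<longrightarrow>
        (\<forall>k. measure M {\<omega> \<in> space M. emeasure (N \<omega>) A = of_nat k} =
             exp (- measure \<nu> A) * measure \<nu> A ^ k / fact k)) \<and>
     (\<forall>F. finite F \<and> F \<subseteq> sets \<nu> \<and> disjoint F \<longrightarrow>
        prob_space.indep_vars M (\<lambda>_. borel) (\<lambda>A \<omega>. emeasure (N \<omega>) A) F)"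

text \<open>The measure \<open>A \<mapsto> \<integral> 1\<^sub>A(t) 1\<^bsub>(0, l(t)]\<^esub>(z) \<mu>(dt \<times> dz)\<close> on the real line.\<close>

definition thinning :: "(real \<Rightarrow> real) \<Rightarrow> (real \<times> real) measure \<Rightarrow> real measure" where
  "thinning l \<mu> = distr (density \<mu> (\<lambda>(t, z). indicator {0<..l t} z)) borel fst"

lemma emeasure_thinning:
  assumes sets: "sets \<mu> = sets (restrict_space borel half_plane)"
    and l [measurable]: "l \<in> borel_measurable borel" and A [measurable]: "A \<in> sets borel"
  shows "emeasure (thinning l \<mu>) A =
    (\<integral>\<^sup>+x. indicator {0<..l (fst x)} (snd x) * indicator (A \<times> {0..}) x \<partial>\<mu>)"
proof -
  have id: "(\<lambda>x. x) \<in> \<mu> \<rightarrow>\<^sub>M borel \<Otimes>\<^sub>M borel"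
    unfolding borel_prod measurable_cong_sets[OF sets refl]
    by (intro measurable_restrict_space1) simp
  have fst [measurable]: "fst \<in> \<mu> \<rightarrow>\<^sub>M borel" and snd [measurable]: "snd \<in> \<mu> \<rightarrow>\<^sub>M borel"
    using measurable_compose[OF id measurable_fst] measurable_compose[OF id measurable_snd]
    by auto
  have ind: "(\<lambda>x. indicator {0<..l (fst x)} (snd x) :: ennreal) \<in> borel_measurable \<mu>"
    unfolding indicator_def greaterThanAtMost_iff by measurable
  have space: "space \<mu> = half_plane"
    using sets_eq_imp_space_eq[OF sets] by (simp add: space_restrict_space)
  have pre: "fst -` A \<inter> space \<mu> \<in> sets \<mu>"
    by measurable
  have "emeasure (thinning l \<mu>) A =
      (\<integral>\<^sup>+x. indicator {0<..l (fst x)} (snd x) * indicator (fst -` A \<inter> space \<mu>) x \<partial>\<mu>)"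
    unfolding thinning_def case_prod_beta using ind pre
    by (subst emeasure_distr) (auto simp: emeasure_density)
  also have "\<dots> = (\<integral>\<^sup>+x. indicator {0<..l (fst x)} (snd x) * indicator (A \<times> {0..}) x \<partial>\<mu>)"
    by (intro nn_integral_cong) (auto simp: space half_plane_def indicator_def)
  finally show ?thesis .
qed


section \<open>Local integrability and Wasserstein distance\<close>

definition locally_integrable_on :: "real set \<Rightarrow> (real \<Rightarrow> real) \<Rightarrow> bool" where
  "locally_integrable_on S f \<longleftrightarrow> (\<forall>K. compact K \<and> K \<subseteq> S \<longrightarrow> set_integrable lborel K f)"

text \<open>The two random variables may live on different probability spaces. The supremum may be
  infinite. The expectations are Bochner integrals, so the definition is meaningful for integrable
  random variables.\<close>

definition wasserstein_dist ::
    "'a measure \<Rightarrow> ('a \<Rightarrow> real) \<Rightarrow> 'b measure \<Rightarrow> ('b \<Rightarrow> real) \<Rightarrow> ennreal" where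
  "wasserstein_dist M X M' Y =
     (SUP g\<in>{g :: real \<Rightarrow> real. 1-lipschitz_on UNIV g}.
        ennreal \<bar>(\<integral>\<omega>. g (X \<omega>) \<partial>M) - (\<integral>\<omega>. g (Y \<omega>) \<partial>M')\<bar>)"

end

theory Submission
  imports Defs "HOL-Real_Asymp.Real_Asymp"
begin

text \<open>By Stein's method the distance is at most the supremum of \<open>\<bar>E[f'(F) - F f(F)]\<bar>\<close> with
  \<open>F = \<delta>(u)\<close>, where \<open>\<bar>f'\<bar> \<le> \<surd>(2/\<pi>)\<close> and \<open>\<bar>f''\<bar> \<le> 2\<close>. Put \<open>U(t, z) = u(t) 1\<^bsub>(0, \<lambda>(t)]\<^esub>(z)\<close>, so that \<open>F\<close>
  is the compensated integral of the predictable process \<open>U\<close>. The Mecke formula gives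
  \<open>E[F f(F)] = E \<integral> U (f(F + U + R) - f(F)) dt dz\<close>, because adding a point at \<open>(t, z)\<close> changes \<open>F\<close> by
  \<open>U + R\<close>; here \<open>R\<close> is the compensated integral of the change of \<open>U\<close> after time \<open>t\<close>. In Taylor's formula
  \<open>U\<^sup>2 f'(F)\<close> yields the first term of the bound and \<open>U R f'(F)\<close> the third. The remainder is at most
  \<open>\<bar>U\<bar> (U + R)\<^sup>2\<close>: the cube yields the second term, the mixed term has mean zero since \<open>R\<close> is a
  martingale increment after \<open>t\<close>, and \<open>\<bar>U\<bar> R\<^sup>2\<close> yields the fourth term by the isometry for
  compensated integrals.\<close>

section \<open>Solutions of Stein's equation\<close>

text \<open>The obstacle is the bare definition of the process: Poisson counts of disjoint sets and
  a sigma-field that comes from the vague topology. Dyadic cells link the two. Cells and cell counts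
  are refined from level to level, so they yield an intersection-stable generator for pairs of a
  point and a measure; on it the Mecke formula is the identity k p(k) = m p(k - 1) for Poisson
  weights p of mean m. No filtration is used. An integrand is predictable if adding a later or
  simultaneous point does not change it, and the indicator of z \<le> \<lambda>(t) can be moved into
  integrals over times after t, which replaces conditioning on the past. The isometry is needed as
  an inequality only, so truncation and Fatou's lemma suffice. Constants: \<surd>(2/\<pi>) is twice
  the normal density at 0. The bound 2 on the second derivative cancels the 1/2 of Taylor's formula,
  whence coefficient 1 in the second and fourth terms. The extra 2 in the third term comes from
  estimating a compensated integral in mean by its two parts, which have equal means.\<close>

lemma nonneg_if_mono_tendsto_at_bot:
  fixes h h' :: "real \<Rightarrow> real"
  assumes d: "\<And>x. (h has_real_derivative h' x) (at x)" and nn: "\<And>x. h' x \<ge> 0"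
    and l: "(h \<longlongrightarrow> 0) at_bot"
  shows "0 \<le> h x"
proof (rule tendsto_upperbound[OF l])
  show "\<forall>\<^sub>F y in at_bot. h y \<le> h x"
    using eventually_le_at_bot[of x]
    by eventually_elim (rule DERIV_nonneg_imp_nondecreasing, assumption, use d nn in blast)
qed simp

text \<open>The value at x dominates all later values and hence their limit. With its mirror image
  above, this reduces most Gaussian inequalities below to the sign of one derivative and one
  limit.\<close>

lemma nonneg_if_antimono_tendsto_at_top:
  fixes h h' :: "real \<Rightarrow> real"
  assumes d: "\<And>y. y \<ge> x \<Longrightarrow> (h has_real_derivative h' y) (at y)" and nn: "\<And>y. y \<ge> x \<Longrightarrow> h' y \<le> 0"
    and l: "(h \<longlongrightarrow> 0) at_top"
  shows "0 \<le> h x"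
proof (rule tendsto_upperbound[OF l])
  show "\<forall>\<^sub>F y in at_top. h y \<le> h x"
    using eventually_ge_at_top[of x]
    by eventually_elim (rule DERIV_nonpos_imp_nonincreasing, assumption, use d nn in blast)
qed simp

section \<open>Integrals over left half lines as functions of the end point\<close>

context
  fixes q :: "real \<Rightarrow> real"
  assumes cont: "continuous_on UNIV q" and int: "integrable lborel q"
begin

lemma integral_atMost_has_real_derivative:
  "((\<lambda>x. LBINT y:{..x}. q y) has_real_derivative q x) (at x)"
proof -
  \<comment> \<open>Near x the integral over the half line is a constant plus an integral over a
    compact interval, to which the fundamental theorem applies; x - 1 is merely some point to the
    left of x.\<close>
  have eq: "(LBINT y:{..z}. q y) = (LBINT y:{..x-1}. q y) + integral {x-1..z} q"
    if "z \<ge> x - 1" for z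
  proof -
    have i: "set_integrable lborel S q" if "S \<in> sets borel" for S
      unfolding set_integrable_def using that int by (intro integrable_mult_indicator) auto
    have "{..z} = {..x-1} \<union> {x-1<..z}"
      using that by auto
    then have "(LBINT y:{..z}. q y) = (LBINT y:{..x-1}. q y) + (LBINT y:{x-1<..z}. q y)"
      by (simp add: set_integral_Un i Int_def)
    also have "(LBINT y:{x-1<..z}. q y) = (LBINT y:{x-1..z}. q y)"
      unfolding set_lebesgue_integral_def
      by (rule integral_cong_AE)
        (use AE_lborel_singleton[of "x-1"] int borel_measurable_integrable[OF int]
          in \<open>auto simp: indicator_def elim!: eventually_mono\<close>)
    also have "\<dots> = integral {x-1..z} q"
      by (rule set_borel_integral_eq_integral) (use i in auto)
    finally show ?thesis .
  qed
  have "((\<lambda>z. integral {x-1..z} q) has_real_derivative q x) (at x within {x-1..x+1})"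
    by (rule integral_has_real_derivative) (use cont in \<open>auto intro: continuous_on_subset\<close>)
  then have "((\<lambda>z. integral {x-1..z} q) has_real_derivative q x) (at x)"
    by (subst (asm) at_within_interior) (auto simp: interior_atLeastAtMost_real)
  then have "((\<lambda>z. (LBINT y:{..x-1}. q y) + integral {x-1..z} q) has_real_derivative q x) (at x)"
    by (auto intro!: derivative_eq_intros)
  moreover have "\<forall>\<^sub>F z in nhds x. z \<in> {x-1<..}"
    by (rule eventually_nhds_in_open) auto
  then have "\<forall>\<^sub>F z in nhds x. (LBINT y:{..z}. q y) = (LBINT y:{..x-1}. q y) + integral {x-1..z} q"
    by (rule eventually_mono) (rule eq, simp)
  ultimately show ?thesis
    by (subst DERIV_cong_ev[OF refl _ refl])
qed

lemma integral_atMost_tendsto_at_top: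
  "((\<lambda>x. LBINT y:{..x}. q y) \<longlongrightarrow> (\<integral>y. q y \<partial>lborel)) at_top"
proof (rule tendsto_at_topI_sequentially)
  fix X :: "nat \<Rightarrow> real" assume X: "filterlim X at_top sequentially"
  show "(\<lambda>n. LBINT y:{..X n}. q y) \<longlonglongrightarrow> (\<integral>y. q y \<partial>lborel)"
    unfolding set_lebesgue_integral_def
  proof (rule integral_dominated_convergence[where w = "\<lambda>x. \<bar>q x\<bar>"])
    show "AE x in lborel. (\<lambda>n. indicator {..X n} x *\<^sub>R q x) \<longlonglongrightarrow> q x"
    proof
      fix x
      from X have "\<forall>\<^sub>F n in sequentially. x \<le> X n"
        unfolding filterlim_at_top_ge[where c=x] by auto
      then show "(\<lambda>n. indicator {..X n} x *\<^sub>R q x) \<longlonglongrightarrow> q x"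
        by (intro tendsto_eventually) (auto elim!: eventually_mono split: split_indicator)
    qed
  qed (use int in \<open>auto simp: indicator_def borel_measurable_integrable\<close>)
qed

lemma integral_atMost_tendsto_at_bot:
  "((\<lambda>x. LBINT y:{..x}. q y) \<longlongrightarrow> 0) at_bot"
  unfolding filterlim_at_bot_mirror
proof (rule tendsto_at_topI_sequentially)
  fix X :: "nat \<Rightarrow> real" assume X: "filterlim X at_top sequentially"
  have "(\<lambda>n. LBINT y:{..- X n}. q y) \<longlonglongrightarrow> (\<integral>y. 0 \<partial>(lborel :: real measure))"
    unfolding set_lebesgue_integral_def
  proof (rule integral_dominated_convergence[where w = "\<lambda>x. \<bar>q x\<bar>"])
    show "AE x in lborel. (\<lambda>n. indicator {..- X n} x *\<^sub>R q x) \<longlonglongrightarrow> 0"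
    proof
      fix x
      from X have "\<forall>\<^sub>F n in sequentially. 1 - x \<le> X n"
        unfolding filterlim_at_top_ge[where c="1-x"] by auto
      then show "(\<lambda>n. indicator {..- X n} x *\<^sub>R q x) \<longlonglongrightarrow> 0"
        by (intro tendsto_eventually) (auto elim!: eventually_mono split: split_indicator)
    qed
  qed (use int in \<open>auto simp: indicator_def borel_measurable_integrable\<close>)
  then show "(\<lambda>n. LBINT y:{..- X n}. q y) \<longlonglongrightarrow> 0"
    by simp
qed

end

section \<open>The standard normal density and distribution function\<close>

abbreviation (input) "npdf \<equiv> std_normal_density"

definition ncdf :: "real \<Rightarrow> real" where
  "ncdf x = (LBINT y:{..x}. npdf y)"

lemma npdf_pos [simp]: "npdf x > 0"
  by (rule normal_density_pos) simp

lemma npdf_neq_0 [simp]: "npdf x \<noteq> 0"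
  using npdf_pos[of x] by linarith

lemma npdf_DERIV [derivative_intros]:
  "(f has_real_derivative f') (at x within S) \<Longrightarrow>
    ((\<lambda>x. npdf (f x)) has_real_derivative - f x * npdf (f x) * f') (at x within S)"
  unfolding std_normal_density_def by (auto intro!: derivative_eq_intros simp: field_simps)

lemma npdf_continuous [continuous_intros]: "continuous_on S f \<Longrightarrow> continuous_on S (\<lambda>x. npdf (f x))"
  unfolding std_normal_density_def by (intro continuous_intros) auto

lemma npdf_even [simp]: "npdf (- x) = npdf x"
  by (simp add: std_normal_density_def)

lemma npdf_tendsto: "(npdf \<longlongrightarrow> 0) at_top" "(npdf \<longlongrightarrow> 0) at_bot"
proof -
  show t: "(npdf \<longlongrightarrow> 0) at_top"
    unfolding std_normal_density_def by real_asymp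
  show "(npdf \<longlongrightarrow> 0) at_bot"
    unfolding filterlim_at_bot_mirror using t by simp
qed

lemma ncdf_DERIV [derivative_intros]:
  "(f has_real_derivative f') (at x within S) \<Longrightarrow>
    ((\<lambda>x. ncdf (f x)) has_real_derivative npdf (f x) * f') (at x within S)"
  unfolding ncdf_def
  by (rule DERIV_chain2[OF integral_atMost_has_real_derivative])
    (auto intro: continuous_intros)

lemma ncdf_tendsto_at_top: "(ncdf \<longlongrightarrow> 1) at_top"
  unfolding ncdf_def[abs_def]
  using integral_atMost_tendsto_at_top[of npdf] npdf_continuous[of UNIV "\<lambda>x. x"] by simp

lemma ncdf_tendsto_at_bot: "(ncdf \<longlongrightarrow> 0) at_bot"
  unfolding ncdf_def[abs_def]
  by (rule integral_atMost_tendsto_at_bot) (auto intro: continuous_intros)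

text \<open>Since the density is even, \<open>ncdf x + ncdf (- x)\<close> has derivative zero; its
  constant value is the limit 1 at infinity.\<close>

lemma ncdf_minus: "ncdf (- x) = 1 - ncdf x"
proof -
  have "((\<lambda>x. ncdf x + ncdf (- x)) \<longlongrightarrow> 1 + 0) at_top"
    using ncdf_tendsto_at_bot unfolding filterlim_at_bot_mirror
    by (intro tendsto_add ncdf_tendsto_at_top)
  moreover have "ncdf y + ncdf (- y) = ncdf x + ncdf (- x)" for y
    by (rule DERIV_isconst_all) (auto intro!: derivative_eq_intros)
  then have "(\<lambda>x. ncdf x + ncdf (- x)) = (\<lambda>_. ncdf x + ncdf (- x))"
    by blast
  ultimately show ?thesis
    by (simp add: tendsto_const_iff)
qed

lemma ncdf_zero: "ncdf 0 = 1 / 2"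
  using ncdf_minus[of 0] by simp

lemma ncdf_nonneg: "0 \<le> ncdf x"
  by (rule nonneg_if_mono_tendsto_at_bot[of _ npdf])
    (auto intro!: derivative_eq_intros ncdf_tendsto_at_bot)

lemma ncdf_le_1: "ncdf x \<le> 1"
  using ncdf_nonneg[of "- x"] by (simp add: ncdf_minus)

lemma abs_npdf_int: "integrable lborel (\<lambda>y. \<bar>y\<bar> * npdf y)"
  using integrable_std_normal_moment_abs[of 1] by (simp add: mult.commute)

text \<open>For y \<le> x \<le> 0 the factor \<open>\<bar>x\<bar>\<close> is at most
  \<open>\<bar>y\<bar>\<close>, so the product is bounded by a tail of the convergent first absolute
  moment.\<close>

lemma abs_ncdf_tendsto_at_bot: "((\<lambda>x. \<bar>x\<bar> * ncdf x) \<longlongrightarrow> 0) at_bot"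
proof (rule tendsto_sandwich[OF _ _ tendsto_const])
  show "((\<lambda>x. LBINT y:{..x}. \<bar>y\<bar> * npdf y) \<longlongrightarrow> 0) at_bot"
    by (rule integral_atMost_tendsto_at_bot) (auto intro!: continuous_intros abs_npdf_int)
  show "\<forall>\<^sub>F x in at_bot. \<bar>x\<bar> * ncdf x \<le> (LBINT y:{..x}. \<bar>y\<bar> * npdf y)"
    using eventually_le_at_bot[of 0]
  proof eventually_elim
    case (elim x)
    have "\<bar>x\<bar> * ncdf x = (LBINT y:{..x}. \<bar>x\<bar> * npdf y)"
      by (simp add: ncdf_def)
    also have "\<dots> \<le> (LBINT y:{..x}. \<bar>y\<bar> * npdf y)"
      unfolding set_lebesgue_integral_def
      by (rule integral_mono)
        (use elim integrable_mult_indicator[of "{..x}" lborel, OF _ abs_npdf_int]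
          integrable_mult_indicator[of "{..x}" lborel, OF _ integrable_mult_right[OF integrable_normal_density]]
          in \<open>auto intro!: mult_right_mono split: split_indicator\<close>)
    finally show ?case .
  qed
qed (auto simp: ncdf_nonneg)

lemma abs_ncdf_tendsto_at_top: "((\<lambda>x. \<bar>x\<bar> * (1 - ncdf x)) \<longlongrightarrow> 0) at_top"
  using abs_ncdf_tendsto_at_bot unfolding filterlim_at_bot_mirror by (simp add: ncdf_minus)

text \<open>\<open>nA x\<close> is the integral of \<^const>\<open>ncdf\<close> over \<open>(-\<infinity>, x]\<close> and \<open>nB x\<close> that of \<open>1 - ncdf\<close> over
  \<open>[x, \<infinity>)\<close>. They dominate the two parts of the solution of Stein's equation.\<close>

definition nA :: "real \<Rightarrow> real" where "nA x = x * ncdf x + npdf x"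
definition nB :: "real \<Rightarrow> real" where "nB x = npdf x - x * (1 - ncdf x)"

lemma nA_DERIV: "(nA has_real_derivative ncdf x) (at x)"
  unfolding nA_def[abs_def] by (auto intro!: derivative_eq_intros)

lemma nB_DERIV: "(nB has_real_derivative - (1 - ncdf x)) (at x)"
  unfolding nB_def[abs_def] by (auto intro!: derivative_eq_intros)

lemma nA_tendsto: "(nA \<longlongrightarrow> 0) at_bot"
proof -
  have "((\<lambda>x. - (\<bar>x\<bar> * ncdf x) + npdf x) \<longlongrightarrow> - 0 + 0) at_bot"
    by (intro tendsto_add tendsto_minus abs_ncdf_tendsto_at_bot npdf_tendsto)
  then have "((\<lambda>x. - (\<bar>x\<bar> * ncdf x) + npdf x) \<longlongrightarrow> 0) at_bot"
    by simp
  then show ?thesis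
    unfolding nA_def[abs_def]
    by (rule Lim_transform_eventually)
      (use eventually_le_at_bot[of 0] in \<open>eventually_elim, auto\<close>)
qed

lemma nB_tendsto: "(nB \<longlongrightarrow> 0) at_top"
proof -
  have "((\<lambda>x. npdf x - (\<bar>x\<bar> * (1 - ncdf x))) \<longlongrightarrow> 0 - 0) at_top"
    by (intro tendsto_diff abs_ncdf_tendsto_at_top npdf_tendsto)
  then have "((\<lambda>x. npdf x - (\<bar>x\<bar> * (1 - ncdf x))) \<longlongrightarrow> 0) at_top"
    by simp
  then show ?thesis
    unfolding nB_def[abs_def]
    by (rule Lim_transform_eventually)
      (use eventually_ge_at_top[of 0] in \<open>eventually_elim, auto\<close>)
qed

lemma nA_nonneg: "0 \<le> nA x"
  by (rule nonneg_if_mono_tendsto_at_bot[OF nA_DERIV _ nA_tendsto]) (rule ncdf_nonneg)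

lemma nB_nonneg: "0 \<le> nB x"
  by (rule nonneg_if_antimono_tendsto_at_top[OF nB_DERIV _ nB_tendsto]) (simp add: ncdf_le_1)

lemma nB_minus: "nB (- x) = nA x"
  by (simp add: nA_def nB_def ncdf_minus)

section \<open>Mills ratio inequalities and the maximum of \<open>nA * nB / npdf\<close>\<close>

lemma mills_upper: "x * nB x \<le> 1 - ncdf x"
proof -
  \<comment> \<open>Nonnegativity of \<open>h\<close> is the classical lower bound for the Gaussian
    tail; multiplied by 1 + x^2 and rearranged it is the claim.\<close>
  define h where "h x = 1 - ncdf x - x * npdf x / (1 + x\<^sup>2)" for x
  have pos: "1 + x\<^sup>2 > 0" for x :: real
    by (rule add_pos_nonneg) auto
  have "0 \<le> h x"
  proof (rule nonneg_if_antimono_tendsto_at_top[where h=h and x=x])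
    show "(h has_real_derivative - 2 * npdf y / (1 + y\<^sup>2)\<^sup>2) (at y)" for y
      unfolding h_def[abs_def] using pos[of y]
      by (auto intro!: derivative_eq_intros simp: divide_simps power2_eq_square add_nonneg_eq_0_iff) (simp add: algebra_simps)
    show "- 2 * npdf y / (1 + y\<^sup>2)\<^sup>2 \<le> 0" for y
      by (simp add: less_imp_le)
    have "((\<lambda>x. 1 - ncdf x - (x / (1 + x\<^sup>2)) * npdf x) \<longlongrightarrow> 1 - 1 - 0 * 0) at_top"
      by (intro tendsto_diff tendsto_const ncdf_tendsto_at_top tendsto_mult npdf_tendsto) real_asymp
    then show "(h \<longlongrightarrow> 0) at_top"
      by (simp add: h_def[abs_def])
  qed
  then have "x * npdf x \<le> (1 - ncdf x) * (1 + x\<^sup>2)"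
    using pos[of x] by (simp add: h_def field_simps)
  then show ?thesis
    by (simp add: nB_def power2_eq_square algebra_simps)
qed

lemma mills_lower: "- x * nA x \<le> ncdf x"
  using mills_upper[of "- x"] by (simp add: ncdf_minus nB_minus)

text \<open>Both sides agree at 0 and their derivatives are ordered. The inequality is the sign of
  the numerator of \<open>h'\<close> in \<open>nA_nB_aux\<close>.\<close>

lemma two_ncdf_bound:
  assumes "0 \<le> x"
  shows "(2 * ncdf x - 1) * (2 - x\<^sup>2) \<le> 4 * x * npdf x"
proof -
  \<comment> \<open>\<open>k\<close> is the factor that remains when \<open>h\<close> below is
    differentiated: the derivative of \<open>h\<close> is \<open>2 * y * k y\<close>.\<close>
  define k where "k x = 2 * ncdf x - 1 - x * npdf x" for x
  have k: "0 \<le> k y" if "0 \<le> y" for y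
  proof -
    have "k 0 \<le> k y"
    proof (rule DERIV_nonneg_imp_nondecreasing[OF that])
      show "\<exists>d. (k has_real_derivative d) (at y) \<and> 0 \<le> d" for y
        unfolding k_def[abs_def]
        by (rule exI[of _ "npdf y * (1 + y\<^sup>2)"], rule conjI)
          (auto intro!: derivative_eq_intros simp: power2_eq_square distrib_left)
    qed
    then show ?thesis
      by (simp add: k_def ncdf_zero)
  qed
  define h where "h x = 4 * x * npdf x - (2 * ncdf x - 1) * (2 - x\<^sup>2)" for x
  have "h 0 \<le> h x"
  proof (rule DERIV_nonneg_imp_nondecreasing[OF assms])
    show "\<exists>d. (h has_real_derivative d) (at y) \<and> 0 \<le> d" if "0 \<le> y" for y
    proof (intro exI conjI)
      show "(h has_real_derivative 2 * y * k y) (at y)"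
        unfolding h_def[abs_def]
        by (auto intro!: derivative_eq_intros simp: k_def power2_eq_square algebra_simps)
      show "0 \<le> 2 * y * k y"
        using k[OF that] that by simp
    qed
  qed
  then show ?thesis
    by (simp add: h_def ncdf_zero)
qed

text \<open>Up to a positive factor, the two sides differ by minus the derivative of \<open>nA * nB / npdf\<close>.\<close>

lemma nA_nB_aux:
  assumes x: "0 < x"
  shows "((1 + x\<^sup>2) * (2 * ncdf x - 1) * npdf x + x * (npdf x)\<^sup>2) / (x * (x\<^sup>2 + 2))
    \<le> ncdf x * (1 - ncdf x)"
proof -
  define h where "h x = ncdf x * (1 - ncdf x)
    - ((1 + x\<^sup>2) * (2 * ncdf x - 1) * npdf x + x * (npdf x)\<^sup>2) / (x * (x\<^sup>2 + 2))" for x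
  define h' where "h' x = npdf x * ((2 * ncdf x - 1) * (2 - x\<^sup>2) - 4 * x * npdf x)
    / (x * (x\<^sup>2 + 2))\<^sup>2" for x
  have "0 \<le> h x"
  proof (rule nonneg_if_antimono_tendsto_at_top[where h=h and x=x])
    fix y assume "x \<le> y"
    then have y: "0 < y"
      using x by simp
    have nz: "y * (y\<^sup>2 + 2) \<noteq> 0"
      using y by (simp add: add_nonneg_pos less_imp_neq[THEN not_sym])
    define N' where "N' = 2 * y * (2 * ncdf y - 1) * npdf y + (1 + y\<^sup>2) * (2 * npdf y) * npdf y
      - y * (1 + y\<^sup>2) * (2 * ncdf y - 1) * npdf y + (npdf y)\<^sup>2 - 2 * y\<^sup>2 * (npdf y)\<^sup>2"
    let ?N = "\<lambda>x. (1 + x\<^sup>2) * (2 * ncdf x - 1) * npdf x + x * (npdf x)\<^sup>2"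
    let ?Q = "\<lambda>x::real. x * (x\<^sup>2 + 2)"
    have N: "(?N has_real_derivative N') (at y)"
      unfolding N'_def
      by (auto intro!: derivative_eq_intros) (simp add: power2_eq_square algebra_simps)
    have Q: "(?Q has_real_derivative 3 * y\<^sup>2 + 2) (at y)"
      by (auto intro!: derivative_eq_intros simp: power2_eq_square)
    have P: "((\<lambda>x. ncdf x * (1 - ncdf x)) has_real_derivative - (2 * ncdf y - 1) * npdf y) (at y)"
      by (auto intro!: derivative_eq_intros simp: algebra_simps)
    \<comment> \<open>T and p stand for \<open>2 * ncdf y - 1\<close> and \<open>npdf y\<close>;
      treated as free variables they turn the outcome of the quotient rule into a polynomial
      identity.\<close>
    have poly: "- T * p * (y * (y\<^sup>2 + 2))\<^sup>2 - (2 * y * T * p + (1 + y\<^sup>2) * (2 * p) * p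
        - y * (1 + y\<^sup>2) * T * p + p\<^sup>2 - 2 * y\<^sup>2 * p\<^sup>2) * (y * (y\<^sup>2 + 2))
        + ((1 + y\<^sup>2) * T * p + y * p\<^sup>2) * (3 * y\<^sup>2 + 2) = p * (T * (2 - y\<^sup>2) - 4 * y * p)"
      for T p :: real
      by algebra
    have quot: "- T * p - (n * q - m * q') / q\<^sup>2 = (- T * p * q\<^sup>2 - n * q + m * q') / q\<^sup>2"
      if "q \<noteq> 0" for T p n m q q' :: real
      using that by (simp add: field_simps)
    have "(h has_real_derivative (- (2 * ncdf y - 1) * npdf y
        - (N' * ?Q y - ?N y * (3 * y\<^sup>2 + 2)) / (?Q y)\<^sup>2)) (at y)"
      unfolding h_def[abs_def]
      using DERIV_diff[OF P DERIV_divide[OF N Q nz]] by (simp add: power2_eq_square)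
    also have "- (2 * ncdf y - 1) * npdf y - (N' * ?Q y - ?N y * (3 * y\<^sup>2 + 2)) / (?Q y)\<^sup>2 = h' y"
      unfolding quot[OF nz] h'_def N'_def poly ..
    finally show "(h has_real_derivative h' y) (at y)" .
    show "h' y \<le> 0"
      unfolding h'_def using two_ncdf_bound[of y] y
      by (intro divide_nonpos_nonneg mult_nonneg_nonpos) (auto simp: less_imp_le)
  next
    have "((\<lambda>x. ncdf x * (1 - ncdf x) - ((1 + x\<^sup>2) / (x * (x\<^sup>2 + 2)) * ((2 * ncdf x - 1) * npdf x)
        + x / (x * (x\<^sup>2 + 2)) * (npdf x)\<^sup>2)) \<longlongrightarrow> 1 * (1 - 1) - (0 * ((2 * 1 - 1) * 0) + 0 * 0\<^sup>2)) at_top"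
      by (intro tendsto_diff tendsto_add tendsto_mult tendsto_power tendsto_const npdf_tendsto
          ncdf_tendsto_at_top) real_asymp+
    moreover have "h = (\<lambda>x. ncdf x * (1 - ncdf x) - ((1 + x\<^sup>2) / (x * (x\<^sup>2 + 2)) * ((2 * ncdf x - 1) * npdf x)
        + x / (x * (x\<^sup>2 + 2)) * (npdf x)\<^sup>2))"
      unfolding h_def[abs_def] add_divide_distrib[of "_ * npdf _"] by (simp only: times_divide_eq_left mult.assoc)
    ultimately show "(h \<longlongrightarrow> 0) at_top"
      by simp
  qed
  then show ?thesis
    by (simp add: h_def)
qed

text \<open>The quotient \<open>nA x * nB x / npdf x\<close> is even, because reflection swaps
  \<open>nA\<close> and \<open>nB\<close>, and it decreases for x \<ge> 0. Its maximum is therefore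
  at 0, where all three functions equal \<open>npdf 0\<close>. Twice this value is the bound
  \<surd>(2/\<pi>) for the first derivative of the Stein solution.\<close>

lemma nA_nB_le: "nA x * nB x \<le> npdf 0 * npdf x"
proof -
  have *: "nA x * nB x \<le> npdf 0 * npdf x" if x: "0 \<le> x" for x
  proof -
    define w where "w x = nA x * nB x / npdf x" for x
    have "w x \<le> w 0"
    proof (rule DERIV_nonpos_imp_nonincreasing[OF x])
      fix y :: real assume y: "0 \<le> y"
      define d where "d = (ncdf y * nB y - (1 - ncdf y) * nA y + y * nA y * nB y) / npdf y"
      have "(w has_real_derivative d) (at y)"
        unfolding w_def[abs_def] d_def
        by (rule derivative_eq_intros nA_DERIV nB_DERIV refl npdf_neq_0)+
          (simp add: divide_simps, simp add: algebra_simps)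
      moreover have "d \<le> 0"
      proof (cases "y = 0")
        case True
        then show ?thesis
          by (simp add: d_def nA_def nB_def ncdf_zero)
      next
        case False
        with y have y: "0 < y" by simp
        then have "y * (y\<^sup>2 + 2) > 0"
          by (simp add: add_nonneg_pos)
        from nA_nB_aux[OF y] this
        have "(1 + y\<^sup>2) * (2 * ncdf y - 1) * npdf y + y * (npdf y)\<^sup>2
            \<le> ncdf y * (1 - ncdf y) * (y * (y\<^sup>2 + 2))"
          by (simp add: pos_divide_le_eq)
        then show ?thesis
          unfolding d_def nA_def nB_def
          by (intro divide_nonpos_pos) (auto simp: power2_eq_square algebra_simps)
      qed
      ultimately show "\<exists>d. (w has_real_derivative d) (at y) \<and> d \<le> 0"
        by blast
    qed
    then show ?thesis
      by (simp add: w_def nA_def nB_def divide_simps power2_eq_square)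
  qed
  show ?thesis
    using *[of x] *[of "- x"] nB_minus[of x] nB_minus[of "- x"]
    by (cases "0 \<le> x") (auto simp: mult.commute)
qed

text \<open>The solution is expressed through integrals \<open>A\<close> and \<open>B\<close> of
  \<open>g'\<close> rather than of \<open>g\<close>, so that the bound on \<open>g'\<close> gives
  \<open>\<bar>A\<bar> \<le> nA\<close> and \<open>\<bar>B\<bar> \<le> nB\<close>. In
  \<open>f\<close>, \<open>f'\<close> and \<open>f'' - g'\<close> the coefficients of
  \<open>A\<close> and \<open>B\<close> have fixed signs. The extreme cases of the three numerators
  are \<open>npdf\<close>, \<open>2 * nA * nB\<close> and \<open>npdf\<close>, each to be divided by
  \<open>npdf\<close>.\<close>

lemma stein_solution:
  fixes g g' :: "real \<Rightarrow> real"
  assumes g: "\<And>x. (g has_real_derivative g' x) (at x)" and g': "\<And>x. \<bar>g' x\<bar> \<le> 1"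
  obtains f f' f'' where "\<And>x. (f has_real_derivative f' x) (at x)"
    "\<And>x. (f' has_real_derivative f'' x) (at x)"
    "\<And>x. \<bar>f x\<bar> \<le> 1" "\<And>x. \<bar>f' x\<bar> \<le> sqrt (2 / pi)" "\<And>x. \<bar>f'' x\<bar> \<le> 2"
    "\<And>x. f' x - x * f x = g x - (\<integral>y. npdf y * g y \<partial>lborel)"
proof -
  have g_cont: "continuous_on UNIV g"
    using g by (intro DERIV_continuous_on[of _ _ g']) (auto intro: has_field_derivative_at_within)
  have g_bound: "\<bar>g x\<bar> \<le> \<bar>g 0\<bar> + \<bar>x\<bar>" for x
  proof -
    have "norm (g x - g 0) \<le> 1 * norm (x - 0)"
      by (rule field_differentiable_bound[of UNIV _ g'])
        (use g g' in \<open>auto intro: has_field_derivative_at_within\<close>)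
    then show ?thesis
      by simp
  qed
  have qi: "integrable lborel (\<lambda>y. npdf y * g y)"
  proof (rule Bochner_Integration.integrable_bound)
    show "integrable lborel (\<lambda>y. npdf y * \<bar>g 0\<bar> + \<bar>y\<bar> * npdf y)"
      using abs_npdf_int by simp
    show "(\<lambda>y. npdf y * g y) \<in> borel_measurable lborel"
      using borel_measurable_continuous_onI[OF g_cont] by simp
    show "AE y in lborel. norm (npdf y * g y) \<le> norm (npdf y * \<bar>g 0\<bar> + \<bar>y\<bar> * npdf y)"
    proof (rule AE_I2)
      fix y
      have "npdf y * \<bar>g y\<bar> \<le> npdf y * (\<bar>g 0\<bar> + \<bar>y\<bar>)"
        by (intro mult_left_mono g_bound) simp
      then show "norm (npdf y * g y) \<le> norm (npdf y * \<bar>g 0\<bar> + \<bar>y\<bar> * npdf y)"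
        by (simp add: abs_mult distrib_left mult.commute)
    qed
  qed
  have qc: "continuous_on UNIV (\<lambda>y. npdf y * g y)"
    by (intro continuous_intros g_cont)
  define c where "c = (\<integral>y. npdf y * g y \<partial>lborel)"
  define q where "q x = (LBINT y:{..x}. npdf y * g y)" for x
  have q_DERIV: "(q has_real_derivative npdf x * g x) (at x)" for x
    unfolding q_def[abs_def] by (rule integral_atMost_has_real_derivative[OF qc qi])
  \<comment> \<open>\<open>A x\<close> and \<open>B x\<close> are the integrals of \<open>g' * ncdf\<close> over \<open>(-\<infinity>, x]\<close> and of \<open>g' * (1 - ncdf)\<close>
    over \<open>[x, \<infinity>)\<close>; writing them through \<open>g\<close> makes \<open>A - B = g - c\<close> an identity.\<close>
  define A where "A x = g x * ncdf x - q x" for x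
  define B where "B x = (c - q x) - g x * (1 - ncdf x)" for x
  have A_DERIV: "(A has_real_derivative g' x * ncdf x) (at x)" for x
    unfolding A_def[abs_def] by (rule derivative_eq_intros g q_DERIV refl)+ simp
  have B_DERIV: "(B has_real_derivative - g' x * (1 - ncdf x)) (at x)" for x
    unfolding B_def[abs_def] by (rule derivative_eq_intros g q_DERIV refl)+ (simp add: algebra_simps)
  have AB: "A x - B x = g x - c" for x
    by (simp add: A_def B_def algebra_simps)
  have g_le: "\<bar>g x * p\<bar> \<le> \<bar>\<bar>g 0\<bar> * p + \<bar>x\<bar> * p\<bar>" if "0 \<le> p" for x p
    using mult_right_mono[OF g_bound that, of x] that by (simp add: abs_mult distrib_right)
  have "((\<lambda>x. g x * ncdf x) \<longlongrightarrow> 0) at_bot"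
  proof (rule tendsto_0_le[where K=1])
    show "((\<lambda>x. \<bar>g 0\<bar> * ncdf x + \<bar>x\<bar> * ncdf x) \<longlongrightarrow> 0) at_bot"
      using tendsto_add[OF tendsto_mult_left[OF ncdf_tendsto_at_bot] abs_ncdf_tendsto_at_bot]
      by simp
    show "\<forall>\<^sub>F x in at_bot. norm (g x * ncdf x) \<le> norm (\<bar>g 0\<bar> * ncdf x + \<bar>x\<bar> * ncdf x) * 1"
      using g_le[OF ncdf_nonneg] by (intro always_eventually) simp
  qed
  from tendsto_diff[OF this integral_atMost_tendsto_at_bot[OF qc qi]]
  have A_lim: "(A \<longlongrightarrow> 0) at_bot"
    by (simp add: A_def[abs_def] q_def[abs_def])
  have "((\<lambda>x. g x * (1 - ncdf x)) \<longlongrightarrow> 0) at_top"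
  proof (rule tendsto_0_le[where K=1])
    have "((\<lambda>x. \<bar>g 0\<bar> * (1 - ncdf x)) \<longlongrightarrow> \<bar>g 0\<bar> * (1 - 1)) at_top"
      by (intro tendsto_mult_left tendsto_diff tendsto_const ncdf_tendsto_at_top)
    from tendsto_add[OF this abs_ncdf_tendsto_at_top]
    show "((\<lambda>x. \<bar>g 0\<bar> * (1 - ncdf x) + \<bar>x\<bar> * (1 - ncdf x)) \<longlongrightarrow> 0) at_top"
      by simp
    show "\<forall>\<^sub>F x in at_top. norm (g x * (1 - ncdf x))
        \<le> norm (\<bar>g 0\<bar> * (1 - ncdf x) + \<bar>x\<bar> * (1 - ncdf x)) * 1"
      using g_le[of "1 - ncdf _"] ncdf_le_1 by (intro always_eventually) simp
  qed
  from tendsto_diff[OF tendsto_diff[OF tendsto_const integral_atMost_tendsto_at_top[OF qc qi]] this]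
  have B_lim: "(B \<longlongrightarrow> 0) at_top"
    unfolding B_def[abs_def] q_def c_def by (metis (no_types) diff_self)
  have sgn_le: "1 + s * g' x \<ge> 0" if "s = 1 \<or> s = -1" for s x
    using g'[of x] that by (auto simp: abs_le_iff)
  have A_le: "\<bar>A x\<bar> \<le> nA x" for x
  proof -
    have "0 \<le> nA x + s * A x" if s: "s = 1 \<or> s = -1" for s
    proof (rule nonneg_if_mono_tendsto_at_bot[where h = "\<lambda>x. nA x + s * A x"])
      show "((\<lambda>x. nA x + s * A x) has_real_derivative (1 + s * g' y) * ncdf y) (at y)" for y
        by (auto intro!: derivative_eq_intros nA_DERIV A_DERIV simp: algebra_simps)
      show "0 \<le> (1 + s * g' y) * ncdf y" for y
        using sgn_le[OF s] ncdf_nonneg by simp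
      show "((\<lambda>x. nA x + s * A x) \<longlongrightarrow> 0) at_bot"
        using tendsto_add[OF nA_tendsto tendsto_mult_left[OF A_lim]] by simp
    qed
    from this[of 1] this[of "-1"] show ?thesis
      by auto
  qed
  have B_le: "\<bar>B x\<bar> \<le> nB x" for x
  proof -
    have "0 \<le> nB x + s * B x" if s: "s = 1 \<or> s = -1" for s
    proof (rule nonneg_if_antimono_tendsto_at_top[where h = "\<lambda>x. nB x + s * B x"])
      show "((\<lambda>x. nB x + s * B x) has_real_derivative - ((1 + s * g' y) * (1 - ncdf y))) (at y)" for y
        by (auto intro!: derivative_eq_intros nB_DERIV B_DERIV simp: algebra_simps)
      show "- ((1 + s * g' y) * (1 - ncdf y)) \<le> 0" for y
        using sgn_le[OF s] ncdf_le_1 by simp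
      show "((\<lambda>x. nB x + s * B x) \<longlongrightarrow> 0) at_top"
        using tendsto_add[OF nB_tendsto tendsto_mult_left[OF B_lim]] by simp
    qed
    from this[of 1] this[of "-1"] show ?thesis
      by auto
  qed
  define f where "f x = - ((1 - ncdf x) * A x + ncdf x * B x) / npdf x" for x
  define f' where "f' x = x * f x + g x - c" for x
  define f'' where "f'' x = f x + x * f' x + g' x" for x
  have f'_eq: "f' x = (A x * nB x - B x * nA x) / npdf x" for x
  proof -
    have "f' x = x * f x + (A x - B x)"
      by (simp add: f'_def AB)
    also have "\<dots> = (A x * nB x - B x * nA x) / npdf x"
      unfolding f_def nA_def nB_def by (simp add: divide_simps) (simp add: algebra_simps)
    finally show ?thesis .
  qed
  have f''_eq: "f'' x = g' x - (A x * (1 - ncdf x - x * nB x) + B x * (ncdf x + x * nA x)) / npdf x" for x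
    unfolding f''_def f'_eq f_def nA_def nB_def
    by (simp add: divide_simps) (simp add: algebra_simps)
  \<comment> \<open>In the extreme case \<open>A = nA\<close>, \<open>B = nB\<close> the numerator
    of \<open>f\<close> is the density itself, which gives the bound 1. The same identity serves for
    \<open>f''\<close>, where the terms with \<open>x * nA x * nB x\<close> cancel.\<close>
  have w: "(1 - ncdf x) * nA x + ncdf x * nB x = npdf x" for x
    by (simp add: nA_def nB_def algebra_simps)
  show ?thesis
  proof
    show "(f has_real_derivative f' x) (at x)" for x
    proof -
      have "(f has_real_derivative (x * f x + (A x - B x))) (at x)"
        unfolding f_def[abs_def]
        by (rule derivative_eq_intros A_DERIV B_DERIV refl npdf_neq_0)+
          (simp add: divide_simps, simp add: algebra_simps)
      then show ?thesis
        by (simp add: f'_def AB algebra_simps)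
    qed
    then show "(f' has_real_derivative f'' x) (at x)" for x
      unfolding f'_def[abs_def] f''_def
      by (auto intro!: derivative_eq_intros g simp: f'_def algebra_simps)
    show "\<bar>f x\<bar> \<le> 1" for x
    proof -
      have "\<bar>(1 - ncdf x) * A x + ncdf x * B x\<bar> \<le> (1 - ncdf x) * \<bar>A x\<bar> + ncdf x * \<bar>B x\<bar>"
        using abs_triangle_ineq[of "(1 - ncdf x) * A x" "ncdf x * B x"]
        by (simp add: abs_mult ncdf_nonneg ncdf_le_1)
      also have "\<dots> \<le> (1 - ncdf x) * nA x + ncdf x * nB x"
        by (intro add_mono mult_left_mono A_le B_le) (auto simp: ncdf_nonneg ncdf_le_1)
      finally show ?thesis
        unfolding w f_def by (simp add: abs_divide pos_divide_le_eq)
    qed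
    show "\<bar>f' x\<bar> \<le> sqrt (2 / pi)" for x
    proof -
      have "\<bar>A x * nB x - B x * nA x\<bar> \<le> \<bar>A x\<bar> * nB x + \<bar>B x\<bar> * nA x"
        using abs_triangle_ineq4[of "A x * nB x" "B x * nA x"] by (simp add: abs_mult nA_nonneg nB_nonneg)
      also have "\<dots> \<le> nA x * nB x + nB x * nA x"
        by (intro add_mono mult_right_mono A_le B_le nA_nonneg nB_nonneg)
      also have "\<dots> \<le> 2 * npdf 0 * npdf x"
        using nA_nB_le[of x] by (simp add: mult.commute)
      finally have "\<bar>f' x\<bar> \<le> 2 * npdf 0"
        unfolding f'_eq by (simp add: abs_divide pos_divide_le_eq)
      also have "2 * npdf 0 = sqrt (2 / pi)"
        by (simp add: std_normal_density_def real_sqrt_mult real_sqrt_divide divide_simps)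
      finally show ?thesis .
    qed
    show "\<bar>f'' x\<bar> \<le> 2" for x
    proof -
      have m: "0 \<le> 1 - ncdf x - x * nB x" "0 \<le> ncdf x + x * nA x"
        using mills_upper[of x] mills_lower[of x] by auto
      have "\<bar>A x * (1 - ncdf x - x * nB x) + B x * (ncdf x + x * nA x)\<bar>
          \<le> \<bar>A x\<bar> * (1 - ncdf x - x * nB x) + \<bar>B x\<bar> * (ncdf x + x * nA x)"
        using abs_triangle_ineq[of "A x * (1 - ncdf x - x * nB x)" "B x * (ncdf x + x * nA x)"]
        by (simp add: abs_mult abs_of_nonneg[OF m(1)] abs_of_nonneg[OF m(2)])
      also have "\<dots> \<le> nA x * (1 - ncdf x - x * nB x) + nB x * (ncdf x + x * nA x)"
        by (intro add_mono mult_right_mono A_le B_le m)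
      also have "\<dots> = npdf x"
        using w[of x] by (simp add: algebra_simps)
      finally have "\<bar>(A x * (1 - ncdf x - x * nB x) + B x * (ncdf x + x * nA x)) / npdf x\<bar> \<le> 1"
        by (simp add: abs_divide pos_divide_le_eq)
      \<comment> \<open>One unit of the bound 2 comes from the quotient, the other from
        \<open>g'\<close>.\<close>
      with g'[of x] show ?thesis
        unfolding f''_eq by linarith
    qed
    show "f' x - x * f x = g x - (\<integral>y. npdf y * g y \<partial>lborel)" for x
      by (simp add: f'_def c_def)
  qed
qed

text \<open>The approximation is the mean of \<open>g\<close> over \<open>[x, x + e]\<close>. Its
  derivative is a difference quotient of \<open>g\<close>, hence at most 1 in absolute value, and by
  the mean value theorem it equals a value of \<open>g\<close> at distance less than
  \<open>e\<close>.\<close>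

lemma smooth_lipschitz_approx:
  fixes g :: "real \<Rightarrow> real"
  assumes g: "1-lipschitz_on UNIV g" and e: "0 < e"
  obtains h h' where "\<And>x. (h has_real_derivative h' x) (at x)" "\<And>x. \<bar>h' x\<bar> \<le> 1"
    "\<And>x. \<bar>h x - g x\<bar> \<le> e"
proof -
  have lip: "\<bar>g x - g y\<bar> \<le> \<bar>x - y\<bar>" for x y
    using lipschitz_onD[OF g, of x y] by (simp add: dist_real_def)
  have cont: "continuous_on S g" for S
    using lipschitz_on_continuous_on[OF g] continuous_on_subset by blast
  have int: "g integrable_on {a..b}" for a b
    by (rule integrable_continuous_real[OF cont])
  define G where "G x = (if 0 \<le> x then integral {0..x} g else - integral {x..0} g)" for x
  have Gd: "G b - G a = integral {a..b} g" if "a \<le> b" for a b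
  proof -
    have "integral {a..b} g = integral {a..0} g + integral {0..b} g" if "a \<le> 0" "0 \<le> b"
      using that by (intro Henstock_Kurzweil_Integration.integral_combine[symmetric] int)
    moreover have "integral {0..b} g = integral {0..a} g + integral {a..b} g" if "0 \<le> a"
      using that \<open>a \<le> b\<close> by (intro Henstock_Kurzweil_Integration.integral_combine[symmetric] int)
    moreover have "integral {a..0} g = integral {a..b} g + integral {b..0} g" if "b \<le> 0"
      using that \<open>a \<le> b\<close> by (intro Henstock_Kurzweil_Integration.integral_combine[symmetric] int)
    ultimately show ?thesis
      using that by (auto simp: G_def not_le)
  qed
  have G: "(G has_real_derivative g x) (at x)" for x
  proof -
    have "((\<lambda>z. integral {x-1..z} g) has_real_derivative g x) (at x within {x-1..x+1})"
      by (rule integral_has_real_derivative) (use cont in auto)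
    then have "((\<lambda>z. integral {x-1..z} g) has_real_derivative g x) (at x)"
      by (subst (asm) at_within_interior) (auto simp: interior_atLeastAtMost_real)
    then have *: "((\<lambda>z. G (x-1) + integral {x-1..z} g) has_real_derivative g x) (at x)"
      by (auto intro!: derivative_eq_intros)
    have "\<forall>\<^sub>F z in nhds x. z \<in> {x-1<..}"
      by (rule eventually_nhds_in_open) auto
    then have "\<forall>\<^sub>F z in nhds x. G z = G (x-1) + integral {x-1..z} g"
    proof (rule eventually_mono)
      show "G z = G (x-1) + integral {x-1..z} g" if "z \<in> {x-1<..}" for z
        using Gd[of "x-1" z] that by auto
    qed
    then show ?thesis
      using * by (subst DERIV_cong_ev[OF refl _ refl])
  qed
  show ?thesis
  proof
    show "((\<lambda>x. (G (x + e) - G x) / e) has_real_derivative (g (x + e) - g x) / e) (at x)" for x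
      using e by (auto intro!: derivative_eq_intros DERIV_chain2[OF G] G)
    show "\<bar>(g (x + e) - g x) / e\<bar> \<le> 1" for x
      using lip[of "x + e" x] e by (simp add: abs_divide pos_divide_le_eq)
    show "\<bar>(G (x + e) - G x) / e - g x\<bar> \<le> e" for x
    proof -
      obtain z where z: "x < z" "z < x + e" "G (x + e) - G x = (x + e - x) * g z"
        using MVT2[of x "x + e" G g] G e by auto
      then have "(G (x + e) - G x) / e = g z"
        using e by simp
      then show ?thesis
        using lip[of z x] z by auto
    qed
  qed
qed

section \<open>Dyadic cells and the space of counting measures\<close>

abbreviation hp_borel :: "(real \<times> real) measure" where
  "hp_borel \<equiv> restrict_space borel half_plane"

lemma half_plane_closed: "closed half_plane"
  unfolding half_plane_def by (intro closed_Times) auto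

lemma half_plane_borel [measurable]: "half_plane \<in> sets borel"
  using half_plane_closed by (rule borel_closed)

lemma space_hp_borel [simp]: "space hp_borel = half_plane"
  by (simp add: space_restrict_space)

lemma sets_half_plane_lebesgue: "sets half_plane_lebesgue = sets hp_borel"
  unfolding half_plane_lebesgue_def by (simp add: sets_restrict_space)

lemma hp_borel_id: "(\<lambda>x. x) \<in> hp_borel \<rightarrow>\<^sub>M borel \<Otimes>\<^sub>M borel"
  unfolding borel_prod by (intro measurable_restrict_space1) simp

lemma hp_borel_fst [measurable]: "fst \<in> hp_borel \<rightarrow>\<^sub>M borel"
  and hp_borel_snd [measurable]: "snd \<in> hp_borel \<rightarrow>\<^sub>M borel"
  using measurable_compose[OF hp_borel_id measurable_fst]
    measurable_compose[OF hp_borel_id measurable_snd] by auto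

section \<open>The dyadic grid, its cells and its windows\<close>

definition grid :: "nat \<Rightarrow> real \<times> real \<Rightarrow> int \<times> int" where
  "grid n x = (\<lfloor>2 ^ n * fst x\<rfloor>, \<lfloor>2 ^ n * snd x\<rfloor>)"

definition cell :: "nat \<Rightarrow> int \<times> int \<Rightarrow> (real \<times> real) set" where
  "cell n i = {x \<in> half_plane. grid n x = i}"

text \<open>Level n shrinks the mesh to 2^-n and at the same time enlarges the window to
  \<open>hp_box n\<close>. Thus every level has finitely many bounded cells, and the levels together
  exhaust the half plane.\<close>

definition idx :: "nat \<Rightarrow> (int \<times> int) set" where
  "idx n = {- (int n * 2 ^ n)..<int n * 2 ^ n} \<times> {0..<int n * 2 ^ n}"

definition hp_box :: "nat \<Rightarrow> (real \<times> real) set" where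
  "hp_box n = {- real n..<real n} \<times> {0..<real n}"

lemma finite_idx [simp]: "finite (idx n)"
  by (simp add: idx_def)

lemma box_subset: "hp_box n \<subseteq> half_plane"
  by (auto simp: hp_box_def half_plane_def)

lemma box_mono: "n \<le> m \<Longrightarrow> hp_box n \<subseteq> hp_box m"
  by (auto simp: hp_box_def)

lemma box_UN: "(\<Union>n. hp_box n) = half_plane"
proof
  show "half_plane \<subseteq> (\<Union>n. hp_box n)"
  proof
    fix x assume "x \<in> half_plane"
    moreover obtain n where "\<bar>fst x\<bar> + \<bar>snd x\<bar> < real n"
      using reals_Archimedean2 by blast
    ultimately show "x \<in> (\<Union>n. hp_box n)"
      by (intro UN_I[of n]) (auto simp: hp_box_def half_plane_def mem_Times_iff)
  qed
qed (use box_subset in auto)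

lemma ex_box: "x \<in> half_plane \<Longrightarrow> \<exists>m\<ge>n. x \<in> hp_box m"
  using box_UN box_mono by (metis UN_E max.cobounded1 max.cobounded2 subsetD)

lemma floor_scale_bounds:
  fixes a :: real
  shows "int k * 2 ^ n \<le> \<lfloor>2 ^ n * a\<rfloor> \<longleftrightarrow> real k \<le> a"
    "- (int k * 2 ^ n) \<le> \<lfloor>2 ^ n * a\<rfloor> \<longleftrightarrow> - real k \<le> a"
    "\<lfloor>2 ^ n * a\<rfloor> < int k * 2 ^ n \<longleftrightarrow> a < real k"
proof -
  have "int k * 2 ^ n \<le> \<lfloor>2 ^ n * a\<rfloor> \<longleftrightarrow> 2 ^ n * real k \<le> 2 ^ n * a"
    by (simp add: le_floor_iff mult.commute)
  then show "int k * 2 ^ n \<le> \<lfloor>2 ^ n * a\<rfloor> \<longleftrightarrow> real k \<le> a"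
    by simp
  have "- (int k * 2 ^ n) \<le> \<lfloor>2 ^ n * a\<rfloor> \<longleftrightarrow> 2 ^ n * (- real k) \<le> 2 ^ n * a"
    by (simp add: le_floor_iff mult.commute)
  then show "- (int k * 2 ^ n) \<le> \<lfloor>2 ^ n * a\<rfloor> \<longleftrightarrow> - real k \<le> a"
    by (simp only: mult_le_cancel_left_pos zero_less_power zero_less_numeral)
  have "\<lfloor>2 ^ n * a\<rfloor> < int k * 2 ^ n \<longleftrightarrow> 2 ^ n * a < 2 ^ n * real k"
    by (simp add: floor_less_iff mult.commute)
  then show "\<lfloor>2 ^ n * a\<rfloor> < int k * 2 ^ n \<longleftrightarrow> a < real k"
    by simp
qed

lemma grid_idx_iff: "x \<in> half_plane \<Longrightarrow> grid n x \<in> idx n \<longleftrightarrow> x \<in> hp_box n"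
  using floor_scale_bounds(2)[of n n "fst x"] floor_scale_bounds(3)[of n "fst x" n]
    floor_scale_bounds(3)[of n "snd x" n]
  by (auto simp: idx_def grid_def hp_box_def half_plane_def mem_Times_iff)

text \<open>Integer division commutes with taking floors, so the index of a coarse cell is a
  function of the index of the finer one. This is why cells are nested.\<close>

lemma grid_coarse:
  assumes "n \<le> m"
  shows "grid n x = (fst (grid m x) div 2 ^ (m - n), snd (grid m x) div 2 ^ (m - n))"
proof -
  have "\<lfloor>2 ^ m * a\<rfloor> div 2 ^ (m - n) = \<lfloor>2 ^ n * a\<rfloor>" for a :: real
  proof -
    have "\<lfloor>2 ^ m * a\<rfloor> div 2 ^ (m - n) = \<lfloor>2 ^ m * a / real_of_int (2 ^ (m - n))\<rfloor>"
      by (rule floor_divide_real_eq_div[symmetric]) simp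
    also have "2 ^ m * a / real_of_int (2 ^ (m - n)) = 2 ^ m * a / 2 ^ (m - n)"
      by (simp only: of_int_power of_int_numeral)
    also have "\<dots> = 2 ^ n * a"
      using assms by (simp add: field_simps flip: power_add)
    finally show ?thesis .
  qed
  then show ?thesis
    by (simp add: grid_def)
qed

lemma cell_nested:
  assumes "n \<le> m" "x \<in> cell m j" "x \<in> cell n i"
  shows "cell m j \<subseteq> cell n i"
  using assms by (auto simp: cell_def grid_coarse[OF assms(1)])

lemma cell_subset: "cell n i \<subseteq> half_plane"
  by (auto simp: cell_def)

lemma cell_box: "i \<in> idx n \<Longrightarrow> cell n i \<subseteq> hp_box n"
  using grid_idx_iff by (auto simp: cell_def)

text \<open>Boxes have integer corners, so at every level membership in a box is decided by the grid
  index alone.\<close>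

lemma box_eq_grid: "hp_box m = {x \<in> half_plane. grid n x \<in>
    {- (int m * 2 ^ n)..<int m * 2 ^ n} \<times> {0..<int m * 2 ^ n}}"
  using floor_scale_bounds[of m n] floor_scale_bounds(3)[of n _ m]
  by (auto simp: grid_def hp_box_def half_plane_def mem_Times_iff)

lemma cell_box_cases: "cell n i \<subseteq> hp_box m \<or> cell n i \<inter> hp_box m = {}"
proof -
  have "{x \<in> half_plane. grid n x = i} \<subseteq> {x \<in> half_plane. grid n x \<in> S} \<or>
      {x \<in> half_plane. grid n x = i} \<inter> {x \<in> half_plane. grid n x \<in> S} = {}" for S
    by (cases "i \<in> S") auto
  then show ?thesis
    unfolding box_eq_grid[of m n] cell_def .
qed

lemma disjoint_cell: "i \<noteq> j \<Longrightarrow> cell n i \<inter> cell n j = {}"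
  by (auto simp: cell_def)

lemma cell_measurable [measurable]: "cell n i \<in> sets hp_borel"
proof -
  have "cell n i = {x \<in> space hp_borel. \<lfloor>2 ^ n * fst x\<rfloor> = fst i \<and> \<lfloor>2 ^ n * snd x\<rfloor> = snd i}"
    by (auto simp: cell_def grid_def)
  also have "\<dots> \<in> sets hp_borel"
    by measurable
  finally show ?thesis .
qed

lemma box_UN_cell: "hp_box n = (\<Union>i\<in>idx n. cell n i)"
proof (intro equalityI subsetI)
  fix x assume x: "x \<in> hp_box n"
  then have "x \<in> half_plane"
    using box_subset by blast
  with x show "x \<in> (\<Union>i\<in>idx n. cell n i)"
    using grid_idx_iff[of x n] by (auto simp: cell_def)
qed (use cell_box in blast)

lemma box_measurable [measurable]: "hp_box n \<in> sets hp_borel"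
  unfolding box_UN_cell by (intro sets.finite_UN) auto

lemma cell_dist:
  assumes "x \<in> cell n i" "y \<in> cell n i"
  shows "dist x y \<le> 2 / 2 ^ n"
proof -
  have *: "\<bar>a - b\<bar> \<le> 1 / 2 ^ n" if "\<lfloor>2 ^ n * a\<rfloor> = \<lfloor>2 ^ n * b\<rfloor>" for a b :: real
  proof -
    have "2 ^ n * \<bar>a - b\<bar> = \<bar>2 ^ n * a - 2 ^ n * b\<bar>"
      by (simp add: abs_mult flip: right_diff_distrib)
    also have "\<dots> \<le> 1"
      using that by linarith
    finally show ?thesis
      by (simp add: pos_le_divide_eq mult.commute)
  qed
  have "dist x y \<le> \<bar>fst x - fst y\<bar> + \<bar>snd x - snd y\<bar>"
    unfolding dist_prod_def dist_real_def by (rule sqrt_sum_squares_le_sum) auto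
  also have "\<dots> \<le> 1 / 2 ^ n + 1 / 2 ^ n"
    using assms by (intro add_mono *) (auto simp: cell_def grid_def)
  finally show ?thesis
    by simp
qed

lemma ex_cell_radius:
  assumes "0 < e" shows "\<exists>m\<ge>n. 2 / 2 ^ m < (e :: real)"
proof -
  obtain k where "(1/2) ^ k < e / 2"
    using real_arch_pow_inv[of "e/2" "1/2"] assms by auto
  moreover have "(1/2) ^ max n k \<le> (1/2 :: real) ^ k"
    by (intro power_decreasing) auto
  ultimately have "(1/2) ^ max n k < e / 2"
    by linarith
  then have "2 / 2 ^ max n k < e"
    by (simp add: power_one_over field_simps)
  then show ?thesis
    by (intro exI[of _ "max n k"]) auto
qed

text \<open>One level has to meet two demands: its window contains x and its cells fit into a ball
  around x. Both persist when the level increases.\<close>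

lemma ex_cell_in_open:
  assumes "open U" "x \<in> U" "x \<in> half_plane"
  shows "\<exists>m\<ge>n. x \<in> hp_box m \<and> cell m (grid m x) \<subseteq> U"
proof -
  obtain e where e: "0 < e" "ball x e \<subseteq> U"
    using assms openE by blast
  obtain k where k: "k \<ge> n" "x \<in> hp_box k"
    using ex_box[OF assms(3)] by blast
  obtain m where m: "m \<ge> k" "2 / 2 ^ m < e"
    using ex_cell_radius[OF e(1)] by blast
  have "cell m (grid m x) \<subseteq> ball x e"
  proof
    fix y assume y: "y \<in> cell m (grid m x)"
    have "x \<in> cell m (grid m x)"
      using assms by (simp add: cell_def)
    from cell_dist[OF this y] m show "y \<in> ball x e"
      by simp
  qed
  with e k m box_mono[of k m] show ?thesis
    by (intro exI[of _ m]) auto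
qed

text \<open>Cells of all levels form a countable nested family, hence a \<open>\<inter>\<close>-stable generator of the Borel
  sets which refines every open cover.\<close>

definition cells :: "(real \<times> real) set set" where
  "cells = (\<Union>n. cell n ` idx n)"

lemma countable_cells: "countable cells"
  unfolding cells_def by (intro countable_UN countable_image) (auto intro: countable_finite)

lemma sets_hp_borel_cells: "sets hp_borel = sigma_sets half_plane cells"
proof
  have sub: "cells \<subseteq> Pow half_plane"
    using cell_subset by (auto simp: cells_def)
  interpret S: sigma_algebra half_plane "sigma_sets half_plane cells"
    using sub by (rule sigma_algebra_sigma_sets)
  have "A \<inter> half_plane \<in> sigma_sets half_plane cells" if "open A" for A
  proof -
    have "A \<inter> half_plane = \<Union>{C \<in> cells. C \<subseteq> A}"
    proof safe
      fix a b assume "(a, b) \<in> A" "(a, b) \<in> half_plane"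
      with ex_cell_in_open[OF that, of "(a,b)"] obtain m
        where "(a, b) \<in> hp_box m" "cell m (grid m (a, b)) \<subseteq> A" by blast
      then show "(a, b) \<in> \<Union>{C \<in> cells. C \<subseteq> A}"
        using \<open>(a, b) \<in> half_plane\<close> grid_idx_iff[of "(a,b)" m]
        by (intro UnionI[of "cell m (grid m (a, b))"]) (auto simp: cells_def cell_def)
    qed (use sub in auto)
    moreover have "\<Union>{C \<in> cells. C \<subseteq> A} \<in> sigma_sets half_plane cells"
      by (intro S.countable_Union countable_subset[OF _ countable_cells]) (auto intro: sigma_sets.Basic)
    ultimately show ?thesis
      by simp
  qed
  then have "sigma_sets half_plane ((\<inter>) half_plane ` {S. open S}) \<subseteq> sigma_sets half_plane cells"
    by (intro S.sigma_sets_subset) (auto simp: Int_commute)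
  moreover have "half_plane \<in> sigma_sets UNIV {S :: (real \<times> real) set. open S}"
    using half_plane_borel unfolding borel_def by (simp add: sets_measure_of)
  from sigma_sets_Int[OF this subset_UNIV]
  have "sets hp_borel = sigma_sets half_plane ((\<inter>) half_plane ` {S. open S})"
    unfolding borel_def by (simp add: sets_restrict_space sets_measure_of)
  ultimately show "sets hp_borel \<subseteq> sigma_sets half_plane cells"
    by simp
  show "sigma_sets half_plane cells \<subseteq> sets hp_borel"
    using sets.sigma_sets_subset[of cells hp_borel] unfolding space_hp_borel
    by (simp add: cells_def UN_subset_iff image_subset_iff)
qed

text \<open>Of two cells, the finer one lies inside the coarser one or misses it; the empty set is
  included for the second case.\<close>

lemma Int_stable_cells: "Int_stable (insert {} cells)"
proof -
  have *: "C \<inter> D \<in> insert {} cells" if "C = cell n i" "D = cell m j" "j \<in> idx m" "n \<le> m" for C D n m i j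
  proof (cases "C \<inter> D = {}")
    case False
    then have "D \<subseteq> C"
      using cell_nested[OF that(4), of _ j i] that by blast
    then have "C \<inter> D = D"
      by blast
    then show ?thesis
      using that by (auto simp: cells_def)
  qed simp
  show ?thesis
    unfolding Int_stable_def
  proof (intro ballI)
    fix C D assume CD: "C \<in> insert {} cells" "D \<in> insert {} cells"
    have **: "C \<inter> D \<in> insert {} cells" if "C = cell n i" "i \<in> idx n" "D = cell m j" "j \<in> idx m" for n m i j
    proof (cases "n \<le> m")
      case True
      show ?thesis
        by (rule *[OF that(1,3,4) True])
    next
      case False
      then have "m \<le> n" by simp
      from *[OF that(3,1,2) this] show ?thesis
        by (simp only: Int_commute)
    qed
    show "C \<inter> D \<in> insert {} cells"
    proof (cases "C = {} \<or> D = {}")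
      case False
      with CD have "C \<in> cells" "D \<in> cells"
        by auto
      then obtain n i m j where "C = cell n i" "i \<in> idx n" "D = cell m j" "j \<in> idx m"
        unfolding cells_def by (elim UN_E imageE)
      then show ?thesis
        by (rule **)
    qed auto
  qed
qed

section \<open>Cell counts of counting measures\<close>

lemma counting_measures_sets: "\<mu> \<in> counting_measures \<Longrightarrow> sets \<mu> = sets hp_borel"
  by (simp add: counting_measures_def)

lemma counting_measures_space: "\<mu> \<in> counting_measures \<Longrightarrow> space \<mu> = half_plane"
  using sets_eq_imp_space_eq[OF counting_measures_sets] by simp

lemma counting_measures_box: "\<mu> \<in> counting_measures \<Longrightarrow> emeasure \<mu> (hp_box n) < \<infinity>"
proof -
  assume \<mu>: "\<mu> \<in> counting_measures"
  have "compact ({- real n..real n} \<times> {0..real n})" "{- real n..real n} \<times> {0..real n} \<subseteq> half_plane"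
    by (auto intro: compact_Times simp: half_plane_def)
  then have "emeasure \<mu> ({- real n..real n} \<times> {0..real n}) < \<infinity>"
    and "{- real n..real n} \<times> {0..real n} \<in> sets \<mu>"
    using \<mu> by (auto simp: counting_measures_def sets_restrict_space image_iff
        intro!: bexI[of _ "{- real n..real n} \<times> {0..real n}"] borel_closed compact_imp_closed)
  moreover have "hp_box n \<subseteq> {- real n..real n} \<times> {0..real n}"
    by (auto simp: hp_box_def)
  ultimately show ?thesis
    using emeasure_mono le_less_trans by blast
qed

lemma counting_measures_sigma_finite:
  assumes "\<mu> \<in> counting_measures" shows "sigma_finite_measure \<mu>"
proof
  show "\<exists>A. countable A \<and> A \<subseteq> sets \<mu> \<and> \<Union> A = space \<mu> \<and> (\<forall>a\<in>A. emeasure \<mu> a \<noteq> \<infinity>)"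
    using counting_measures_box[OF assms] counting_measures_sets[OF assms]
      counting_measures_space[OF assms] box_UN
    by (intro exI[of _ "range hp_box"]) (auto simp: less_top)
qed

lemma counting_measures_nat:
  assumes "\<mu> \<in> counting_measures" "A \<in> sets hp_borel" "emeasure \<mu> A < \<infinity>"
  shows "\<exists>k. emeasure \<mu> A = of_nat k"
proof -
  from assms have "emeasure \<mu> A \<in> range ennreal_of_enat"
    by (auto simp: counting_measures_def)
  then obtain e where e: "emeasure \<mu> A = ennreal_of_enat e"
    by (rule imageE)
  show ?thesis
  proof (cases e)
    case (enat k)
    with e show ?thesis
      by (intro exI[of _ k]) simp
  next
    case infinity
    with e assms(3) show ?thesis
      by simp
  qed
qed

lemma emeasure_cell_finite: "\<mu> \<in> counting_measures \<Longrightarrow> i \<in> idx n \<Longrightarrow> emeasure \<mu> (cell n i) < \<infinity>"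
  using counting_measures_box[of \<mu> n] emeasure_mono[OF cell_box, of i n \<mu>]
  by (auto simp: counting_measures_sets intro: le_less_trans)

lemma emeasure_cell_refine:
  assumes \<mu>: "sets \<mu> = sets hp_borel" and "n \<le> m" and i: "i \<in> idx n"
  shows "emeasure \<mu> (cell n i) = (\<Sum>j | j \<in> idx m \<and> cell m j \<subseteq> cell n i. emeasure \<mu> (cell m j))"
proof -
  have "cell n i = (\<Union>j\<in>{j. j \<in> idx m \<and> cell m j \<subseteq> cell n i}. cell m j)"
  proof (intro equalityI subsetI)
    fix x assume x: "x \<in> cell n i"
    then have "x \<in> cell m (grid m x)" "grid m x \<in> idx m"
      using cell_box[OF i] box_mono[OF \<open>n \<le> m\<close>] cell_subset by (auto simp: cell_def grid_idx_iff)
    then show "x \<in> (\<Union>j\<in>{j. j \<in> idx m \<and> cell m j \<subseteq> cell n i}. cell m j)"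
      using cell_nested[OF \<open>n \<le> m\<close> _ x] by blast
  qed auto
  also have "emeasure \<mu> \<dots> = (\<Sum>j | j \<in> idx m \<and> cell m j \<subseteq> cell n i. emeasure \<mu> (cell m j))"
    using disjoint_cell \<mu> by (intro sum_emeasure[symmetric]) (auto simp: disjoint_family_on_def)
  finally show ?thesis .
qed

definition counts_are :: "nat \<Rightarrow> (int \<times> int \<Rightarrow> nat) \<Rightarrow> (real \<times> real) measure set" where
  "counts_are n k = {\<mu> \<in> counting_measures. \<forall>i\<in>idx n. emeasure \<mu> (cell n i) = of_nat (k i)}"

text \<open>Extensional functions on a finite index set form a countable set, which all functions on
  the integer pairs would not.\<close>

definition count_maps :: "nat \<Rightarrow> (int \<times> int \<Rightarrow> nat) set" where
  "count_maps n = (idx n \<rightarrow>\<^sub>E UNIV)"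

lemma countable_count_maps: "countable (count_maps n)"
  unfolding count_maps_def by (intro countable_PiE) auto

lemma counts_are_subset: "counts_are n k \<subseteq> counting_measures"
  by (auto simp: counts_are_def)

lemma ex_counts_are:
  assumes "\<mu> \<in> counting_measures" shows "\<exists>k\<in>count_maps n. \<mu> \<in> counts_are n k"
proof -
  have "\<forall>i\<in>idx n. \<exists>k. emeasure \<mu> (cell n i) = of_nat k"
    using counting_measures_nat[OF assms cell_measurable emeasure_cell_finite[OF assms]] by (rule ballI)
  from bchoice[OF this] obtain k where "\<forall>i\<in>idx n. emeasure \<mu> (cell n i) = of_nat (k i)" ..
  with assms show ?thesis
    by (intro bexI[of _ "restrict k (idx n)"]) (auto simp: counts_are_def count_maps_def)
qed

text \<open>Coarse counts are sums of fine ones, so the count events of all levels are nested in the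
  same way as the cells.\<close>

lemma counts_are_nested:
  assumes "n \<le> m" "\<mu> \<in> counts_are m k" "\<mu> \<in> counts_are n l"
  shows "counts_are m k \<subseteq> counts_are n l"
proof
  fix \<nu> assume \<nu>: "\<nu> \<in> counts_are m k"
  have "emeasure \<nu> (cell n i) = of_nat (l i)" if i: "i \<in> idx n" for i
  proof -
    have "emeasure \<nu> (cell n i) = emeasure \<mu> (cell n i)"
      using \<nu> assms emeasure_cell_refine[OF _ assms(1) i]
      by (auto simp: counts_are_def counting_measures_sets intro!: sum.cong)
    then show ?thesis
      using assms i by (auto simp: counts_are_def)
  qed
  with \<nu> show "\<nu> \<in> counts_are n l"
    by (auto simp: counts_are_def)
qed

text \<open>This sigma-field serves in place of \<open>counting_space\<close>. It contains all
  vaguely open sets, so the functional stays measurable, and it has a countable generator on which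
  the Poisson property gives explicit probabilities.\<close>

definition cell_count_space :: "(real \<times> real) measure measure" where
  "cell_count_space = sigma counting_measures
     {{\<mu> \<in> counting_measures. emeasure \<mu> (cell n i) = of_nat k} | n i k. i \<in> idx n}"

abbreviation "CM \<equiv> cell_count_space"

lemma space_CM [simp]: "space CM = counting_measures"
  unfolding cell_count_space_def by (rule space_measure_of_conv)

lemma sets_CM: "sets CM = sigma_sets counting_measures
     {{\<mu> \<in> counting_measures. emeasure \<mu> (cell n i) = of_nat k} | n i k. i \<in> idx n}"
  unfolding cell_count_space_def by (rule sets_measure_of) auto

lemma count_event_measurable:
  "i \<in> idx n \<Longrightarrow> {\<mu> \<in> counting_measures. emeasure \<mu> (cell n i) = of_nat k} \<in> sets CM"
  unfolding sets_CM by (rule sigma_sets.Basic) blast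

lemma emeasure_cell_measurable:
  assumes i: "i \<in> idx n" shows "(\<lambda>\<mu>. emeasure \<mu> (cell n i)) \<in> borel_measurable CM"
proof (rule measurableI)
  fix B :: "ennreal set"
  \<comment> \<open>Cell counts are finite natural numbers, so a preimage is a countable union of
    count events.\<close>
  have "(\<lambda>\<mu>. emeasure \<mu> (cell n i)) -` B \<inter> space CM
      = (\<Union>k\<in>{k. of_nat k \<in> B}. {\<mu> \<in> counting_measures. emeasure \<mu> (cell n i) = of_nat k})"
    using counting_measures_nat[OF _ cell_measurable emeasure_cell_finite] i by fastforce
  also have "\<dots> \<in> sets CM"
    using i by (intro sets.countable_UN') (auto intro: count_event_measurable)
  finally show "(\<lambda>\<mu>. emeasure \<mu> (cell n i)) -` B \<inter> space CM \<in> sets CM" .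
qed simp

lemma counts_are_measurable [measurable]: "counts_are n k \<in> sets CM"
proof -
  have "counts_are n k = {\<mu> \<in> space CM. \<forall>i\<in>idx n. emeasure \<mu> (cell n i) = of_nat (k i)}"
    by (simp add: counts_are_def)
  also have "\<dots> \<in> sets CM"
    using count_event_measurable by (intro sets.sets_Collect_finite_All) auto
  finally show ?thesis .
qed

lemma measurable_CM:
  assumes "\<And>\<omega>. \<omega> \<in> space M \<Longrightarrow> f \<omega> \<in> counting_measures"
    and "\<And>n i. i \<in> idx n \<Longrightarrow> (\<lambda>\<omega>. emeasure (f \<omega>) (cell n i)) \<in> borel_measurable M"
  shows "f \<in> M \<rightarrow>\<^sub>M CM"
  unfolding cell_count_space_def
proof (rule measurable_measure_of)
  fix Y assume "Y \<in> {{\<mu> \<in> counting_measures. emeasure \<mu> (cell n i) = of_nat k} | n i k. i \<in> idx n}"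
  then obtain n i k where Y: "Y = {\<mu> \<in> counting_measures. emeasure \<mu> (cell n i) = of_nat k}" "i \<in> idx n"
    by blast
  then have "f -` Y \<inter> space M = (\<lambda>\<omega>. emeasure (f \<omega>) (cell n i)) -` {of_nat k} \<inter> space M"
    using assms(1) by auto
  also have "\<dots> \<in> sets M"
    using assms(2)[OF Y(2)] by (rule measurable_sets) simp
  finally show "f -` Y \<inter> space M \<in> sets M" .
qed (use assms in auto)

text \<open>A vague neighbourhood of \<open>\<mu>\<close> contains all counting measures with the same counts as \<open>\<mu>\<close> on
  the cells of some sufficiently fine level. Since there are only countably many
  \<^const>\<open>counts_are\<close> sets, vaguely open sets are measurable with respect to the cell counts.\<close>

lemma integral_test_function_cells:
  assumes f: "f \<in> test_functions"
  shows "\<exists>n0. \<forall>e>0. \<exists>m\<ge>n0. \<forall>\<mu>\<in>counting_measures.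
    \<bar>(\<integral>x. f x \<partial>\<mu>) - (\<Sum>i\<in>idx m. f (of_int (fst i) / 2 ^ m, of_int (snd i) / 2 ^ m) * measure \<mu> (cell m i))\<bar>
      \<le> e * measure \<mu> (hp_box n0)"
proof -
  from f obtain K where cont: "continuous_on half_plane f" and K: "compact K" "K \<subseteq> half_plane"
      "\<And>x. x \<in> half_plane - K \<Longrightarrow> f x = 0"
    by (auto simp: test_functions_def)
  obtain b where b: "\<And>x. x \<in> K \<Longrightarrow> norm x < b"
    using compact_imp_bounded[OF K(1)] unfolding bounded_pos_less by blast
  obtain n0 where n0: "b < real n0"
    using reals_Archimedean2 by blast
  have zero: "f x = 0" if "x \<in> half_plane" "x \<notin> hp_box n0" for x
  proof (rule ccontr)
    assume "f x \<noteq> 0"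
    then have "x \<in> K"
      using K(3)[of x] that by blast
    then have "norm x < real n0"
      using less_trans[OF b n0] by blast
    then have "\<bar>fst x\<bar> < real n0" "\<bar>snd x\<bar> < real n0"
      using norm_fst_le[of "fst x" "snd x"] norm_snd_le[of "snd x" "fst x"] by auto
    with that show False
      by (auto simp: hp_box_def half_plane_def mem_Times_iff)
  qed
  \<comment> \<open>The window n0 is fixed before e and does not grow with the level m. The error is
    thus e times the mass of one fixed box, uniformly over all counting measures.\<close>
  have "\<exists>m\<ge>n0. \<forall>\<mu>\<in>counting_measures.
      \<bar>(\<integral>x. f x \<partial>\<mu>) - (\<Sum>i\<in>idx m. f (of_int (fst i) / 2 ^ m, of_int (snd i) / 2 ^ m) * measure \<mu> (cell m i))\<bar>
      \<le> e * measure \<mu> (hp_box n0)" if e: "0 < e" for e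
  proof -
    let ?Q = "{- real n0..real n0} \<times> {0..real n0}"
    have "uniformly_continuous_on ?Q f"
      by (intro compact_uniformly_continuous continuous_on_subset[OF cont] compact_Times)
        (auto simp: half_plane_def)
    then obtain d where d: "0 < d" "\<And>x y. x \<in> ?Q \<Longrightarrow> y \<in> ?Q \<Longrightarrow> dist y x < d \<Longrightarrow> dist (f y) (f x) < e"
      using e unfolding uniformly_continuous_on_def by metis
    obtain m where m: "m \<ge> n0" "2 / 2 ^ m < d"
      using ex_cell_radius[OF d(1)] by blast
    \<comment> \<open>The sample point of a cell is its lower left corner, which belongs to the cell
      because cells are half open.\<close>
    define c :: "int \<times> int \<Rightarrow> real \<times> real" where "c i = (of_int (fst i) / 2 ^ m, of_int (snd i) / 2 ^ m)" for i :: "int \<times> int"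
    define g where "g x = (\<Sum>i\<in>idx m. f (c i) * indicator (cell m i) x)" for x
    have grid_c: "grid m (c i) = i" for i
      by (simp add: grid_def c_def)
    have c_hp: "c i \<in> half_plane" if "i \<in> idx m" for i
      using that by (auto simp: c_def half_plane_def idx_def)
    have g_eq: "g x = f (c (grid m x))" if "x \<in> half_plane" "x \<in> hp_box m" for x
    proof -
      have "g x = (\<Sum>i\<in>{grid m x}. f (c i) * indicator (cell m i) x)"
        unfolding g_def using that grid_idx_iff[of x m]
        by (intro sum.mono_neutral_right) (auto simp: cell_def)
      then show ?thesis
        using that by (simp add: cell_def)
    qed
    have box_c: "c (grid m x) \<in> hp_box n0 \<longleftrightarrow> x \<in> hp_box n0" if "x \<in> half_plane" "x \<in> hp_box m" for x
      using that c_hp[of "grid m x"] grid_idx_iff[of x m] by (simp add: box_eq_grid[of n0 m] grid_c)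
    have le: "\<bar>f x - g x\<bar> \<le> e * indicator (hp_box n0) x" if x: "x \<in> half_plane" for x
    proof (cases "x \<in> hp_box m")
      case True
      note g = g_eq[OF x True]
      show ?thesis
      proof (cases "x \<in> hp_box n0")
        case n: True
        have "c (grid m x) \<in> cell m (grid m x)" "x \<in> cell m (grid m x)"
          using c_hp[of "grid m x"] grid_idx_iff[OF x, of m] True x grid_c by (auto simp: cell_def)
        from cell_dist[OF this(2,1)] m have "dist x (c (grid m x)) < d"
          by simp
        moreover have "x \<in> ?Q" "c (grid m x) \<in> ?Q"
          using n box_c[OF x True] by (auto simp: hp_box_def)
        ultimately have "dist (f x) (f (c (grid m x))) < e"
          by (intro d(2))
        then show ?thesis
          using n by (simp add: g dist_real_def)
      next
        case False
        then show ?thesis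
          using zero[OF x False] zero[of "c (grid m x)"] box_c[OF x True]
            c_hp[of "grid m x"] grid_idx_iff[OF x, of m] True by (simp add: g)
      qed
    next
      case False
      then have "x \<notin> hp_box n0"
        using m box_mono by blast
      moreover have "g x = 0"
        unfolding g_def using False cell_box by (intro sum.neutral) (auto simp: indicator_def)
      ultimately show ?thesis
        using zero[OF x] by simp
    qed
    have "\<bar>(\<integral>x. f x \<partial>\<mu>) - (\<Sum>i\<in>idx m. f (c i) * measure \<mu> (cell m i))\<bar> \<le> e * measure \<mu> (hp_box n0)"
      if \<mu>: "\<mu> \<in> counting_measures" for \<mu>
    proof -
      note S = counting_measures_sets[OF \<mu>] counting_measures_space[OF \<mu>]
        Int_absorb2[OF cell_subset] Int_absorb2[OF box_subset]
      have ci: "integrable \<mu> (\<lambda>x. f (c i) * indicator (cell m i) x)" if "i \<in> idx m" for i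
        using emeasure_cell_finite[OF \<mu> that] by (intro integrable_mult_right) (auto simp: S integrable_indicator_iff)
      have gi: "integrable \<mu> g"
        unfolding g_def[abs_def] by (intro Bochner_Integration.integrable_sum ci)
      have bi: "integrable \<mu> (\<lambda>x. e * indicator (hp_box n0) x)"
        using counting_measures_box[OF \<mu>, of n0] by (auto simp: S integrable_indicator_iff)
      have fm: "f \<in> borel_measurable \<mu>"
        using borel_measurable_continuous_on_restrict[OF cont] by (simp add: measurable_cong_sets[OF S(1) refl])
      have di: "integrable \<mu> (\<lambda>x. f x - g x)"
      proof (rule Bochner_Integration.integrable_bound[OF bi])
        show "(\<lambda>x. f x - g x) \<in> borel_measurable \<mu>"
          by (intro borel_measurable_diff fm borel_measurable_integrable gi)
        show "AE x in \<mu>. norm (f x - g x) \<le> norm (e * indicator (hp_box n0) x)"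
        proof (rule AE_I2)
          fix x assume "x \<in> space \<mu>"
          with le[of x] e show "norm (f x - g x) \<le> norm (e * indicator (hp_box n0) x)"
            by (simp add: S abs_mult)
        qed
      qed
      have fi: "integrable \<mu> f"
        using Bochner_Integration.integrable_add[OF di gi] by simp
      have "(\<integral>x. g x \<partial>\<mu>) = (\<Sum>i\<in>idx m. f (c i) * measure \<mu> (cell m i))"
        unfolding g_def by (subst Bochner_Integration.integral_sum[OF ci])
          (auto simp: S intro!: sum.cong)
      then have "\<bar>(\<integral>x. f x \<partial>\<mu>) - (\<Sum>i\<in>idx m. f (c i) * measure \<mu> (cell m i))\<bar> = \<bar>\<integral>x. f x - g x \<partial>\<mu>\<bar>"
        using fi gi by simp
      also have "\<dots> \<le> (\<integral>x. \<bar>f x - g x\<bar> \<partial>\<mu>)"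
        by (rule integral_abs_bound)
      also have "\<dots> \<le> (\<integral>x. e * indicator (hp_box n0) x \<partial>\<mu>)"
        using le by (intro integral_mono integrable_abs di bi) (simp add: S)
      also have "\<dots> = e * measure \<mu> (hp_box n0)"
        by (simp add: S)
      finally show ?thesis .
    qed
    with m(1) show ?thesis
      unfolding c_def by (intro exI[of _ m] conjI ballI)
  qed
  note main = this
  show ?thesis
    by (rule exI[of _ n0], rule allI, rule impI, rule main)
qed

lemma vague_open_counts_are:
  assumes "openin vague_topology U" "\<mu> \<in> U"
  shows "\<exists>n. \<forall>k. \<mu> \<in> counts_are n k \<longrightarrow> counts_are n k \<subseteq> U"
proof -
  have "generate_topology_on
     {{\<mu> \<in> counting_measures. (\<integral>x. f x \<partial>\<mu>) \<in> U} | f U. f \<in> test_functions \<and> open U} U"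
    using assms(1) unfolding vague_topology_def openin_topology_generated_by_iff .
  then show ?thesis
    using assms(2)
  proof (induction arbitrary: \<mu> rule: generate_topology_on.induct)
    case (Int a b)
    then obtain n m where n: "\<And>k. \<mu> \<in> counts_are n k \<Longrightarrow> counts_are n k \<subseteq> a"
      and m: "\<And>k. \<mu> \<in> counts_are m k \<Longrightarrow> counts_are m k \<subseteq> b"
      by (metis IntD1 IntD2)
    show ?case
    proof (intro exI[of _ "max n m"] allI impI)
      fix k assume k: "\<mu> \<in> counts_are (max n m) k"
      then have "\<mu> \<in> counting_measures"
        by (simp add: counts_are_def)
      then obtain k1 k2 where "\<mu> \<in> counts_are n k1" "\<mu> \<in> counts_are m k2"
        using ex_counts_are by metis
      with n m counts_are_nested[OF max.cobounded1 k] counts_are_nested[OF max.cobounded2 k]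
      show "counts_are (max n m) k \<subseteq> a \<inter> b"
        by blast
    qed
  next
    case (UN K)
    then obtain k where "k \<in> K" "\<mu> \<in> k"
      by blast
    with UN.IH[OF this] show ?case
      by blast
  next
    case (Basis s)
    then obtain f U where f: "f \<in> test_functions" and U: "open U"
      and s: "s = {\<mu> \<in> counting_measures. (\<integral>x. f x \<partial>\<mu>) \<in> U}"
      by blast
    from Basis s have \<mu>: "\<mu> \<in> counting_measures" "(\<integral>x. f x \<partial>\<mu>) \<in> U"
      by auto
    obtain e where e: "0 < e" "ball (\<integral>x. f x \<partial>\<mu>) e \<subseteq> U"
      using openE[OF U \<mu>(2)] by blast
    obtain n0 where n0: "\<And>e. e > 0 \<Longrightarrow> \<exists>m\<ge>n0. \<forall>\<mu>\<in>counting_measures.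
      \<bar>(\<integral>x. f x \<partial>\<mu>) - (\<Sum>i\<in>idx m. f (of_int (fst i) / 2 ^ m, of_int (snd i) / 2 ^ m) * measure \<mu> (cell m i))\<bar>
      \<le> e * measure \<mu> (hp_box n0)"
      using integral_test_function_cells[OF f] by blast
    \<comment> \<open>Chosen so that the two approximation errors, one for each measure, add up to
      less than e; the summand 1 covers a box without mass.\<close>
    define e' where "e' = e / (2 * (measure \<mu> (hp_box n0) + 1))"
    have p: "0 < measure \<mu> (hp_box n0) + 1"
      by (intro add_nonneg_pos) auto
    then have e': "0 < e'"
      using e by (simp add: e'_def)
    have e'': "2 * (e' * measure \<mu> (hp_box n0)) < e"
      using e(1) p by (simp add: e'_def field_simps)
    obtain m where m: "m \<ge> n0" "\<And>\<mu>. \<mu> \<in> counting_measures \<Longrightarrow>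
      \<bar>(\<integral>x. f x \<partial>\<mu>) - (\<Sum>i\<in>idx m. f (of_int (fst i) / 2 ^ m, of_int (snd i) / 2 ^ m) * measure \<mu> (cell m i))\<bar>
      \<le> e' * measure \<mu> (hp_box n0)"
      using n0[OF e'] by blast
    show ?case
    proof (intro exI[of _ m] allI impI subsetI)
      fix k \<nu> assume k: "\<mu> \<in> counts_are m k" and \<nu>: "\<nu> \<in> counts_are m k"
      then have \<nu>': "\<nu> \<in> counting_measures"
        by (simp add: counts_are_def)
      obtain l where l: "\<mu> \<in> counts_are n0 l"
        using ex_counts_are[OF \<mu>(1)] by blast
      then have "\<nu> \<in> counts_are n0 l"
        using counts_are_nested[OF m(1) k l] \<nu> by blast
      with l have "emeasure \<nu> (cell n0 i) = emeasure \<mu> (cell n0 i)" if "i \<in> idx n0" for i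
        using that by (simp add: counts_are_def)
      moreover have "emeasure \<xi> (hp_box n0) = (\<Sum>i\<in>idx n0. emeasure \<xi> (cell n0 i))"
        if "\<xi> \<in> counting_measures" for \<xi>
        unfolding box_UN_cell using disjoint_cell counting_measures_sets[OF that]
        by (intro sum_emeasure[symmetric]) (auto simp: disjoint_family_on_def)
      \<comment> \<open>The counts at level m determine those at level n0 and hence the mass of the
        box, so both measures obey the same error bound.\<close>
      ultimately have b: "measure \<nu> (hp_box n0) = measure \<mu> (hp_box n0)"
        using \<mu>(1) \<nu>' by (simp add: measure_def)
      have "measure \<nu> (cell m i) = measure \<mu> (cell m i)" if "i \<in> idx m" for i
        using that \<nu> k by (simp add: measure_def counts_are_def)
      then have "(\<Sum>i\<in>idx m. f (of_int (fst i) / 2 ^ m, of_int (snd i) / 2 ^ m) * measure \<nu> (cell m i))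
        = (\<Sum>i\<in>idx m. f (of_int (fst i) / 2 ^ m, of_int (snd i) / 2 ^ m) * measure \<mu> (cell m i))"
        by (intro sum.cong) auto
      with m(2)[OF \<mu>(1)] m(2)[OF \<nu>', unfolded b] e''
      have "\<bar>(\<integral>x. f x \<partial>\<mu>) - (\<integral>x. f x \<partial>\<nu>)\<bar> < e"
        unfolding abs_le_iff abs_less_iff by linarith
      with e(2) \<nu>' show "\<nu> \<in> s"
        by (auto simp: s ball_def dist_real_def)
    qed
  qed auto
qed

text \<open>A vaguely open set is the union of the count events that it contains, and over all
  levels there are only countably many count events.\<close>

lemma sets_counting_space_CM: "sets counting_space \<subseteq> sets CM"
proof -
  have "U \<in> sets CM" if U: "openin vague_topology U" for U
  proof -
    have sub: "U \<subseteq> counting_measures"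
      using openin_subset[OF U] topspace_vague_topology by simp
    let ?A = "{A \<in> (\<Union>n. counts_are n ` count_maps n). A \<subseteq> U}"
    have "U = \<Union>?A"
    proof (intro equalityI subsetI)
      fix \<mu> assume \<mu>: "\<mu> \<in> U"
      obtain n where n: "\<And>k. \<mu> \<in> counts_are n k \<Longrightarrow> counts_are n k \<subseteq> U"
        using vague_open_counts_are[OF U \<mu>] by blast
      obtain k where "k \<in> count_maps n" "\<mu> \<in> counts_are n k"
        using ex_counts_are \<mu> sub by blast
      with n show "\<mu> \<in> \<Union>?A"
        by blast
    qed auto
    moreover have "countable ?A"
      by (rule countable_subset[of _ "\<Union>n. counts_are n ` count_maps n"])
        (auto intro!: countable_image countable_count_maps)
    ultimately show ?thesis
      by (metis (no_types, lifting) sets.countable_Union counts_are_measurable imageE mem_Collect_eq subsetI UN_E)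
  qed
  then show ?thesis
    using sets.sigma_sets_subset[of "{U. openin vague_topology U}" CM]
    by (auto simp: sets_counting_space)
qed

lemma measurable_counting_space_CM: "f \<in> M \<rightarrow>\<^sub>M CM \<Longrightarrow> f \<in> M \<rightarrow>\<^sub>M counting_space"
  using sets_counting_space_CM by (auto simp: measurable_def space_counting_space)

section \<open>Kernels, adding points and restriction\<close>

lemma mem_half_plane: "(t, z) \<in> half_plane \<longleftrightarrow> 0 \<le> z"
  by (simp add: half_plane_def)

text \<open>Dynkin's argument on the generator of cells. Intersecting with \<open>hp_box m\<close>
  keeps all masses finite, so that complements become differences.\<close>

lemma emeasure_cell_Int_box_measurable:
  assumes "A \<in> sets hp_borel" and \<kappa>: "\<kappa> \<in> Y \<rightarrow>\<^sub>M CM"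
  shows "(\<lambda>y. emeasure (\<kappa> y) (A \<inter> hp_box m)) \<in> borel_measurable Y"
proof -
  have \<kappa>_cm: "\<kappa> y \<in> counting_measures" if "y \<in> space Y" for y
    using measurable_space[OF \<kappa> that] by simp
  have cell: "(\<lambda>y. emeasure (\<kappa> y) (cell n i)) \<in> borel_measurable Y" if "i \<in> idx n" for n i
    using measurable_compose[OF \<kappa> emeasure_cell_measurable[OF that]] .
  have box: "(\<lambda>y. emeasure (\<kappa> y) (hp_box n)) \<in> borel_measurable Y" for n
  proof (subst measurable_cong)
    show "emeasure (\<kappa> y) (hp_box n) = (\<Sum>i\<in>idx n. emeasure (\<kappa> y) (cell n i))" if "y \<in> space Y" for y
      unfolding box_UN_cell using disjoint_cell counting_measures_sets[OF \<kappa>_cm[OF that]]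
      by (intro sum_emeasure[symmetric]) (auto simp: disjoint_family_on_def)
  qed (intro borel_measurable_sum cell)
  have A: "A \<in> sigma_sets half_plane (insert {} cells)"
    using assms(1) unfolding sets_hp_borel_cells
    by (rule rev_subsetD) (rule sigma_sets_mono', auto)
  have sub: "insert {} cells \<subseteq> Pow half_plane"
    using cell_subset by (auto simp: cells_def)
  have S: "B \<in> sets hp_borel" if "B \<in> sigma_sets half_plane (insert {} cells)" for B
    using that sets.sigma_sets_subset[of "insert {} cells" hp_borel] unfolding space_hp_borel
    by (auto simp: cells_def UN_subset_iff image_subset_iff)
  from A show ?thesis
  proof (induction rule: sigma_sets_induct_disjoint[OF Int_stable_cells sub, consumes 1, case_names basic empty compl union])
    case (basic A)
    then consider "A = {}" | n i where "i \<in> idx n" "A = cell n i"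
      by (auto simp: cells_def)
    then show ?case
    proof cases
      case 2
      then show ?thesis
        using cell_box_cases[of n i m] cell[of i n] by (auto simp: Int_absorb2)
    qed simp
  next
    case (compl A)
    have eq: "emeasure (\<kappa> y) ((half_plane - A) \<inter> hp_box m)
        = emeasure (\<kappa> y) (hp_box m) - emeasure (\<kappa> y) (A \<inter> hp_box m)" if "y \<in> space Y" for y
    proof -
      note s = counting_measures_sets[OF \<kappa>_cm[OF that]]
      have "(half_plane - A) \<inter> hp_box m = hp_box m - (A \<inter> hp_box m)"
        using box_subset by auto
      moreover have "emeasure (\<kappa> y) (A \<inter> hp_box m) \<le> emeasure (\<kappa> y) (hp_box m)"
        by (intro emeasure_mono) (auto simp: s)
      ultimately show ?thesis
        using S[OF compl(1)] counting_measures_box[OF \<kappa>_cm[OF that], of m]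
        by (auto simp: s intro!: emeasure_Diff)
    qed
    show ?case
      by (rule measurable_cong[THEN iffD1, OF eq[symmetric]])
        (auto intro!: borel_measurable_minus_ennreal box compl)
  next
    case (union A)
    have eq: "emeasure (\<kappa> y) ((\<Union>i. A i) \<inter> hp_box m) = (\<Sum>i. emeasure (\<kappa> y) (A i \<inter> hp_box m))"
      if "y \<in> space Y" for y
    proof -
      have "(\<Union>i. A i) \<inter> hp_box m = (\<Union>i. A i \<inter> hp_box m)"
        by auto
      moreover have "disjoint_family (\<lambda>i. A i \<inter> hp_box m)"
        using union(1) unfolding disjoint_family_on_def by blast
      moreover have "A i \<in> sets hp_borel" for i
        using union(2) by (intro S) auto
      ultimately show ?thesis
        by (simp only:) (intro suminf_emeasure[symmetric],
          auto simp: counting_measures_sets[OF \<kappa>_cm[OF that]])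
    qed
    note union(3)[measurable]
    show ?case
      by (rule measurable_cong[THEN iffD1, OF eq[symmetric]]) measurable
  qed simp_all
qed

text \<open>Dynkin's argument on rectangles, again inside a box; a monotone limit over the boxes
  removes the restriction. With the identity for \<open>\<kappa>\<close> this covers integration
  against the random measure itself.\<close>

lemma emeasure_kernel_measurable:
  assumes D: "D \<in> sets (hp_borel \<Otimes>\<^sub>M Y)" and \<kappa>: "\<kappa> \<in> Y \<rightarrow>\<^sub>M CM"
  shows "(\<lambda>y. emeasure (\<kappa> y) {x. (x, y) \<in> D}) \<in> borel_measurable Y"
proof -
  have \<kappa>_cm: "\<kappa> y \<in> counting_measures" if "y \<in> space Y" for y
    using measurable_space[OF \<kappa> that] by simp
  have sl: "{x. (x, y) \<in> D} \<in> sets hp_borel" if "D \<in> sets (hp_borel \<Otimes>\<^sub>M Y)" for y D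
    using sets_Pair2[OF that, of y] by (simp add: vimage_def)
  have m: "(\<lambda>y. emeasure (\<kappa> y) ({x. (x, y) \<in> D} \<inter> hp_box m)) \<in> borel_measurable Y" for m
    using D unfolding sets_pair_measure
  proof (induction rule: sigma_sets_induct_disjoint[OF Int_stable_pair_measure_generator pair_measure_closed,
      consumes 1, case_names basic empty compl union])
    case (basic D)
    then obtain A B where D: "D = A \<times> B" "A \<in> sets hp_borel" "B \<in> sets Y"
      by blast
    have "emeasure (\<kappa> y) ({x. (x, y) \<in> D} \<inter> hp_box m) = emeasure (\<kappa> y) (A \<inter> hp_box m) * indicator B y" for y
      by (auto simp: D(1) indicator_def)
    then show ?case
      using D emeasure_cell_Int_box_measurable[OF D(2) \<kappa>, of m] by simp
  next
    case (compl D)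
    have D: "D \<in> sets (hp_borel \<Otimes>\<^sub>M Y)"
      using compl(1) by (simp add: sets_pair_measure)
    have eq: "emeasure (\<kappa> y) ({x. (x, y) \<in> space hp_borel \<times> space Y - D} \<inter> hp_box m)
        = emeasure (\<kappa> y) (half_plane \<inter> hp_box m) - emeasure (\<kappa> y) ({x. (x, y) \<in> D} \<inter> hp_box m)"
      if "y \<in> space Y" for y
    proof -
      note s = counting_measures_sets[OF \<kappa>_cm[OF that]]
      have "{x. (x, y) \<in> space hp_borel \<times> space Y - D} \<inter> hp_box m = half_plane \<inter> hp_box m - ({x. (x, y) \<in> D} \<inter> hp_box m)"
        using box_subset that by auto
      moreover have "{x. (x, y) \<in> D} \<inter> hp_box m \<subseteq> half_plane \<inter> hp_box m"
        using box_subset by auto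
      moreover have "emeasure (\<kappa> y) ({x. (x, y) \<in> D} \<inter> hp_box m) \<noteq> \<infinity>"
        using emeasure_mono[of "{x. (x, y) \<in> D} \<inter> hp_box m" "hp_box m" "\<kappa> y"]
          counting_measures_box[OF \<kappa>_cm[OF that], of m] by (auto simp: s top_unique)
      moreover have "half_plane \<inter> hp_box m = hp_box m"
        using box_subset by blast
      ultimately show ?thesis
        using sl[OF D, of y] by (auto simp: s intro!: emeasure_Diff)
    qed
    have "half_plane \<in> sets hp_borel"
      using sets.top[of hp_borel] by simp
    from emeasure_cell_Int_box_measurable[OF this \<kappa>, of m] show ?case
      by (intro measurable_cong[THEN iffD1, OF eq[symmetric]] borel_measurable_minus_ennreal compl)
  next
    case (union D)
    have eq: "emeasure (\<kappa> y) ({x. (x, y) \<in> (\<Union>i. D i)} \<inter> hp_box m)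
        = (\<Sum>i. emeasure (\<kappa> y) ({x. (x, y) \<in> D i} \<inter> hp_box m))" if "y \<in> space Y" for y
    proof -
      have "{x. (x, y) \<in> (\<Union>i. D i)} \<inter> hp_box m = (\<Union>i. {x. (x, y) \<in> D i} \<inter> hp_box m)"
        by auto
      moreover have "D i \<in> sets (hp_borel \<Otimes>\<^sub>M Y)" for i
        using union(2) by (auto simp: sets_pair_measure)
      moreover have "disjoint_family (\<lambda>i. {x. (x, y) \<in> D i} \<inter> hp_box m)"
        using union(1) unfolding disjoint_family_on_def by blast
      ultimately show ?thesis
        by (simp only:) (intro suminf_emeasure[symmetric],
          auto simp: counting_measures_sets[OF \<kappa>_cm[OF that]] intro!: sl)
    qed
    note union(3)[measurable]
    show ?case
      by (rule measurable_cong[THEN iffD1, OF eq[symmetric]]) measurable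
  qed simp
  show ?thesis
  proof (subst measurable_cong)
    fix y assume y: "y \<in> space Y"
    note s = counting_measures_sets[OF \<kappa>_cm[OF y]]
    have "{x. (x, y) \<in> D} = (\<Union>m. {x. (x, y) \<in> D} \<inter> hp_box m)"
      using box_UN sets.sets_into_space[OF sl[OF D, of y]] by auto
    moreover have "(SUP m. emeasure (\<kappa> y) ({x. (x, y) \<in> D} \<inter> hp_box m)) = emeasure (\<kappa> y) (\<Union>m. {x. (x, y) \<in> D} \<inter> hp_box m)"
      using box_mono sl[OF D, of y] by (intro SUP_emeasure_incseq) (auto simp: s incseq_def)
    ultimately show "emeasure (\<kappa> y) {x. (x, y) \<in> D} = (SUP m. emeasure (\<kappa> y) ({x. (x, y) \<in> D} \<inter> hp_box m))"
      by simp
  qed (intro borel_measurable_SUP m, simp)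
qed

lemma nn_integral_kernel_measurable:
  assumes h: "h \<in> borel_measurable (hp_borel \<Otimes>\<^sub>M Y)" and \<kappa>: "\<kappa> \<in> Y \<rightarrow>\<^sub>M CM"
  shows "(\<lambda>y. \<integral>\<^sup>+x. h (x, y) \<partial>\<kappa> y) \<in> borel_measurable Y"
proof -
  have \<kappa>_cm: "\<kappa> y \<in> counting_measures" if "y \<in> space Y" for y
    using measurable_space[OF \<kappa> that] by simp
  note s = counting_measures_sets[OF \<kappa>_cm] counting_measures_space[OF \<kappa>_cm]
  have sl: "(\<lambda>x. u (x, y)) \<in> borel_measurable (\<kappa> y)"
    if "u \<in> borel_measurable (hp_borel \<Otimes>\<^sub>M Y)" "y \<in> space Y" for u :: "_ \<Rightarrow> ennreal" and y
    using measurable_Pair1[OF that] by (simp cong: measurable_cong_sets add: s(1)[OF that(2)])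
  show ?thesis
    using h
  proof (induction rule: borel_measurable_induct)
    case (cong f g)
    have "(\<integral>\<^sup>+x. f (x, y) \<partial>\<kappa> y) = (\<integral>\<^sup>+x. g (x, y) \<partial>\<kappa> y)" if "y \<in> space Y" for y
      using cong(3) that by (intro nn_integral_cong) (auto simp: s space_pair_measure)
    then show ?case
      using cong(4) by (simp cong: measurable_cong)
  next
    case (set D)
    have "(\<integral>\<^sup>+x. indicator D (x, y) \<partial>\<kappa> y) = emeasure (\<kappa> y) {x. (x, y) \<in> D}" if "y \<in> space Y" for y
    proof -
      have "(\<integral>\<^sup>+x. indicator D (x, y) \<partial>\<kappa> y) = (\<integral>\<^sup>+x. indicator {x. (x, y) \<in> D} x \<partial>\<kappa> y)"
        by (intro nn_integral_cong) (auto simp: indicator_def)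
      also have "\<dots> = emeasure (\<kappa> y) {x. (x, y) \<in> D}"
        using sets_Pair2[OF set, of y] by (intro nn_integral_indicator) (simp add: s[OF that] vimage_def)
      finally show ?thesis .
    qed
    then show ?case
      using emeasure_kernel_measurable[OF set \<kappa>] by (simp cong: measurable_cong)
  next
    case (mult u c)
    then show ?case
      using sl[OF mult(2)] by (subst measurable_cong[OF nn_integral_cmult]) auto
  next
    case (add u v)
    then show ?case
      using sl[OF add(1)] sl[OF add(3)] by (subst measurable_cong[OF nn_integral_add]) auto
  next
    case (seq U)
    have "(\<integral>\<^sup>+x. (SUP i. U i) (x, y) \<partial>\<kappa> y) = (SUP i. \<integral>\<^sup>+x. U i (x, y) \<partial>\<kappa> y)" if "y \<in> space Y" for y
      unfolding SUP_apply using seq(3) sl[OF seq(1) that]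
      by (intro nn_integral_monotone_convergence_SUP) (auto simp: incseq_def le_fun_def)
    then show ?case
      using seq.IH by (simp cong: measurable_cong)
  qed
qed

text \<open>The Bochner integral is 0 by default when the integrand is not integrable, so
  measurability is read off from an explicit case distinction on the integral of the absolute
  value.\<close>

lemma integral_kernel_measurable:
  fixes h :: "(real \<times> real) \<times> 'a \<Rightarrow> real"
  assumes h: "h \<in> borel_measurable (hp_borel \<Otimes>\<^sub>M Y)" and \<kappa>: "\<kappa> \<in> Y \<rightarrow>\<^sub>M CM"
  shows "(\<lambda>y. \<integral>x. h (x, y) \<partial>\<kappa> y) \<in> borel_measurable Y"
proof -
  have \<kappa>_cm: "\<kappa> y \<in> counting_measures" if "y \<in> space Y" for y
    using measurable_space[OF \<kappa> that] by simp
  note s = counting_measures_sets[OF \<kappa>_cm]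
  have [measurable]: "(\<lambda>y. \<integral>\<^sup>+x. ennreal (h (x, y)) \<partial>\<kappa> y) \<in> borel_measurable Y"
    "(\<lambda>y. \<integral>\<^sup>+x. ennreal (- h (x, y)) \<partial>\<kappa> y) \<in> borel_measurable Y"
    "(\<lambda>y. \<integral>\<^sup>+x. ennreal \<bar>h (x, y)\<bar> \<partial>\<kappa> y) \<in> borel_measurable Y"
    using h by (intro nn_integral_kernel_measurable[OF _ \<kappa>], simp)+
  have "(\<integral>x. h (x, y) \<partial>\<kappa> y) = (if (\<integral>\<^sup>+x. ennreal \<bar>h (x, y)\<bar> \<partial>\<kappa> y) < \<infinity>
      then enn2real (\<integral>\<^sup>+x. ennreal (h (x, y)) \<partial>\<kappa> y) - enn2real (\<integral>\<^sup>+x. ennreal (- h (x, y)) \<partial>\<kappa> y) else 0)"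
    if "y \<in> space Y" for y
  proof -
    have "(\<lambda>x. h (x, y)) \<in> borel_measurable (\<kappa> y)"
      using measurable_Pair1[OF h that] by (simp cong: measurable_cong_sets add: s[OF that])
    then have "integrable (\<kappa> y) (\<lambda>x. h (x, y)) \<longleftrightarrow> (\<integral>\<^sup>+x. ennreal \<bar>h (x, y)\<bar> \<partial>\<kappa> y) < \<infinity>"
      by (simp add: integrable_iff_bounded)
    then show ?thesis
      using real_lebesgue_integral_def[of "\<kappa> y" "\<lambda>x. h (x, y)"]
      by (auto simp: not_integrable_integral_eq)
  qed
  then show ?thesis
    by (subst measurable_cong) (auto intro!: measurable_If)
qed

section \<open>Adding an atom and adding a point\<close>

lemma sets_add_atom [simp]: "sets (add_atom \<mu> x) = sets \<mu>"
  and space_add_atom [simp]: "space (add_atom \<mu> x) = space \<mu>"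
  unfolding add_atom_def using sets.space_closed[of \<mu>]
  by (simp_all add: sets_measure_of_conv space_measure_of_conv sets.sigma_sets_eq)

lemma nn_integral_add_atom:
  assumes h: "h \<in> borel_measurable \<mu>" and x: "x \<in> space \<mu>"
  shows "(\<integral>\<^sup>+y. h y \<partial>add_atom \<mu> x) = (\<integral>\<^sup>+y. h y \<partial>\<mu>) + h x"
proof -
  have M: "borel_measurable (add_atom \<mu> x) = borel_measurable \<mu>"
    by (rule measurable_cong_sets) auto
  show ?thesis
    using h
  proof (induction rule: borel_measurable_induct)
    case (cong f g)
    then show ?case
      using x nn_integral_cong[of "add_atom \<mu> x" f g] nn_integral_cong[of \<mu> f g] by simp
  next
    case (set A)
    then show ?case
      by (simp add: emeasure_add_atom)
  next
    case (mult u c)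
    then show ?case
      by (simp add: nn_integral_cmult M distrib_left)
  next
    case (add u v)
    then show ?case
      by (simp add: nn_integral_add M ac_simps)
  next
    case (seq U)
    have "(\<integral>\<^sup>+y. (SUP i. U i) y \<partial>\<nu>) = (SUP i. \<integral>\<^sup>+y. U i y \<partial>\<nu>)" if "borel_measurable \<nu> = (borel_measurable \<mu> :: ('a \<Rightarrow> ennreal) set)" for \<nu>
      unfolding SUP_apply
      by (intro nn_integral_monotone_convergence_SUP seq(3)) (simp only: that seq(1))
    then show ?case
      using seq(3) by (simp add: M seq.IH image_comp)
        (intro ennreal_SUP_add, auto simp: incseq_def le_fun_def intro: nn_integral_mono)
  qed
qed

lemma integral_add_atom:
  fixes h :: "'a \<Rightarrow> real"
  assumes h: "integrable \<mu> h" and x: "x \<in> space \<mu>"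
  shows "integrable (add_atom \<mu> x) h" "(\<integral>y. h y \<partial>add_atom \<mu> x) = (\<integral>y. h y \<partial>\<mu>) + h x"
proof -
  have M: "borel_measurable (add_atom \<mu> x) = borel_measurable \<mu>"
    by (rule measurable_cong_sets) auto
  have m [measurable]: "h \<in> borel_measurable \<mu>"
    using h by simp
  show int: "integrable (add_atom \<mu> x) h"
    using h x by (simp add: integrable_iff_bounded M nn_integral_add_atom)
  have fin: "(\<integral>\<^sup>+y. ennreal (h y) \<partial>\<mu>) < \<infinity>" "(\<integral>\<^sup>+y. ennreal (- h y) \<partial>\<mu>) < \<infinity>"
    using h unfolding real_integrable_def by (auto simp: less_top)
  then show "(\<integral>y. h y \<partial>add_atom \<mu> x) = (\<integral>y. h y \<partial>\<mu>) + h x"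
    unfolding real_lebesgue_integral_def[OF int] real_lebesgue_integral_def[OF h]
    using x by (simp add: nn_integral_add_atom enn2real_plus) (cases "0 \<le> h x", auto simp: ennreal_neg)
qed

text \<open>In contrast to \<^const>\<open>add_atom\<close>, the following operation stays inside the simple measures.\<close>

definition add_point :: "'a measure \<Rightarrow> 'a \<Rightarrow> 'a measure" where
  "add_point \<mu> x = (if emeasure \<mu> {x} = 0 then add_atom \<mu> x else \<mu>)"

lemma sets_add_point [simp]: "sets (add_point \<mu> x) = sets \<mu>"
  and space_add_point [simp]: "space (add_point \<mu> x) = space \<mu>"
  by (simp_all add: add_point_def)

lemma emeasure_add_point:
  "A \<in> sets \<mu> \<Longrightarrow> emeasure (add_point \<mu> x) A = emeasure \<mu> A + (if emeasure \<mu> {x} = 0 then indicator A x else 0)"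
  by (simp add: add_point_def emeasure_add_atom)

lemma singleton_sets_hp_borel: "x \<in> half_plane \<Longrightarrow> {x} \<in> sets hp_borel"
  by (auto simp: sets_restrict_space image_iff intro!: bexI[of _ "{x}"])

lemma add_point_counting_measures:
  assumes \<mu>: "\<mu> \<in> counting_measures" and x: "x \<in> half_plane"
  shows "add_point \<mu> x \<in> counting_measures"
proof -
  note s = counting_measures_sets[OF \<mu>]
  have "emeasure (add_point \<mu> x) A \<in> range ennreal_of_enat" if A: "A \<in> sets hp_borel" for A
  proof -
    have "emeasure \<mu> A \<in> range ennreal_of_enat"
      using \<mu> A by (simp add: counting_measures_def)
    then obtain e where "emeasure \<mu> A = ennreal_of_enat e"
      by (rule imageE)
    then have "emeasure (add_point \<mu> x) A = ennreal_of_enat (e + (if emeasure \<mu> {x} = 0 \<and> x \<in> A then 1 else 0))"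
      using A by (auto simp: emeasure_add_point s ennreal_of_enat_plus simp flip: one_enat_def)
    then show ?thesis
      by blast
  qed
  moreover have "emeasure (add_point \<mu> x) K < \<infinity>" if K: "compact K" "K \<subseteq> half_plane" for K
  proof -
    have "K \<in> sets hp_borel"
      using K by (auto simp: sets_restrict_space image_iff intro!: bexI[of _ K] borel_closed compact_imp_closed)
    moreover have "emeasure \<mu> K < \<infinity>"
      using \<mu> K by (simp add: counting_measures_def)
    ultimately show ?thesis
      by (simp add: emeasure_add_point s) (simp add: indicator_def)
  qed
  moreover have "emeasure (add_point \<mu> x) {y} \<le> 1" if y: "y \<in> half_plane" for y
  proof -
    have "emeasure \<mu> {y} \<le> 1"
      using \<mu> y by (simp add: counting_measures_def)
    then show ?thesis
      using singleton_sets_hp_borel[OF y] by (auto simp: emeasure_add_point s indicator_def)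
  qed
  ultimately show ?thesis
    using s by (simp add: counting_measures_def)
qed

section \<open>Restriction to the past\<close>

lemma sets_restrict_before [simp]: "sets (restrict_before s \<mu>) = sets \<mu>"
  and space_restrict_before [simp]: "space (restrict_before s \<mu>) = space \<mu>"
  by (simp_all add: restrict_before_def)

lemma before_measurable: "{..<s} \<times> {0..} \<in> sets hp_borel" for s :: real
proof -
  have "{..<s} \<times> {0..} = {x \<in> space hp_borel. fst x < s}"
    by (auto simp: mem_half_plane)
  also have "\<dots> \<in> sets hp_borel"
    by measurable
  finally show ?thesis .
qed

lemma restrict_before_counting_measures:
  assumes \<mu>: "\<mu> \<in> counting_measures"
  shows "restrict_before s \<mu> \<in> counting_measures"
proof -
  note st = counting_measures_sets[OF \<mu>]
  note e = emeasure_restrict_before[OF st, unfolded st]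
  have le: "emeasure (restrict_before s \<mu>) A \<le> emeasure \<mu> A" if "A \<in> sets hp_borel" for A
    using that by (auto simp: e st intro!: emeasure_mono)
  have "emeasure (restrict_before s \<mu>) A \<in> range ennreal_of_enat" if "A \<in> sets hp_borel" for A
    using \<mu> sets.Int[OF that before_measurable] by (simp add: e[OF that] counting_measures_def)
  moreover have "emeasure (restrict_before s \<mu>) K < \<infinity>" if K: "compact K" "K \<subseteq> half_plane" for K
  proof -
    have "K \<in> sets hp_borel"
      using K by (auto simp: sets_restrict_space image_iff intro!: bexI[of _ K] borel_closed compact_imp_closed)
    from le[OF this] \<mu> K show ?thesis
      by (auto simp: counting_measures_def intro: le_less_trans)
  qed
  moreover have "emeasure (restrict_before s \<mu>) {y} \<le> 1" if y: "y \<in> half_plane" for y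
    using le[OF singleton_sets_hp_borel[OF y]] \<mu> y by (auto simp: counting_measures_def intro: order_trans)
  ultimately show ?thesis
    using st by (simp add: counting_measures_def)
qed

lemma restrict_before_add_point_after:
  assumes \<mu>: "\<mu> \<in> counting_measures" and s: "s \<le> fst x"
  shows "restrict_before s (add_point \<mu> x) = restrict_before s \<mu>"
proof (rule measure_eqI)
  note st = counting_measures_sets[OF \<mu>]
  fix A assume "A \<in> sets (restrict_before s (add_point \<mu> x))"
  then have A: "A \<in> sets hp_borel"
    by (simp add: st)
  show "emeasure (restrict_before s (add_point \<mu> x)) A = emeasure (restrict_before s \<mu>) A"
    using A before_measurable[of s] s
    by (cases x) (auto simp: emeasure_restrict_before st emeasure_add_point)
qed simp

lemma restrict_before_add_point_before:
  assumes \<mu>: "\<mu> \<in> counting_measures" and x: "x \<in> half_plane" and s: "fst x < s"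
  shows "restrict_before s (add_point \<mu> x) = add_point (restrict_before s \<mu>) x"
proof (rule measure_eqI)
  note st = counting_measures_sets[OF \<mu>]
  fix A assume "A \<in> sets (restrict_before s (add_point \<mu> x))"
  then have A: "A \<in> sets hp_borel"
    by (simp add: st)
  have x': "x \<in> {..<s} \<times> {0..}"
    using x s by (cases x) (auto simp: half_plane_def)
  then have "emeasure (restrict_before s \<mu>) {x} = emeasure \<mu> {x}"
    using singleton_sets_hp_borel[OF x] by (simp add: emeasure_restrict_before st)
  then show "emeasure (restrict_before s (add_point \<mu> x)) A = emeasure (add_point (restrict_before s \<mu>) x) A"
    using A before_measurable[of s] x'
    by (auto simp: emeasure_restrict_before st emeasure_add_point indicator_def)
qed simp

text \<open>A point at or after time s leaves no trace before s, even if another point is added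
  afterwards. This makes the increment of the intensity caused by x predictable.\<close>

lemma restrict_before_add_point_add_point:
  assumes \<mu>: "\<mu> \<in> counting_measures" and x: "x \<in> half_plane" and y: "y \<in> half_plane" "s \<le> fst y"
  shows "restrict_before s (add_point (add_point \<mu> y) x) = restrict_before s (add_point \<mu> x)"
proof (cases "s \<le> fst x")
  case True
  then show ?thesis
    using \<mu> y add_point_counting_measures[OF \<mu> y(1)] by (simp add: restrict_before_add_point_after)
next
  case False
  then show ?thesis
    using \<mu> x y add_point_counting_measures[OF \<mu> y(1)]
    by (simp add: restrict_before_add_point_after restrict_before_add_point_before)
qed

text \<open>The singleton is a section of the diagonal, which is measurable, so the kernel lemma
  applies.\<close>

lemma emeasure_point_measurable:
  "(\<lambda>p. emeasure (snd p) {fst p}) \<in> borel_measurable (hp_borel \<Otimes>\<^sub>M CM)"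
proof -
  let ?D = "{q \<in> space (hp_borel \<Otimes>\<^sub>M (hp_borel \<Otimes>\<^sub>M CM)). fst (fst q) = fst (fst (snd q)) \<and> snd (fst q) = snd (fst (snd q))}"
  have "?D \<in> sets (hp_borel \<Otimes>\<^sub>M (hp_borel \<Otimes>\<^sub>M CM))"
    by measurable
  from emeasure_kernel_measurable[OF this measurable_snd]
  show ?thesis
  proof (rule measurable_cong[THEN iffD1, rotated])
    fix p assume p: "p \<in> space (hp_borel \<Otimes>\<^sub>M CM)"
    then have "{x. (x, p) \<in> ?D} = {fst p}"
      by (auto simp: space_pair_measure prod_eq_iff)
    then show "emeasure (snd p) {x. (x, p) \<in> ?D} = emeasure (snd p) {fst p}"
      by simp
  qed
qed

lemma add_point_measurable [measurable]:
  assumes [measurable]: "f \<in> M \<rightarrow>\<^sub>M hp_borel" "g \<in> M \<rightarrow>\<^sub>M CM"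
  shows "(\<lambda>\<omega>. add_point (g \<omega>) (f \<omega>)) \<in> M \<rightarrow>\<^sub>M CM"
proof (rule measurable_CM)
  have fg: "f \<omega> \<in> half_plane" "g \<omega> \<in> counting_measures" if "\<omega> \<in> space M" for \<omega>
    using measurable_space[OF assms(1) that] measurable_space[OF assms(2) that] by auto
  then show "add_point (g \<omega>) (f \<omega>) \<in> counting_measures" if "\<omega> \<in> space M" for \<omega>
    using that by (intro add_point_counting_measures) auto
  fix n i assume i: "i \<in> idx n"
  have [measurable]: "(\<lambda>\<omega>. emeasure (g \<omega>) (cell n i)) \<in> borel_measurable M"
    using measurable_compose[OF assms(2) emeasure_cell_measurable[OF i]] .
  have [measurable]: "(\<lambda>\<omega>. emeasure (g \<omega>) {f \<omega>}) \<in> borel_measurable M"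
    using measurable_compose[OF measurable_Pair[OF assms] emeasure_point_measurable] by simp
  have "(\<lambda>\<omega>. emeasure (g \<omega>) (cell n i) + (if emeasure (g \<omega>) {f \<omega>} = 0 then indicator (cell n i) (f \<omega>) else 0))
      \<in> borel_measurable M"
    by measurable
  then show "(\<lambda>\<omega>. emeasure (add_point (g \<omega>) (f \<omega>)) (cell n i)) \<in> borel_measurable M"
    by (rule measurable_cong[THEN iffD1, rotated])
      (use fg in \<open>auto simp: emeasure_add_point counting_measures_sets\<close>)
qed

lemma restrict_before_measurable [measurable]:
  assumes [measurable]: "f \<in> borel_measurable M" "g \<in> M \<rightarrow>\<^sub>M CM"
  shows "(\<lambda>\<omega>. restrict_before (f \<omega>) (g \<omega>)) \<in> M \<rightarrow>\<^sub>M CM"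
proof (rule measurable_CM)
  have g: "g \<omega> \<in> counting_measures" if "\<omega> \<in> space M" for \<omega>
    using measurable_space[OF assms(2) that] by auto
  then show "restrict_before (f \<omega>) (g \<omega>) \<in> counting_measures" if "\<omega> \<in> space M" for \<omega>
    using that by (intro restrict_before_counting_measures) auto
  fix n i assume i: "i \<in> idx n"
  let ?D = "{q \<in> space (hp_borel \<Otimes>\<^sub>M M). fst q \<in> cell n i \<and> fst (fst q) < f (snd q)}"
  have "?D \<in> sets (hp_borel \<Otimes>\<^sub>M M)"
    by measurable
  from emeasure_kernel_measurable[OF this assms(2)]
  show "(\<lambda>\<omega>. emeasure (restrict_before (f \<omega>) (g \<omega>)) (cell n i)) \<in> borel_measurable M"
  proof (rule measurable_cong[THEN iffD1, rotated])
    fix \<omega> assume \<omega>: "\<omega> \<in> space M"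
    then have "{x. (x, \<omega>) \<in> ?D} = cell n i \<inter> {..<f \<omega>} \<times> {0..}"
      using cell_subset by (auto simp: space_pair_measure mem_half_plane)
    then show "emeasure (g \<omega>) {x. (x, \<omega>) \<in> ?D} = emeasure (restrict_before (f \<omega>) (g \<omega>)) (cell n i)"
      using g[OF \<omega>] by (simp add: emeasure_restrict_before counting_measures_sets)
  qed
qed

section \<open>The Mecke formula\<close>

abbreviation (input) "hpl \<equiv> half_plane_lebesgue"

lemmas sets_hpl [measurable_cong, simp] = sets_half_plane_lebesgue

lemma space_hpl [simp]: "space hpl = half_plane"
  using sets_eq_imp_space_eq[OF sets_half_plane_lebesgue] by simp

lemma emeasure_hpl: "A \<subseteq> half_plane \<Longrightarrow> emeasure hpl A = emeasure lborel A"
  unfolding half_plane_lebesgue_def by (intro emeasure_restrict_space) auto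

lemma nn_integral_hpl:
  assumes f: "f \<in> borel_measurable hp_borel"
  shows "(\<integral>\<^sup>+x. f x \<partial>hpl) = (\<integral>\<^sup>+t. (\<integral>\<^sup>+z\<in>{0..}. f (t, z) \<partial>lborel) \<partial>lborel)"
proof -
  have m: "(\<lambda>x. f x * indicator half_plane x) \<in> borel_measurable borel"
    using f by (subst borel_measurable_restrict_space_iff_ennreal[symmetric]) auto
  have "(\<integral>\<^sup>+x. f x \<partial>hpl) = (\<integral>\<^sup>+x. f x * indicator half_plane x \<partial>lborel)"
    unfolding half_plane_lebesgue_def by (intro nn_integral_restrict_space) auto
  also have "\<dots> = (\<integral>\<^sup>+t. \<integral>\<^sup>+z. f (t, z) * indicator half_plane (t, z) \<partial>lborel \<partial>lborel)"
    using m unfolding lborel_prod[symmetric]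
    by (intro lborel.nn_integral_fst[symmetric]) (simp add: lborel_prod)
  also have "\<dots> = (\<integral>\<^sup>+t. (\<integral>\<^sup>+z\<in>{0..}. f (t, z) \<partial>lborel) \<partial>lborel)"
    by (intro nn_integral_cong) (auto simp: half_plane_def indicator_def)
  finally show ?thesis .
qed

lemma emeasure_hpl_singleton: "x \<in> half_plane \<Longrightarrow> emeasure hpl {x} = 0"
  by (simp add: emeasure_hpl)

lemma time_slice_measurable: "{y \<in> half_plane. fst y = t} \<in> sets hp_borel"
proof -
  have "{y \<in> half_plane. fst y = t} = {y \<in> space hp_borel. fst y = t}"
    by simp
  also have "\<dots> \<in> sets hp_borel"
    by measurable
  finally show ?thesis .
qed

text \<open>The line has infinite length, but only a single time carries this infinite inner
  integral. The fact rules out simultaneous points.\<close>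

lemma emeasure_hpl_time_slice: "emeasure hpl {y \<in> half_plane. fst y = t} = 0"
proof -
  have "emeasure hpl {y \<in> half_plane. fst y = t} = (\<integral>\<^sup>+y. indicator {y \<in> half_plane. fst y = t} y \<partial>hpl)"
    using time_slice_measurable by simp
  also have "\<dots> = (\<integral>\<^sup>+s. (\<integral>\<^sup>+z\<in>{0..}. indicator {y \<in> half_plane. fst y = t} (s, z) \<partial>lborel) \<partial>lborel)"
    using time_slice_measurable by (intro nn_integral_hpl) auto
  also have "\<dots> = (\<integral>\<^sup>+s. indicator {t} s * (\<integral>\<^sup>+z. indicator {0::real..} z \<partial>lborel) \<partial>(lborel :: real measure))"
  proof (intro nn_integral_cong)
    fix s
    show "(\<integral>\<^sup>+z\<in>{0..}. indicator {y \<in> half_plane. fst y = t} (s, z) \<partial>lborel)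
      = indicator {t} s * (\<integral>\<^sup>+z. indicator {0::real..} z \<partial>lborel)"
    proof (cases "s = t")
      case True
      then have "indicator {y \<in> half_plane. fst y = t} (s, z) * indicator {0..} z = (indicator {0..} z :: ennreal)" for z
        by (simp add: mem_half_plane split: split_indicator)
      then show ?thesis
        using True by (simp only: indicator_simps singletonI mult_1)
    qed simp
  qed
  also have "\<dots> = 0"
    by (subst nn_integral_multc) auto
  finally show ?thesis .
qed

lemma emeasure_hpl_box: "emeasure hpl (hp_box n) < \<infinity>"
proof -
  have "emeasure hpl (hp_box n) \<le> emeasure lborel (cbox (- real n, 0) (real n, real n))"
    unfolding emeasure_hpl[OF box_subset]
    by (rule emeasure_mono) (auto simp: hp_box_def cbox_Pair_eq intro!: borel_closed closed_Times)
  also have "\<dots> < \<infinity>"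
    by (rule emeasure_lborel_cbox_finite)
  finally show ?thesis .
qed

lemma sigma_finite_hpl: "sigma_finite_measure hpl"
proof
  show "\<exists>A. countable A \<and> A \<subseteq> sets hpl \<and> \<Union> A = space hpl \<and> (\<forall>a\<in>A. emeasure hpl a \<noteq> \<infinity>)"
    using emeasure_hpl_box box_UN by (intro exI[of _ "range hp_box"]) (auto simp: less_top)
qed

interpretation hpl: sigma_finite_measure hpl
  by (rule sigma_finite_hpl)

lemma emeasure_hpl_cell: "i \<in> idx n \<Longrightarrow> emeasure hpl (cell n i) = ennreal (measure hpl (cell n i))"
  using emeasure_hpl_box[of n] emeasure_mono[OF cell_box, of i n hpl]
  by (intro emeasure_eq_ennreal_measure) (auto simp: top_unique)

text \<open>Products of cells and count events of the same level are nested across levels, which makes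
  them, together with the empty set, a \<open>\<inter>\<close>-stable generator of the product space.\<close>

definition cell_counts :: "((real \<times> real) \<times> (real \<times> real) measure) set set" where
  "cell_counts = (\<Union>n. (\<lambda>(i, k). cell n i \<times> counts_are n k) ` (idx n \<times> count_maps n))"

lemma countable_cell_counts: "countable cell_counts"
  unfolding cell_counts_def
  by (intro countable_UN countable_image countable_SIGMA countable_count_maps) (auto intro: countable_finite)

lemma cell_countsE:
  assumes "C \<in> cell_counts"
  obtains n i k where "C = cell n i \<times> counts_are n k" "i \<in> idx n" "k \<in> count_maps n"
  using assms by (auto simp: cell_counts_def)

lemma cell_countsI:
  "i \<in> idx n \<Longrightarrow> k \<in> count_maps n \<Longrightarrow> cell n i \<times> counts_are n k \<in> cell_counts"
  unfolding cell_counts_def by (intro UN_I[of n] image_eqI[of _ _ "(i, k)"]) auto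

lemma cell_counts_subset: "cell_counts \<subseteq> Pow (half_plane \<times> counting_measures)"
  using cell_subset counts_are_subset by (auto elim!: cell_countsE) blast+

lemma ex_cell_counts:
  assumes "x \<in> half_plane" "\<mu> \<in> counting_measures"
  shows "\<exists>m\<ge>n. \<exists>k\<in>count_maps m. grid m x \<in> idx m \<and> x \<in> cell m (grid m x) \<and> \<mu> \<in> counts_are m k"
proof -
  obtain m where m: "m \<ge> n" "x \<in> hp_box m"
    using ex_box[OF assms(1)] by blast
  obtain k where "k \<in> count_maps m" "\<mu> \<in> counts_are m k"
    using ex_counts_are[OF assms(2)] by blast
  with m assms(1) show ?thesis
    by (intro exI[of _ m] conjI bexI[of _ k]) (auto simp: grid_idx_iff cell_def)
qed

lemma Int_stable_cell_counts: "Int_stable (insert {} cell_counts)"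
proof -
  have *: "(cell n i \<times> counts_are n k) \<inter> (cell m j \<times> counts_are m l) \<in> insert {} cell_counts"
    if "n \<le> m" "j \<in> idx m" "l \<in> count_maps m" for n i k m j l
  proof (cases "(cell n i \<times> counts_are n k) \<inter> (cell m j \<times> counts_are m l) = {}")
    case False
    then obtain x \<mu> where x: "x \<in> cell n i" "x \<in> cell m j" "\<mu> \<in> counts_are n k" "\<mu> \<in> counts_are m l"
      by auto
    from cell_nested[OF that(1) x(2,1)] counts_are_nested[OF that(1) x(4,3)]
    have "(cell n i \<times> counts_are n k) \<inter> (cell m j \<times> counts_are m l) = cell m j \<times> counts_are m l"
      by blast
    then show ?thesis
      using that cell_countsI by simp
  qed simp
  show ?thesis
    unfolding Int_stable_def
  proof (intro ballI)
    fix C D assume CD: "C \<in> insert {} cell_counts" "D \<in> insert {} cell_counts"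
    show "C \<inter> D \<in> insert {} cell_counts"
    proof (cases "C = {} \<or> D = {}")
      case False
      with CD have "C \<in> cell_counts" "D \<in> cell_counts"
        by auto
      then obtain n i k m j l where C: "C = cell n i \<times> counts_are n k" "i \<in> idx n" "k \<in> count_maps n"
        and D: "D = cell m j \<times> counts_are m l" "j \<in> idx m" "l \<in> count_maps m"
        by (elim cell_countsE)
      show ?thesis
      proof (cases "n \<le> m")
        case True
        show ?thesis
          unfolding C(1) D(1) by (rule *[OF True D(2,3)])
      next
        case False
        then have "m \<le> n"
          by simp
        from *[OF this C(2,3), of j l] show ?thesis
          unfolding C(1) D(1) by (simp only: Int_commute)
      qed
    qed auto
  qed
qed

text \<open>The preimage of a cell or of a count event under a projection is the union of the
  members of \<open>cell_counts\<close> that it contains, because a high level refines any given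
  one; countability of \<open>cell_counts\<close> makes this union measurable.\<close>

lemma sets_hp_borel_CM: "sets (hp_borel \<Otimes>\<^sub>M CM) = sigma_sets (half_plane \<times> counting_measures) (insert {} cell_counts)"
proof
  let ?S = "sigma (half_plane \<times> counting_measures) (insert {} cell_counts)"
  have S: "sets ?S = sigma_sets (half_plane \<times> counting_measures) (insert {} cell_counts)"
    "space ?S = half_plane \<times> counting_measures"
    using cell_counts_subset by (auto simp: sets_measure_of_conv space_measure_of_conv)
  have gen: "T \<in> sets ?S" if T: "\<And>p. p \<in> T \<Longrightarrow> \<exists>C\<in>cell_counts. p \<in> C \<and> C \<subseteq> T" for T
  proof -
    have "T = \<Union>{C \<in> cell_counts. C \<subseteq> T}"
    proof (intro equalityI subsetI)
      fix p assume "p \<in> T"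
      from T[OF this] show "p \<in> \<Union>{C \<in> cell_counts. C \<subseteq> T}"
        by auto
    qed auto
    moreover have "\<Union>{C \<in> cell_counts. C \<subseteq> T} \<in> sets ?S"
      by (intro sets.countable_Union countable_subset[OF _ countable_cell_counts]) (auto simp: S)
    ultimately show ?thesis
      by simp
  qed
  have f: "fst \<in> ?S \<rightarrow>\<^sub>M hp_borel"
  proof (rule measurable_sigma_sets[OF sets_hp_borel_cells])
    fix A assume "A \<in> cells"
    then obtain n i where A: "A = cell n i" "i \<in> idx n"
      unfolding cells_def by (elim UN_E imageE)
    show "fst -` A \<inter> space ?S \<in> sets ?S"
    proof (rule gen)
      fix p assume p: "p \<in> fst -` A \<inter> space ?S"
      obtain x \<mu> where [simp]: "p = (x, \<mu>)"
        by (cases p)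
      from p have x: "x \<in> half_plane" "\<mu> \<in> counting_measures" "x \<in> cell n i"
        by (auto simp: S A)
      obtain m k where m: "m \<ge> n" "k \<in> count_maps m" "grid m x \<in> idx m" "x \<in> cell m (grid m x)" "\<mu> \<in> counts_are m k"
        using ex_cell_counts[OF x(1,2), of n] by blast
      have "cell m (grid m x) \<times> counts_are m k \<subseteq> fst -` A \<inter> space ?S"
        using cell_nested[OF m(1,4) x(3)] cell_subset[of m "grid m x"] counts_are_subset[of m k] by (auto simp: A S)
      with m show "\<exists>C\<in>cell_counts. p \<in> C \<and> C \<subseteq> fst -` A \<inter> space ?S"
        by (intro bexI[OF _ cell_countsI[OF m(3,2)]]) auto
    qed
  qed (use cell_subset in \<open>auto simp: S cells_def\<close>)
  have s: "snd \<in> ?S \<rightarrow>\<^sub>M CM"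
  proof (rule measurable_sigma_sets[OF sets_CM])
    fix A assume "A \<in> {{\<mu> \<in> counting_measures. emeasure \<mu> (cell n i) = of_nat k} | n i k. i \<in> idx n}"
    then obtain n i k where A: "A = {\<mu> \<in> counting_measures. emeasure \<mu> (cell n i) = of_nat k}" "i \<in> idx n"
      by blast
    show "snd -` A \<inter> space ?S \<in> sets ?S"
    proof (rule gen)
      fix p assume p: "p \<in> snd -` A \<inter> space ?S"
      obtain x \<mu> where [simp]: "p = (x, \<mu>)"
        by (cases p)
      from p have x: "x \<in> half_plane" "\<mu> \<in> counting_measures" "emeasure \<mu> (cell n i) = of_nat k"
        by (auto simp: S A)
      obtain m l where m: "m \<ge> n" "l \<in> count_maps m" "grid m x \<in> idx m" "x \<in> cell m (grid m x)" "\<mu> \<in> counts_are m l"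
        using ex_cell_counts[OF x(1,2), of n] by blast
      obtain l' where l': "\<mu> \<in> counts_are n l'"
        using ex_counts_are[OF x(2)] by blast
      then have "of_nat (l' i) = (of_nat k :: ennreal)"
        using x(3) A(2) by (simp add: counts_are_def)
      then have "counts_are n l' \<subseteq> A"
        using A(2) by (auto simp: A counts_are_def)
      then have "cell m (grid m x) \<times> counts_are m l \<subseteq> snd -` A \<inter> space ?S"
        using counts_are_nested[OF m(1,5) l'] cell_subset[of m "grid m x"] counts_are_subset[of m l] by (auto simp: S)
      with m show "\<exists>C\<in>cell_counts. p \<in> C \<and> C \<subseteq> snd -` A \<inter> space ?S"
        by (intro bexI[OF _ cell_countsI[OF m(3,2)]]) auto
    qed
  qed (auto simp: S)
  have id: "(\<lambda>p. p) \<in> ?S \<rightarrow>\<^sub>M hp_borel \<Otimes>\<^sub>M CM"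
    by (rule measurable_pair) (use f s in \<open>auto simp: comp_def\<close>)
  have "D \<in> sets ?S" if "D \<in> sets (hp_borel \<Otimes>\<^sub>M CM)" for D
  proof -
    have "(\<lambda>p. p) -` D \<inter> space ?S \<in> sets ?S"
      using id that by (rule measurable_sets)
    moreover have "D \<subseteq> space ?S"
      using sets.sets_into_space[OF that] by (simp add: S space_pair_measure)
    ultimately show ?thesis
      by (simp add: Int_absorb2)
  qed
  then show "sets (hp_borel \<Otimes>\<^sub>M CM) \<subseteq> sigma_sets (half_plane \<times> counting_measures) (insert {} cell_counts)"
    unfolding S(1)[symmetric] by blast
  have "insert {} cell_counts \<subseteq> sets (hp_borel \<Otimes>\<^sub>M CM)"
    by (auto elim!: cell_countsE)
  from sets.sigma_sets_subset[OF this]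
  show "sigma_sets (half_plane \<times> counting_measures) (insert {} cell_counts) \<subseteq> sets (hp_borel \<Otimes>\<^sub>M CM)"
    by (simp add: space_pair_measure)
qed

text \<open>Two facts about the law are recorded: the joint Poisson weights of the cell counts of
  one level, which are what the generator \<open>cell_counts\<close> sees, and the absence of points
  in null sets, applied to single points and to vertical lines.\<close>

locale poisson_law = prob_space P for P :: "(real \<times> real) measure measure" +
  assumes sets_P [measurable_cong, simp]: "sets P = sets CM"
    and prob_counts: "measure P (counts_are n k) =
      (\<Prod>i\<in>idx n. exp (- measure hpl (cell n i)) * measure hpl (cell n i) ^ k i / fact (k i))"
    and AE_null: "A \<in> sets hp_borel \<Longrightarrow> emeasure hpl A = 0 \<Longrightarrow> AE \<mu> in P. emeasure \<mu> A = 0"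
begin

lemma space_P [simp]: "space P = counting_measures"
  using sets_eq_imp_space_eq[OF sets_P] by simp

sublocale HP: pair_sigma_finite hpl P ..

lemma AE_no_point: "x \<in> half_plane \<Longrightarrow> AE \<mu> in P. emeasure \<mu> {x} = 0"
  by (intro AE_null singleton_sets_hp_borel emeasure_hpl_singleton)

text \<open>The two sides of the Mecke formula as measures on the product space.\<close>

definition campbell :: "((real \<times> real) \<times> (real \<times> real) measure) measure" where
  "campbell = measure_of (half_plane \<times> counting_measures) (sets (hp_borel \<Otimes>\<^sub>M CM))
     (\<lambda>D. \<integral>\<^sup>+\<mu>. emeasure \<mu> {x. (x, \<mu>) \<in> D} \<partial>P)"

definition shifted :: "((real \<times> real) \<times> (real \<times> real) measure) measure" where
  "shifted = distr (hpl \<Otimes>\<^sub>M P) (hp_borel \<Otimes>\<^sub>M CM) (\<lambda>(x, \<mu>). (x, add_point \<mu> x))"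

lemma sets_campbell [measurable_cong, simp]: "sets campbell = sets (hp_borel \<Otimes>\<^sub>M CM)"
proof -
  have "half_plane \<times> counting_measures = space (hp_borel \<Otimes>\<^sub>M CM)"
    by (simp add: space_pair_measure)
  then show ?thesis
    unfolding campbell_def by (simp only: sets.sets_measure_of_eq)
qed

lemma emeasure_campbell:
  assumes "D \<in> sets (hp_borel \<Otimes>\<^sub>M CM)"
  shows "emeasure campbell D = (\<integral>\<^sup>+\<mu>. emeasure \<mu> {x. (x, \<mu>) \<in> D} \<partial>P)"
proof (rule emeasure_measure_of[OF campbell_def])
  show "sets (hp_borel \<Otimes>\<^sub>M CM) \<subseteq> Pow (half_plane \<times> counting_measures)"
    using sets.space_closed[of "hp_borel \<Otimes>\<^sub>M CM"] by (simp add: space_pair_measure)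
  show "D \<in> sets campbell"
    using assms by simp
  show "positive (sets campbell) (\<lambda>D. \<integral>\<^sup>+\<mu>. emeasure \<mu> {x. (x, \<mu>) \<in> D} \<partial>P)"
    by (simp add: positive_def)
  show "countably_additive (sets campbell) (\<lambda>D. \<integral>\<^sup>+\<mu>. emeasure \<mu> {x. (x, \<mu>) \<in> D} \<partial>P)"
  proof (rule countably_additiveI)
    fix F :: "nat \<Rightarrow> _" assume F: "range F \<subseteq> sets campbell" "disjoint_family F"
    have Fm: "F i \<in> sets (hp_borel \<Otimes>\<^sub>M CM)" for i
      using F(1) by auto
    have [measurable]: "(\<lambda>\<mu>. emeasure \<mu> {x. (x, \<mu>) \<in> F i}) \<in> borel_measurable P" for i
      using emeasure_kernel_measurable[OF Fm measurable_ident, of i] by simp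
    have "(\<Sum>i. \<integral>\<^sup>+\<mu>. emeasure \<mu> {x. (x, \<mu>) \<in> F i} \<partial>P) = (\<integral>\<^sup>+\<mu>. (\<Sum>i. emeasure \<mu> {x. (x, \<mu>) \<in> F i}) \<partial>P)"
      by (rule nn_integral_suminf[symmetric]) measurable
    also have "\<dots> = (\<integral>\<^sup>+\<mu>. emeasure \<mu> {x. (x, \<mu>) \<in> \<Union> (range F)} \<partial>P)"
    proof (intro nn_integral_cong)
      fix \<mu> assume \<mu>: "\<mu> \<in> space P"
      have "{x. (x, \<mu>) \<in> \<Union> (range F)} = (\<Union>i. {x. (x, \<mu>) \<in> F i})"
        by auto
      moreover have "disjoint_family (\<lambda>i. {x. (x, \<mu>) \<in> F i})"
        using F(2) unfolding disjoint_family_on_def by blast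
      moreover have "{x. (x, \<mu>) \<in> F i} \<in> sets \<mu>" for i
        using sets_Pair2[OF Fm, of \<mu> i] \<mu> by (simp add: counting_measures_sets vimage_def)
      ultimately show "(\<Sum>i. emeasure \<mu> {x. (x, \<mu>) \<in> F i}) = emeasure \<mu> {x. (x, \<mu>) \<in> \<Union> (range F)}"
        by (simp only:) (intro suminf_emeasure, auto)
    qed
    finally show "(\<Sum>i. \<integral>\<^sup>+\<mu>. emeasure \<mu> {x. (x, \<mu>) \<in> F i} \<partial>P)
        = (\<integral>\<^sup>+\<mu>. emeasure \<mu> {x. (x, \<mu>) \<in> \<Union> (range F)} \<partial>P)" .
  qed
qed

lemma shift_measurable: "(\<lambda>(x, \<mu>). (x, add_point \<mu> x)) \<in> hpl \<Otimes>\<^sub>M P \<rightarrow>\<^sub>M hp_borel \<Otimes>\<^sub>M CM"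
  unfolding split_beta' by measurable

lemma nn_integral_shifted:
  assumes h: "h \<in> borel_measurable (hp_borel \<Otimes>\<^sub>M CM)"
  shows "(\<integral>\<^sup>+p. h p \<partial>shifted) = (\<integral>\<^sup>+x. \<integral>\<^sup>+\<mu>. h (x, add_point \<mu> x) \<partial>P \<partial>hpl)"
proof -
  have "(\<integral>\<^sup>+p. h p \<partial>shifted) = (\<integral>\<^sup>+p. h (case p of (x, \<mu>) \<Rightarrow> (x, add_point \<mu> x)) \<partial>(hpl \<Otimes>\<^sub>M P))"
    unfolding shifted_def
    by (rule nn_integral_distr[OF shift_measurable]) (use h in \<open>simp cong: measurable_cong_sets\<close>)
  also have "\<dots> = (\<integral>\<^sup>+x. \<integral>\<^sup>+\<mu>. h (x, add_point \<mu> x) \<partial>P \<partial>hpl)"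
    using measurable_compose[OF shift_measurable h] by (subst nn_integral_fst[symmetric]) auto
  finally show ?thesis .
qed

lemma nn_integral_campbell:
  assumes h: "h \<in> borel_measurable (hp_borel \<Otimes>\<^sub>M CM)"
  shows "(\<integral>\<^sup>+p. h p \<partial>campbell) = (\<integral>\<^sup>+\<mu>. \<integral>\<^sup>+x. h (x, \<mu>) \<partial>\<mu> \<partial>P)"
proof -
  have sp: "space campbell = half_plane \<times> counting_measures"
    using sets_eq_imp_space_eq[OF sets_campbell] by (simp add: space_pair_measure)
  have K: "(\<lambda>\<mu>. \<integral>\<^sup>+x. u (x, \<mu>) \<partial>\<mu>) \<in> borel_measurable P" if "u \<in> borel_measurable (hp_borel \<Otimes>\<^sub>M CM)" for u
    using nn_integral_kernel_measurable[OF that measurable_ident] by simp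
  have sl: "(\<lambda>x. u (x, \<mu>)) \<in> borel_measurable \<mu>"
    if "u \<in> borel_measurable (hp_borel \<Otimes>\<^sub>M CM)" "\<mu> \<in> space P" for u :: "_ \<Rightarrow> ennreal" and \<mu>
    using measurable_Pair1[OF that(1), of \<mu>] that(2) by (simp cong: measurable_cong_sets add: counting_measures_sets)
  have "h \<in> borel_measurable campbell"
    using h by (simp cong: measurable_cong_sets)
  then show ?thesis
  proof (induction rule: borel_measurable_induct)
    case (cong f g)
    have "(\<integral>\<^sup>+p. f p \<partial>campbell) = (\<integral>\<^sup>+p. g p \<partial>campbell)"
      using cong(3) by (rule nn_integral_cong)
    moreover have "(\<integral>\<^sup>+\<mu>. \<integral>\<^sup>+x. f (x, \<mu>) \<partial>\<mu> \<partial>P) = (\<integral>\<^sup>+\<mu>. \<integral>\<^sup>+x. g (x, \<mu>) \<partial>\<mu> \<partial>P)"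
      using cong(3) by (intro nn_integral_cong) (auto simp: sp counting_measures_space)
    ultimately show ?case
      using cong by simp
  next
    case (set D)
    then have D: "D \<in> sets (hp_borel \<Otimes>\<^sub>M CM)"
      by simp
    have "(\<integral>\<^sup>+x. indicator D (x, \<mu>) \<partial>\<mu>) = emeasure \<mu> {x. (x, \<mu>) \<in> D}" if "\<mu> \<in> space P" for \<mu>
    proof -
      have "(\<integral>\<^sup>+x. indicator D (x, \<mu>) \<partial>\<mu>) = (\<integral>\<^sup>+x. indicator {x. (x, \<mu>) \<in> D} x \<partial>\<mu>)"
        by (intro nn_integral_cong) (auto simp: indicator_def)
      also have "\<dots> = emeasure \<mu> {x. (x, \<mu>) \<in> D}"
        using sets_Pair2[OF D, of \<mu>] that by (intro nn_integral_indicator) (simp add: counting_measures_sets vimage_def)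
      finally show ?thesis .
    qed
    then have "(\<integral>\<^sup>+\<mu>. \<integral>\<^sup>+x. indicator D (x, \<mu>) \<partial>\<mu> \<partial>P) = (\<integral>\<^sup>+\<mu>. emeasure \<mu> {x. (x, \<mu>) \<in> D} \<partial>P)"
      by (intro nn_integral_cong)
    then show ?case
      using D by (simp add: emeasure_campbell)
  next
    case (mult u c)
    then have u: "u \<in> borel_measurable (hp_borel \<Otimes>\<^sub>M CM)"
      by (simp cong: measurable_cong_sets)
    have "(\<integral>\<^sup>+\<mu>. \<integral>\<^sup>+x. c * u (x, \<mu>) \<partial>\<mu> \<partial>P) = (\<integral>\<^sup>+\<mu>. c * (\<integral>\<^sup>+x. u (x, \<mu>) \<partial>\<mu>) \<partial>P)"
      using sl[OF u] by (intro nn_integral_cong nn_integral_cmult)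
    then show ?case
      using mult K[OF u] by (simp add: nn_integral_cmult)
  next
    case (add u v)
    then have u: "u \<in> borel_measurable (hp_borel \<Otimes>\<^sub>M CM)" and v: "v \<in> borel_measurable (hp_borel \<Otimes>\<^sub>M CM)"
      by (simp_all cong: measurable_cong_sets)
    have "(\<integral>\<^sup>+\<mu>. \<integral>\<^sup>+x. v (x, \<mu>) + u (x, \<mu>) \<partial>\<mu> \<partial>P) = (\<integral>\<^sup>+\<mu>. (\<integral>\<^sup>+x. v (x, \<mu>) \<partial>\<mu>) + (\<integral>\<^sup>+x. u (x, \<mu>) \<partial>\<mu>) \<partial>P)"
      using sl[OF u] sl[OF v] by (intro nn_integral_cong nn_integral_add)
    then show ?case
      using add K[OF u] K[OF v] by (simp add: nn_integral_add)
  next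
    case (seq U)
    then have U: "U i \<in> borel_measurable (hp_borel \<Otimes>\<^sub>M CM)" for i
      by (simp cong: measurable_cong_sets)
    have "(\<integral>\<^sup>+\<mu>. \<integral>\<^sup>+x. (SUP i. U i) (x, \<mu>) \<partial>\<mu> \<partial>P) = (\<integral>\<^sup>+\<mu>. (SUP i. \<integral>\<^sup>+x. U i (x, \<mu>) \<partial>\<mu>) \<partial>P)"
      unfolding SUP_apply using seq(3) sl[OF U]
      by (intro nn_integral_cong nn_integral_monotone_convergence_SUP) (auto simp: incseq_def le_fun_def)
    also have "\<dots> = (SUP i. \<integral>\<^sup>+\<mu>. \<integral>\<^sup>+x. U i (x, \<mu>) \<partial>\<mu> \<partial>P)"
      using seq(3) K[OF U]
      by (intro nn_integral_monotone_convergence_SUP) (auto simp: incseq_def le_fun_def intro!: nn_integral_mono)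
    also have "\<dots> = (\<integral>\<^sup>+p. (SUP i. U i) p \<partial>campbell)"
      unfolding SUP_apply using seq by (subst nn_integral_monotone_convergence_SUP) auto
    finally show ?case
      by simp
  qed
qed

text \<open>On a product of a cell and a count event the Campbell side is \<open>k i\<close> times a
  Poisson probability. On the shifted side the added point raises the count of cell i by one, so the
  count before is \<open>k i - 1\<close>. Both agree by k p(k) = m p(k - 1) for Poisson weights p of
  mean m, the other cells contributing equal factors.\<close>

lemma campbell_eq_shifted: "campbell = shifted"
proof (rule measure_eqI_generator_eq_countable[where E = "insert {} cell_counts" and A = cell_counts])
  show "Int_stable (insert {} cell_counts)"
    by (rule Int_stable_cell_counts)
  show "insert {} cell_counts \<subseteq> Pow (half_plane \<times> counting_measures)"
    using cell_counts_subset by auto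
  show "sets campbell = sigma_sets (half_plane \<times> counting_measures) (insert {} cell_counts)"
    by (simp add: sets_hp_borel_CM)
  show "sets shifted = sigma_sets (half_plane \<times> counting_measures) (insert {} cell_counts)"
    by (simp add: shifted_def sets_hp_borel_CM)
  show "\<Union> cell_counts = half_plane \<times> counting_measures"
  proof (intro equalityI subsetI)
    fix p assume "p \<in> half_plane \<times> counting_measures"
    then obtain x \<mu> where p: "p = (x, \<mu>)" "x \<in> half_plane" "\<mu> \<in> counting_measures"
      by auto
    obtain m k where "k \<in> count_maps m" "grid m x \<in> idx m" "x \<in> cell m (grid m x)" "\<mu> \<in> counts_are m k"
      using ex_cell_counts[OF p(2,3)] by blast
    then show "p \<in> \<Union> cell_counts"
      unfolding p(1) by (intro UnionI[OF cell_countsI[of "grid m x" m k]]) auto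
  qed (use cell_counts_subset in auto)
  show "countable cell_counts"
    by (rule countable_cell_counts)
  have val: "emeasure campbell C = of_nat (k i) * emeasure P (counts_are n k)"
    if C: "C = cell n i \<times> counts_are n k" "i \<in> idx n" for C n i k
  proof -
    have "C \<in> sets (hp_borel \<Otimes>\<^sub>M CM)"
      by (simp add: C)
    then have "emeasure campbell C = (\<integral>\<^sup>+\<mu>. emeasure \<mu> {x. (x, \<mu>) \<in> C} \<partial>P)"
      by (rule emeasure_campbell)
    also have "\<dots> = (\<integral>\<^sup>+\<mu>. of_nat (k i) * indicator (counts_are n k) \<mu> \<partial>P)"
    proof (intro nn_integral_cong)
      fix \<mu>
      have "{x. (x, \<mu>) \<in> C} = (if \<mu> \<in> counts_are n k then cell n i else {})"
        by (auto simp: C(1))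
      then show "emeasure \<mu> {x. (x, \<mu>) \<in> C} = of_nat (k i) * indicator (counts_are n k) \<mu>"
        using C(2) by (auto simp: counts_are_def)
    qed
    also have "\<dots> = of_nat (k i) * emeasure P (counts_are n k)"
      by (intro nn_integral_cmult_indicator) simp
    finally show ?thesis .
  qed
  show "emeasure campbell C \<noteq> \<infinity>" if "C \<in> cell_counts" for C
    using that by (elim cell_countsE) (auto simp: val ennreal_mult_eq_top_iff)
  show "emeasure campbell C = emeasure shifted C" if CC: "C \<in> insert {} cell_counts" for C
  proof (cases "C = {}")
    case False
    with CC have "C \<in> cell_counts"
      by simp
    then obtain n i k where C: "C = cell n i \<times> counts_are n k" "i \<in> idx n" "k \<in> count_maps n"
      by (rule cell_countsE)
    have Cm: "C \<in> sets (hp_borel \<Otimes>\<^sub>M CM)"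
      by (simp add: C)
    define m where "m = measure hpl (cell n i)"
    \<comment> \<open>For \<open>k i = 0\<close> natural subtraction leaves \<open>k\<close>
      unchanged. The conditionals below treat that case separately: a cell that has received a point
      cannot have count 0.\<close>
    define k' where "k' = k(i := k i - 1)"
    have "emeasure shifted C = (\<integral>\<^sup>+p. indicator C p \<partial>shifted)"
      using Cm by (simp add: shifted_def)
    also have "\<dots> = (\<integral>\<^sup>+x. \<integral>\<^sup>+\<mu>. indicator C (x, add_point \<mu> x) \<partial>P \<partial>hpl)"
      using Cm by (intro nn_integral_shifted) auto
    also have "\<dots> = (\<integral>\<^sup>+x. (if k i = 0 then 0 else emeasure P (counts_are n k')) * indicator (cell n i) x \<partial>hpl)"
    proof (intro nn_integral_cong)
      fix x assume "x \<in> space hpl"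
      then have x: "x \<in> half_plane"
        by simp
      have "(\<integral>\<^sup>+\<mu>. indicator C (x, add_point \<mu> x) \<partial>P)
          = (\<integral>\<^sup>+\<mu>. (if k i = 0 then 0 else indicator (cell n i) x) * indicator (counts_are n k') \<mu> \<partial>P)"
      proof (intro nn_integral_cong_AE)
        show "AE \<mu> in P. indicator C (x, add_point \<mu> x) =
            (if k i = 0 then 0 else indicator (cell n i) x) * (indicator (counts_are n k') \<mu> :: ennreal)"
          using AE_no_point[OF x] AE_space
        proof eventually_elim
          case (elim \<mu>)
          then have \<mu>: "\<mu> \<in> counting_measures"
            by simp
          have e: "emeasure (add_point \<mu> x) (cell n j) = emeasure \<mu> (cell n j) + indicator (cell n j) x" for j
            using elim \<mu> by (simp add: emeasure_add_point counting_measures_sets)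
          show ?case
          proof (cases "x \<in> cell n i")
            case True
            then have j: "indicator (cell n j) x = (if j = i then 1 else 0 :: ennreal)" for j
              by (auto simp: cell_def)
            have iff: "emeasure \<mu> (cell n i) + 1 = of_nat (k i) \<longleftrightarrow>
                k i \<noteq> 0 \<and> emeasure \<mu> (cell n i) = of_nat (k i - 1)"
            proof -
              obtain l where l: "emeasure \<mu> (cell n i) = of_nat l"
                using counting_measures_nat[OF \<mu> cell_measurable emeasure_cell_finite[OF \<mu> C(2)]] by blast
              have "of_nat l + 1 = (of_nat (k i) :: ennreal) \<longleftrightarrow> Suc l = k i"
                using of_nat_eq_iff[of "Suc l" "k i", where 'a = ennreal] by (simp add: add.commute)
              then show ?thesis
                unfolding l by auto
            qed
            \<comment> \<open>The cells are split into i, whose count changes, and the others, on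
              which \<open>k\<close> and \<open>k'\<close> agree.\<close>
            have "add_point \<mu> x \<in> counts_are n k \<longleftrightarrow> k i \<noteq> 0 \<and> \<mu> \<in> counts_are n k'"
            proof -
              have split: "(\<forall>j\<in>idx n. Q j) \<longleftrightarrow> Q i \<and> (\<forall>j\<in>idx n - {i}. Q j)" for Q
                using C(2) by blast
              have "add_point \<mu> x \<in> counts_are n k \<longleftrightarrow>
                  (\<forall>j\<in>idx n. emeasure \<mu> (cell n j) + (if j = i then 1 else 0) = of_nat (k j))"
                using add_point_counting_measures[OF \<mu> x] by (simp add: counts_are_def e j)
              also have "\<dots> \<longleftrightarrow> emeasure \<mu> (cell n i) + 1 = of_nat (k i) \<and>
                  (\<forall>j\<in>idx n - {i}. emeasure \<mu> (cell n j) = of_nat (k j))"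
                unfolding split by simp
              also have "\<dots> \<longleftrightarrow> k i \<noteq> 0 \<and> (\<forall>j\<in>idx n. emeasure \<mu> (cell n j) = of_nat (k' j))"
                unfolding split iff by (simp add: k'_def)
              finally show ?thesis
                using \<mu> by (simp add: counts_are_def)
            qed
            then show ?thesis
              using True by (auto simp: C(1) indicator_def)
          next
            case False
            then show ?thesis
              by (simp add: C(1))
          qed
        qed
      qed
      also have "\<dots> = (if k i = 0 then 0 else indicator (cell n i) x) * emeasure P (counts_are n k')"
        by (intro nn_integral_cmult_indicator) simp
      finally show "(\<integral>\<^sup>+\<mu>. indicator C (x, add_point \<mu> x) \<partial>P) =
          (if k i = 0 then 0 else emeasure P (counts_are n k')) * indicator (cell n i) x"
        by (simp add: mult.commute)
    qed
    also have "\<dots> = (if k i = 0 then 0 else emeasure P (counts_are n k')) * ennreal m"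
      unfolding m_def emeasure_hpl_cell[OF C(2), symmetric] by (intro nn_integral_cmult_indicator) simp
    also have "\<dots> = of_nat (k i) * emeasure P (counts_are n k)"
    proof (cases "k i")
      case (Suc l)
      let ?p = "\<lambda>k i. exp (- measure hpl (cell n i)) * measure hpl (cell n i) ^ k i / fact (k i)"
      have "measure P (counts_are n k') = ?p k' i * (\<Prod>j\<in>idx n - {i}. ?p k' j)"
        unfolding prob_counts using C(2) by (intro prod.remove) auto
      also have "(\<Prod>j\<in>idx n - {i}. ?p k' j) = (\<Prod>j\<in>idx n - {i}. ?p k j)"
        by (intro prod.cong) (auto simp: k'_def)
      finally have "m * measure P (counts_are n k') = m * (?p k' i * (\<Prod>j\<in>idx n - {i}. ?p k j))"
        by (simp only:)
      also have "\<dots> = real (k i) * ?p k i * (\<Prod>j\<in>idx n - {i}. ?p k j)"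
        by (simp add: k'_def Suc m_def fact_Suc field_simps del: of_nat_Suc)
      also have "\<dots> = real (k i) * measure P (counts_are n k)"
        unfolding prob_counts using C(2) prod.remove[of "idx n" i "?p k"] by simp
      finally have "ennreal (m * measure P (counts_are n k')) = ennreal (real (k i) * measure P (counts_are n k))"
        by simp
      then show ?thesis
        using Suc by (simp add: emeasure_eq_measure ennreal_mult m_def mult.commute ennreal_of_nat_eq_real_of_nat)
    qed simp
    finally show ?thesis
      using val[OF C(1,2)] by simp
  qed simp
qed (auto)

theorem mecke:
  assumes "h \<in> borel_measurable (hp_borel \<Otimes>\<^sub>M CM)"
  shows "(\<integral>\<^sup>+\<mu>. \<integral>\<^sup>+x. h (x, \<mu>) \<partial>\<mu> \<partial>P) = (\<integral>\<^sup>+x. \<integral>\<^sup>+\<mu>. h (x, add_point \<mu> x) \<partial>P \<partial>hpl)"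
  using nn_integral_campbell[OF assms] nn_integral_shifted[OF assms] campbell_eq_shifted by simp

end

section \<open>Compensated integrals of predictable integrands\<close>

lemma abs_integral_le_nn_integral:
  fixes f :: "'a \<Rightarrow> real"
  shows "ennreal \<bar>\<integral>x. f x \<partial>M\<bar> \<le> (\<integral>\<^sup>+x. ennreal \<bar>f x\<bar> \<partial>M)"
  using integral_norm_bound_ennreal[of M f] by (cases "integrable M f") (auto simp: not_integrable_integral_eq)

lemma nn_integral_add_point:
  assumes "h \<in> borel_measurable \<mu>" "x \<in> space \<mu>" "h x = 0"
  shows "(\<integral>\<^sup>+y. h y \<partial>add_point \<mu> x) = (\<integral>\<^sup>+y. h y \<partial>\<mu>)"
  using assms by (simp add: add_point_def nn_integral_add_atom)

lemma integral_add_point: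
  fixes h :: "'a \<Rightarrow> real"
  assumes h: "h \<in> borel_measurable \<mu>" and x: "x \<in> space \<mu>" "h x = 0"
  shows "(\<integral>y. h y \<partial>add_point \<mu> x) = (\<integral>y. h y \<partial>\<mu>)"
proof (cases "integrable \<mu> h")
  case True
  then show ?thesis
    using x by (simp add: add_point_def integral_add_atom)
next
  case False
  have "(\<integral>\<^sup>+y. ennreal (norm (h y)) \<partial>add_point \<mu> x) = (\<integral>\<^sup>+y. ennreal (norm (h y)) \<partial>\<mu>)"
    using h x by (intro nn_integral_add_point) auto
  with False h have "\<not> integrable (add_point \<mu> x) h"
    by (simp add: integrable_iff_bounded)
  with False show ?thesis
    by (simp add: not_integrable_integral_eq)
qed

text \<open>Fubini's theorem with the pairs of points sorted by which time comes first. The ordering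
  matters because an inner integral over strictly earlier times is predictable, whereas the full
  inner integral is not.\<close>

lemma product_integral_split_by_time:
  fixes r :: "real \<times> real \<Rightarrow> real"
  assumes s1: "sigma_finite_measure M1" "sets M1 = sets hp_borel"
    and s2: "sigma_finite_measure M2" "sets M2 = sets hp_borel"
    and i1: "integrable M1 r" and i2: "integrable M2 r"
  shows "(\<integral>x. r x \<partial>M1) * (\<integral>y. r y \<partial>M2)
      = (\<integral>x. r x * (\<integral>y. r y * of_bool (fst y < fst x) \<partial>M2) \<partial>M1)
      + (\<integral>y. r y * (\<integral>x. r x * of_bool (fst x < fst y) \<partial>M1) \<partial>M2)
      + (\<integral>x. r x * (\<integral>y. r y * of_bool (fst y = fst x) \<partial>M2) \<partial>M1)"
proof -
  interpret M1: sigma_finite_measure M1 by (rule s1)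
  interpret M2: sigma_finite_measure M2 by (rule s2)
  interpret P: pair_sigma_finite M1 M2 ..
  have [measurable]: "r \<in> borel_measurable hp_borel"
    using borel_measurable_integrable[OF i1] by (simp cong: measurable_cong_sets add: s1)
  note [measurable_cong] = s1(2) s2(2)
  have int: "integrable (M1 \<Otimes>\<^sub>M M2) (\<lambda>(x, y). r x * r y)"
  proof (rule P.Fubini_integrable)
    show "integrable M1 (\<lambda>x. \<integral>y. norm (case (x, y) of (x, y) \<Rightarrow> r x * r y) \<partial>M2)"
      using i1 by (simp add: abs_mult)
    show "AE x in M1. integrable M2 (\<lambda>y. case (x, y) of (x, y) \<Rightarrow> r x * r y)"
      using i2 by simp
  qed measurable
  have intQ: "integrable (M1 \<Otimes>\<^sub>M M2) (\<lambda>(x, y). r x * r y * of_bool (Q x y))"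
    if Q: "Measurable.pred (M1 \<Otimes>\<^sub>M M2) (\<lambda>(x, y). Q x y)" for Q
  proof (rule Bochner_Integration.integrable_bound[OF int])
    have [measurable]: "Measurable.pred (M1 \<Otimes>\<^sub>M M2) (\<lambda>p. Q (fst p) (snd p))"
      using Q by (simp add: split_beta')
    show "(\<lambda>(x, y). r x * r y * of_bool (Q x y)) \<in> borel_measurable (M1 \<Otimes>\<^sub>M M2)"
      unfolding split_beta' by measurable
  qed (auto simp: abs_mult)
  have lt: "Measurable.pred (M1 \<Otimes>\<^sub>M M2) (\<lambda>(x, y). fst y < fst x)"
    and gt: "Measurable.pred (M1 \<Otimes>\<^sub>M M2) (\<lambda>(x, y). fst x < fst y)"
    and eq: "Measurable.pred (M1 \<Otimes>\<^sub>M M2) (\<lambda>(x, y). fst y = fst x)"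
    unfolding split_beta' by measurable
  have "(\<integral>x. r x \<partial>M1) * (\<integral>y. r y \<partial>M2) = (\<integral>x. (\<integral>y. r x * r y \<partial>M2) \<partial>M1)"
    by simp
  also have "\<dots> = (\<integral>p. (case p of (x, y) \<Rightarrow> r x * r y) \<partial>(M1 \<Otimes>\<^sub>M M2))"
    using P.integral_fst'[OF int] by simp
  also have "\<dots> = (\<integral>p. (case p of (x, y) \<Rightarrow> r x * r y * of_bool (fst y < fst x))
      + (case p of (x, y) \<Rightarrow> r x * r y * of_bool (fst x < fst y))
      + (case p of (x, y) \<Rightarrow> r x * r y * of_bool (fst y = fst x)) \<partial>(M1 \<Otimes>\<^sub>M M2))"
    by (intro Bochner_Integration.integral_cong) auto
  also have "\<dots> = (\<integral>p. (case p of (x, y) \<Rightarrow> r x * r y * of_bool (fst y < fst x)) \<partial>(M1 \<Otimes>\<^sub>M M2))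
      + (\<integral>p. (case p of (x, y) \<Rightarrow> r x * r y * of_bool (fst x < fst y)) \<partial>(M1 \<Otimes>\<^sub>M M2))
      + (\<integral>p. (case p of (x, y) \<Rightarrow> r x * r y * of_bool (fst y = fst x)) \<partial>(M1 \<Otimes>\<^sub>M M2))"
    using intQ[OF lt] intQ[OF gt] intQ[OF eq] by simp
  also have "(\<integral>p. (case p of (x, y) \<Rightarrow> r x * r y * of_bool (fst y < fst x)) \<partial>(M1 \<Otimes>\<^sub>M M2))
      = (\<integral>x. r x * (\<integral>y. r y * of_bool (fst y < fst x) \<partial>M2) \<partial>M1)"
    using P.integral_fst'[OF intQ[OF lt]] by (simp add: mult.assoc)
  also have "(\<integral>p. (case p of (x, y) \<Rightarrow> r x * r y * of_bool (fst x < fst y)) \<partial>(M1 \<Otimes>\<^sub>M M2))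
      = (\<integral>y. r y * (\<integral>x. r x * of_bool (fst x < fst y) \<partial>M1) \<partial>M2)"
    using P.integral_snd[OF intQ[OF gt]] by (simp add: mult_ac)
  also have "(\<integral>p. (case p of (x, y) \<Rightarrow> r x * r y * of_bool (fst y = fst x)) \<partial>(M1 \<Otimes>\<^sub>M M2))
      = (\<integral>x. r x * (\<integral>y. r y * of_bool (fst y = fst x) \<partial>M2) \<partial>M1)"
    using P.integral_fst'[OF intQ[OF eq]] by (simp add: mult.assoc)
  finally show ?thesis .
qed

lemma integrable_mult_integral_part:
  fixes r :: "real \<times> real \<Rightarrow> real"
  assumes s1: "sets M1 = sets hp_borel"
    and s2: "sigma_finite_measure M2" "sets M2 = sets hp_borel"
    and i1: "integrable M1 r" and i2: "integrable M2 r"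
  shows "integrable M1 (\<lambda>x. r x * (\<integral>y. r y * of_bool (fst y < fst x) \<partial>M2))"
proof -
  interpret M2: sigma_finite_measure M2 by (rule s2)
  have [measurable]: "r \<in> borel_measurable hp_borel"
    using borel_measurable_integrable[OF i1] by (simp cong: measurable_cong_sets add: s1)
  note [measurable_cong] = s1 s2(2)
  show ?thesis
  proof (rule Bochner_Integration.integrable_bound)
    show "integrable M1 (\<lambda>x. r x * (\<integral>y. \<bar>r y\<bar> \<partial>M2))"
      using i1 by simp
    show "(\<lambda>x. r x * (\<integral>y. r y * of_bool (fst y < fst x) \<partial>M2)) \<in> borel_measurable M1"
      by measurable
    show "AE x in M1. norm (r x * (\<integral>y. r y * of_bool (fst y < fst x) \<partial>M2)) \<le> norm (r x * (\<integral>y. \<bar>r y\<bar> \<partial>M2))"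
    proof (intro AE_I2)
      fix x :: "real \<times> real"
      have "\<bar>\<integral>y. r y * of_bool (fst y < fst x) \<partial>M2\<bar> \<le> (\<integral>y. \<bar>r y\<bar> \<partial>M2)"
        using i2 by (intro integral_abs_bound_integral)
          (auto intro!: Bochner_Integration.integrable_bound[OF i2] simp: abs_mult)
      then show "norm (r x * (\<integral>y. r y * of_bool (fst y < fst x) \<partial>M2)) \<le> norm (r x * (\<integral>y. \<bar>r y\<bar> \<partial>M2))"
        by (simp add: abs_mult mult_left_mono)
    qed
  qed
qed

section \<open>Compensated integrals and predictability\<close>

definition compensated :: "((real \<times> real) \<times> (real \<times> real) measure \<Rightarrow> real) \<Rightarrow> (real \<times> real) measure \<Rightarrow> real" where
  "compensated r \<mu> = (\<integral>x. r (x, \<mu>) \<partial>\<mu>) - (\<integral>x. r (x, \<mu>) \<partial>hpl)"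

definition predictable :: "((real \<times> real) \<times> (real \<times> real) measure \<Rightarrow> 'b) \<Rightarrow> bool" where
  "predictable r \<longleftrightarrow> (\<forall>x\<in>half_plane. \<forall>y\<in>half_plane. \<forall>\<mu>\<in>counting_measures.
     fst x \<le> fst y \<longrightarrow> r (x, add_point \<mu> y) = r (x, \<mu>))"

lemma predictableI:
  "(\<And>x y \<mu>. x \<in> half_plane \<Longrightarrow> y \<in> half_plane \<Longrightarrow> \<mu> \<in> counting_measures \<Longrightarrow> fst x \<le> fst y \<Longrightarrow>
    r (x, add_point \<mu> y) = r (x, \<mu>)) \<Longrightarrow> predictable r"
  by (simp add: predictable_def)

lemma predictableD:
  "predictable r \<Longrightarrow> x \<in> half_plane \<Longrightarrow> y \<in> half_plane \<Longrightarrow> \<mu> \<in> counting_measures \<Longrightarrow> fst x \<le> fst y \<Longrightarrow>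
    r (x, add_point \<mu> y) = r (x, \<mu>)"
  by (simp add: predictable_def)

text \<open>Squaring a compensated integral, path by path: since no two points of \<open>\<mu>\<close> have the same time,
  the diagonal contributes \<open>\<integral> r\<^sup>2 d\<mu>\<close> and the rest is twice an iterated integral over ordered pairs.\<close>

lemma compensated_square:
  fixes r :: "real \<times> real \<Rightarrow> real"
  assumes \<mu>: "\<mu> \<in> counting_measures" and i1: "integrable \<mu> r" and i2: "integrable hpl r"
    and simple: "AE x in \<mu>. emeasure \<mu> {x} = 1 \<and> emeasure \<mu> {y \<in> half_plane. fst y = fst x \<and> y \<noteq> x} = 0"
  shows "((\<integral>x. r x \<partial>\<mu>) - (\<integral>x. r x \<partial>hpl))\<^sup>2 =
    2 * ((\<integral>x. r x * ((\<integral>y. r y * of_bool (fst y < fst x) \<partial>\<mu>) - (\<integral>y. r y * of_bool (fst y < fst x) \<partial>hpl)) \<partial>\<mu>)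
       - (\<integral>x. r x * ((\<integral>y. r y * of_bool (fst y < fst x) \<partial>\<mu>) - (\<integral>y. r y * of_bool (fst y < fst x) \<partial>hpl)) \<partial>hpl))
    + (\<integral>x. (r x)\<^sup>2 \<partial>\<mu>)"
proof -
  note s1 = counting_measures_sigma_finite[OF \<mu>] counting_measures_sets[OF \<mu>]
  note s2 = sigma_finite_hpl sets_hpl
  note sp = counting_measures_space[OF \<mu>]
  have rm: "r \<in> borel_measurable hp_borel"
    using borel_measurable_integrable[OF i1] by (simp cong: measurable_cong_sets add: s1)
  define A where "A x = (\<integral>y. r y * of_bool (fst y < fst x) \<partial>\<mu>)" for x :: "real \<times> real"
  define B where "B x = (\<integral>y. r y * of_bool (fst y < fst x) \<partial>hpl)" for x :: "real \<times> real"
  \<comment> \<open>Vertical lines are null for Lebesgue measure, so the diagonal disappears as soon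
    as the inner integral is a Lebesgue integral.\<close>
  have diag0: "(\<integral>y. r y * of_bool (fst y = fst x) \<partial>hpl) = 0" for x :: "real \<times> real"
  proof (rule integral_eq_zero_AE)
    have "AE y in hpl. y \<notin> {y \<in> half_plane. fst y = fst x}"
      using emeasure_hpl_time_slice time_slice_measurable by (intro AE_not_in) (auto simp: null_sets_def)
    moreover have "AE y in hpl. y \<in> half_plane"
      using AE_space[of hpl] by simp
    ultimately show "AE y in hpl. r y * of_bool (fst y = fst x) = 0"
      by eventually_elim auto
  qed
  have "(\<integral>x. r x * (\<integral>y. r y * of_bool (fst y = fst x) \<partial>\<mu>) \<partial>\<mu>) = (\<integral>x. (r x)\<^sup>2 \<partial>\<mu>)"
  proof (rule integral_cong_AE)
    interpret M: sigma_finite_measure \<mu> by (rule s1)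
    note [measurable] = rm and [measurable_cong] = s1(2)
    show "(\<lambda>x. r x * (\<integral>y. r y * of_bool (fst y = fst x) \<partial>\<mu>)) \<in> borel_measurable \<mu>"
      by measurable
    show "(\<lambda>x. (r x)\<^sup>2) \<in> borel_measurable \<mu>"
      by measurable
    show "AE x in \<mu>. r x * (\<integral>y. r y * of_bool (fst y = fst x) \<partial>\<mu>) = (r x)\<^sup>2"
      using simple AE_space
    proof eventually_elim
      case (elim x)
      then have x: "x \<in> half_plane"
        by (simp add: sp)
      have m: "{y \<in> half_plane. fst y = fst x \<and> y \<noteq> x} \<in> sets \<mu>"
        using sets.Diff[OF time_slice_measurable singleton_sets_hp_borel[OF x], of "fst x"]
        unfolding s1(2) by (rule back_subst[of "\<lambda>A. A \<in> sets hp_borel"]) auto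
      have "AE y in \<mu>. y \<notin> {y \<in> half_plane. fst y = fst x \<and> y \<noteq> x}"
        using elim m by (intro AE_not_in) (auto simp: null_sets_def)
      then have "AE y in \<mu>. r y * of_bool (fst y = fst x) = r x * indicator {x} y"
        using AE_space by eventually_elim (auto simp: sp split: split_indicator)
      then have "(\<integral>y. r y * of_bool (fst y = fst x) \<partial>\<mu>) = (\<integral>y. r x * indicator {x} y \<partial>\<mu>)"
        using singleton_sets_hp_borel[OF x] by (intro integral_cong_AE) (auto simp: s1)
      also have "\<dots> = r x"
        using elim x by (simp add: measure_def sp)
      finally show ?case
        by (simp add: power2_eq_square)
    qed
  qed
  note diag = this
  have XX: "(\<integral>x. r x \<partial>\<mu>) * (\<integral>x. r x \<partial>\<mu>) = 2 * (\<integral>x. r x * A x \<partial>\<mu>) + (\<integral>x. (r x)\<^sup>2 \<partial>\<mu>)"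
    using product_integral_split_by_time[OF s1 s1 i1 i1] by (simp add: A_def diag)
  have XY: "(\<integral>x. r x \<partial>\<mu>) * (\<integral>x. r x \<partial>hpl) = (\<integral>x. r x * B x \<partial>\<mu>) + (\<integral>x. r x * A x \<partial>hpl)"
    using product_integral_split_by_time[OF s1 s2 i1 i2] by (simp add: A_def B_def diag0)
  have YY: "(\<integral>x. r x \<partial>hpl) * (\<integral>x. r x \<partial>hpl) = 2 * (\<integral>x. r x * B x \<partial>hpl)"
    using product_integral_split_by_time[OF s2 s2 i2 i2] by (simp add: B_def diag0)
  have "integrable \<mu> (\<lambda>x. r x * A x)" "integrable \<mu> (\<lambda>x. r x * B x)"
    "integrable hpl (\<lambda>x. r x * A x)" "integrable hpl (\<lambda>x. r x * B x)"
    unfolding A_def B_def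
    by (rule integrable_mult_integral_part[OF s1(2) s1 i1 i1] integrable_mult_integral_part[OF s1(2) s2 i1 i2]
      integrable_mult_integral_part[OF s2(2) s1 i2 i1] integrable_mult_integral_part[OF s2(2) s2 i2 i2])+
  then have "(\<integral>x. r x * (A x - B x) \<partial>\<mu>) = (\<integral>x. r x * A x \<partial>\<mu>) - (\<integral>x. r x * B x \<partial>\<mu>)"
    "(\<integral>x. r x * (A x - B x) \<partial>hpl) = (\<integral>x. r x * A x \<partial>hpl) - (\<integral>x. r x * B x \<partial>hpl)"
    by (simp_all add: right_diff_distrib)
  then show ?thesis
    unfolding A_def[symmetric] B_def[symmetric] using XX XY YY
    by (simp add: power2_eq_square algebra_simps)
qed

context poisson_law
begin

text \<open>The nonnegative formula is applied to the positive and the negative part. The integral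
  of the absolute value is finite in mean, hence finite on almost every path, so both parts may be
  subtracted.\<close>

lemma mecke_real:
  fixes h :: "(real \<times> real) \<times> (real \<times> real) measure \<Rightarrow> real"
  assumes h [measurable]: "h \<in> borel_measurable (hp_borel \<Otimes>\<^sub>M CM)"
    and fin: "(\<integral>\<^sup>+x. \<integral>\<^sup>+\<mu>. ennreal \<bar>h (x, add_point \<mu> x)\<bar> \<partial>P \<partial>hpl) < \<infinity>"
  shows "AE \<mu> in P. integrable \<mu> (\<lambda>x. h (x, \<mu>))"
    and "integrable P (\<lambda>\<mu>. \<integral>x. h (x, \<mu>) \<partial>\<mu>)"
    and "integrable (hpl \<Otimes>\<^sub>M P) (\<lambda>(x, \<mu>). h (x, add_point \<mu> x))"
    and "(\<integral>\<mu>. (\<integral>x. h (x, \<mu>) \<partial>\<mu>) \<partial>P) = (\<integral>(x, \<mu>). h (x, add_point \<mu> x) \<partial>(hpl \<Otimes>\<^sub>M P))"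
proof -
  have sl: "(\<lambda>x. h (x, \<mu>)) \<in> borel_measurable \<mu>" if "\<mu> \<in> space P" for \<mu>
    using measurable_Pair1[OF h, of \<mu>] that by (simp cong: measurable_cong_sets add: counting_measures_sets)
  have K [measurable]: "(\<lambda>\<mu>. \<integral>\<^sup>+x. ennreal (f (h (x, \<mu>))) \<partial>\<mu>) \<in> borel_measurable P"
    if [measurable]: "f \<in> borel_measurable borel" for f
    using nn_integral_kernel_measurable[OF _ measurable_ident, of "\<lambda>p. ennreal (f (h p))"] by simp
  have Ki: "(\<lambda>\<mu>. \<integral>x. h (x, \<mu>) \<partial>\<mu>) \<in> borel_measurable P"
    using integral_kernel_measurable[OF h measurable_ident] by simp
  have M: "(\<integral>\<^sup>+\<mu>. \<integral>\<^sup>+x. ennreal (f (h (x, \<mu>))) \<partial>\<mu> \<partial>P)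
      = (\<integral>\<^sup>+p. ennreal (f (case p of (x, \<mu>) \<Rightarrow> h (x, add_point \<mu> x))) \<partial>(hpl \<Otimes>\<^sub>M P))"
    if [measurable]: "f \<in> borel_measurable borel" for f
  proof -
    have "(\<integral>\<^sup>+\<mu>. \<integral>\<^sup>+x. ennreal (f (h (x, \<mu>))) \<partial>\<mu> \<partial>P) = (\<integral>\<^sup>+x. \<integral>\<^sup>+\<mu>. ennreal (f (h (x, add_point \<mu> x))) \<partial>P \<partial>hpl)"
      by (rule mecke[of "\<lambda>p. ennreal (f (h p))"]) measurable
    also have "\<dots> = (\<integral>\<^sup>+p. ennreal (f (case p of (x, \<mu>) \<Rightarrow> h (x, add_point \<mu> x))) \<partial>(hpl \<Otimes>\<^sub>M P))"
      by (subst nn_integral_fst[symmetric]) (auto simp: split_beta')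
    finally show ?thesis .
  qed
  have fin': "(\<integral>\<^sup>+\<mu>. \<integral>\<^sup>+x. ennreal \<bar>h (x, \<mu>)\<bar> \<partial>\<mu> \<partial>P) < \<infinity>"
    using fin mecke[of "\<lambda>p. ennreal \<bar>h p\<bar>"] by simp
  have "AE \<mu> in P. (\<integral>\<^sup>+x. ennreal \<bar>h (x, \<mu>)\<bar> \<partial>\<mu>) \<noteq> \<infinity>"
    using fin' K[of abs] by (intro nn_integral_PInf_AE) auto
  then show ae: "AE \<mu> in P. integrable \<mu> (\<lambda>x. h (x, \<mu>))"
    using AE_space by eventually_elim (auto simp: integrable_iff_bounded less_top sl)
  show int: "integrable (hpl \<Otimes>\<^sub>M P) (\<lambda>(x, \<mu>). h (x, add_point \<mu> x))"
    unfolding integrable_iff_bounded using fin' M[of abs]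
    by (auto simp: split_beta')
  show "integrable P (\<lambda>\<mu>. \<integral>x. h (x, \<mu>) \<partial>\<mu>)"
    unfolding integrable_iff_bounded
  proof (intro conjI Ki)
    have "(\<integral>\<^sup>+\<mu>. ennreal (norm (\<integral>x. h (x, \<mu>) \<partial>\<mu>)) \<partial>P) \<le> (\<integral>\<^sup>+\<mu>. \<integral>\<^sup>+x. ennreal \<bar>h (x, \<mu>)\<bar> \<partial>\<mu> \<partial>P)"
      using ae by (intro nn_integral_mono_AE, eventually_elim)
        (use integral_norm_bound_ennreal in fastforce)
    also note fin'
    finally show "(\<integral>\<^sup>+\<mu>. ennreal (norm (\<integral>x. h (x, \<mu>) \<partial>\<mu>)) \<partial>P) < \<infinity>" .
  qed
  have part: "integrable P (\<lambda>\<mu>. enn2real (\<integral>\<^sup>+x. ennreal (f (h (x, \<mu>))) \<partial>\<mu>)) \<and>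
      (\<integral>\<mu>. enn2real (\<integral>\<^sup>+x. ennreal (f (h (x, \<mu>))) \<partial>\<mu>) \<partial>P)
      = enn2real (\<integral>\<^sup>+p. ennreal (f (case p of (x, \<mu>) \<Rightarrow> h (x, add_point \<mu> x))) \<partial>(hpl \<Otimes>\<^sub>M P))"
    if [measurable]: "f \<in> borel_measurable borel" and le: "\<And>a. f a \<le> \<bar>a\<bar>" for f
  proof -
    let ?K = "\<lambda>\<mu>. \<integral>\<^sup>+x. ennreal (f (h (x, \<mu>))) \<partial>\<mu>"
    have finK: "(\<integral>\<^sup>+\<mu>. ?K \<mu> \<partial>P) < \<infinity>"
      by (rule le_less_trans[OF _ fin']) (intro nn_integral_mono ennreal_leI le)
    have "AE \<mu> in P. ?K \<mu> \<noteq> \<infinity>"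
      using finK by (intro nn_integral_PInf_AE) auto
    then have eq: "AE \<mu> in P. ennreal (enn2real (?K \<mu>)) = ?K \<mu>"
      by eventually_elim (simp add: less_top)
    from nn_integral_cong_AE[OF this] finK
    have *: "(\<integral>\<^sup>+\<mu>. ennreal (enn2real (?K \<mu>)) \<partial>P) = (\<integral>\<^sup>+\<mu>. ?K \<mu> \<partial>P)"
      by simp
    have i: "integrable P (\<lambda>\<mu>. enn2real (?K \<mu>))"
      unfolding integrable_iff_bounded using * finK by auto
    have "(\<integral>\<mu>. enn2real (?K \<mu>) \<partial>P) = enn2real (\<integral>\<^sup>+\<mu>. ennreal (enn2real (?K \<mu>)) \<partial>P)"
      by (rule integral_eq_nn_integral) auto
    then show ?thesis
      using i * M by simp
  qed
  have "(\<integral>\<mu>. (\<integral>x. h (x, \<mu>) \<partial>\<mu>) \<partial>P) = (\<integral>\<mu>. enn2real (\<integral>\<^sup>+x. ennreal (h (x, \<mu>)) \<partial>\<mu>)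
      - enn2real (\<integral>\<^sup>+x. ennreal (- h (x, \<mu>)) \<partial>\<mu>) \<partial>P)"
  proof (rule integral_cong_AE)
    show "AE \<mu> in P. (\<integral>x. h (x, \<mu>) \<partial>\<mu>) = enn2real (\<integral>\<^sup>+x. ennreal (h (x, \<mu>)) \<partial>\<mu>)
      - enn2real (\<integral>\<^sup>+x. ennreal (- h (x, \<mu>)) \<partial>\<mu>)"
      using ae by eventually_elim (rule real_lebesgue_integral_def)
    show "(\<lambda>\<mu>. enn2real (\<integral>\<^sup>+x. ennreal (h (x, \<mu>)) \<partial>\<mu>) - enn2real (\<integral>\<^sup>+x. ennreal (- h (x, \<mu>)) \<partial>\<mu>)) \<in> borel_measurable P"
      using K[of "\<lambda>a. a"] K[of uminus] by simp
  qed (rule Ki)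
  also have "\<dots> = enn2real (\<integral>\<^sup>+p. ennreal (case p of (x, \<mu>) \<Rightarrow> h (x, add_point \<mu> x)) \<partial>(hpl \<Otimes>\<^sub>M P))
      - enn2real (\<integral>\<^sup>+p. ennreal (- (case p of (x, \<mu>) \<Rightarrow> h (x, add_point \<mu> x))) \<partial>(hpl \<Otimes>\<^sub>M P))"
    using part[of "\<lambda>a. a"] part[of uminus] by (subst Bochner_Integration.integral_diff) auto
  also have "\<dots> = (\<integral>(x, \<mu>). h (x, add_point \<mu> x) \<partial>(hpl \<Otimes>\<^sub>M P))"
    by (rule real_lebesgue_integral_def[OF int, symmetric])
  finally show "(\<integral>\<mu>. (\<integral>x. h (x, \<mu>) \<partial>\<mu>) \<partial>P) = (\<integral>(x, \<mu>). h (x, add_point \<mu> x) \<partial>(hpl \<Otimes>\<^sub>M P))" .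
qed

text \<open>Adding x does not change \<open>r (x, \<mu>)\<close>, so the shift drops out of the
  Mecke formula and Tonelli's theorem finishes.\<close>

lemma mecke_predictable:
  fixes r :: "(real \<times> real) \<times> (real \<times> real) measure \<Rightarrow> ennreal"
  assumes [measurable]: "r \<in> borel_measurable (hp_borel \<Otimes>\<^sub>M CM)" and r: "predictable r"
  shows "(\<integral>\<^sup>+\<mu>. \<integral>\<^sup>+x. r (x, \<mu>) \<partial>\<mu> \<partial>P) = (\<integral>\<^sup>+\<mu>. \<integral>\<^sup>+x. r (x, \<mu>) \<partial>hpl \<partial>P)"
proof -
  have "(\<integral>\<^sup>+\<mu>. \<integral>\<^sup>+x. r (x, \<mu>) \<partial>\<mu> \<partial>P) = (\<integral>\<^sup>+x. \<integral>\<^sup>+\<mu>. r (x, add_point \<mu> x) \<partial>P \<partial>hpl)"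
    by (rule mecke) measurable
  also have "\<dots> = (\<integral>\<^sup>+x. \<integral>\<^sup>+\<mu>. r (x, \<mu>) \<partial>P \<partial>hpl)"
    using r by (intro nn_integral_cong) (simp add: predictableD)
  also have "\<dots> = (\<integral>\<^sup>+\<mu>. \<integral>\<^sup>+x. r (x, \<mu>) \<partial>hpl \<partial>P)"
    by (rule HP.Fubini'[symmetric]) measurable
  finally show ?thesis .
qed

text \<open>Both integrals in the compensated integral have the same mean by the Mecke formula
  without shift. The mean zero property stands in for the martingale property.\<close>

lemma compensated_predictable:
  fixes r :: "(real \<times> real) \<times> (real \<times> real) measure \<Rightarrow> real"
  assumes m [measurable]: "r \<in> borel_measurable (hp_borel \<Otimes>\<^sub>M CM)" and r: "predictable r"
    and fin: "(\<integral>\<^sup>+\<mu>. \<integral>\<^sup>+x. ennreal \<bar>r (x, \<mu>)\<bar> \<partial>hpl \<partial>P) < \<infinity>"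
  shows "AE \<mu> in P. integrable \<mu> (\<lambda>x. r (x, \<mu>)) \<and> integrable hpl (\<lambda>x. r (x, \<mu>))"
    and "integrable P (compensated r)"
    and "(\<integral>\<mu>. compensated r \<mu> \<partial>P) = 0"
proof -
  have fin': "(\<integral>\<^sup>+x. \<integral>\<^sup>+\<mu>. ennreal \<bar>r (x, \<mu>)\<bar> \<partial>P \<partial>hpl) < \<infinity>"
    using fin by (subst HP.Fubini'[symmetric]) auto
  have eq: "(\<integral>\<^sup>+x. \<integral>\<^sup>+\<mu>. ennreal \<bar>r (x, add_point \<mu> x)\<bar> \<partial>P \<partial>hpl) = (\<integral>\<^sup>+x. \<integral>\<^sup>+\<mu>. ennreal \<bar>r (x, \<mu>)\<bar> \<partial>P \<partial>hpl)"
    using r by (intro nn_integral_cong) (simp add: predictableD)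
  note M = mecke_real[OF m, unfolded eq, OF fin']
  have int: "integrable (hpl \<Otimes>\<^sub>M P) r"
    unfolding integrable_iff_bounded using fin' by (auto simp: nn_integral_fst[symmetric])
  have ae2: "AE \<mu> in P. integrable hpl (\<lambda>x. r (x, \<mu>))"
    using HP.AE_integrable_snd[of "\<lambda>x \<mu>. r (x, \<mu>)"] int by simp
  show "AE \<mu> in P. integrable \<mu> (\<lambda>x. r (x, \<mu>)) \<and> integrable hpl (\<lambda>x. r (x, \<mu>))"
    using M(1) ae2 by eventually_elim simp
  have i2: "integrable P (\<lambda>\<mu>. \<integral>x. r (x, \<mu>) \<partial>hpl)"
    using HP.integrable_snd[of "\<lambda>x \<mu>. r (x, \<mu>)"] int by simp
  show "integrable P (compensated r)"
    unfolding compensated_def[abs_def] using M(2) i2 by (rule Bochner_Integration.integrable_diff)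
  have "(\<integral>\<mu>. (\<integral>x. r (x, \<mu>) \<partial>hpl) \<partial>P) = (\<integral>p. r p \<partial>(hpl \<Otimes>\<^sub>M P))"
    using HP.integral_snd[of "\<lambda>x \<mu>. r (x, \<mu>)"] int by simp
  also have "\<dots> = (\<integral>(x, \<mu>). r (x, add_point \<mu> x) \<partial>(hpl \<Otimes>\<^sub>M P))"
    using r by (intro Bochner_Integration.integral_cong) (auto simp: predictableD space_pair_measure)
  finally show "(\<integral>\<mu>. compensated r \<mu> \<partial>P) = 0"
    unfolding compensated_def using M(2,4) i2 by simp
qed

text \<open>By the triangle inequality the integral against the measure and the Lebesgue integral
  contribute separately, and they have equal means. This is the source of the factor 2.\<close>

lemma nn_integral_compensated_le:
  fixes r :: "(real \<times> real) \<times> (real \<times> real) measure \<Rightarrow> real"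
  assumes m [measurable]: "r \<in> borel_measurable (hp_borel \<Otimes>\<^sub>M CM)" and r: "predictable r"
  shows "(\<integral>\<^sup>+\<mu>. ennreal \<bar>compensated r \<mu>\<bar> \<partial>P) \<le> 2 * (\<integral>\<^sup>+\<mu>. \<integral>\<^sup>+x. ennreal \<bar>r (x, \<mu>)\<bar> \<partial>hpl \<partial>P)"
proof -
  have "(\<integral>\<^sup>+\<mu>. ennreal \<bar>compensated r \<mu>\<bar> \<partial>P)
      \<le> (\<integral>\<^sup>+\<mu>. (\<integral>\<^sup>+x. ennreal \<bar>r (x, \<mu>)\<bar> \<partial>\<mu>) + (\<integral>\<^sup>+x. ennreal \<bar>r (x, \<mu>)\<bar> \<partial>hpl) \<partial>P)"
  proof (intro nn_integral_mono)
    fix \<mu>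
    have "ennreal \<bar>compensated r \<mu>\<bar> \<le> ennreal (\<bar>\<integral>x. r (x, \<mu>) \<partial>\<mu>\<bar> + \<bar>\<integral>x. r (x, \<mu>) \<partial>hpl\<bar>)"
      unfolding compensated_def by (intro ennreal_leI) linarith
    also have "\<dots> = ennreal \<bar>\<integral>x. r (x, \<mu>) \<partial>\<mu>\<bar> + ennreal \<bar>\<integral>x. r (x, \<mu>) \<partial>hpl\<bar>"
      by (rule ennreal_plus) auto
    also have "\<dots> \<le> (\<integral>\<^sup>+x. ennreal \<bar>r (x, \<mu>)\<bar> \<partial>\<mu>) + (\<integral>\<^sup>+x. ennreal \<bar>r (x, \<mu>)\<bar> \<partial>hpl)"
      by (intro add_mono abs_integral_le_nn_integral)
    finally show "ennreal \<bar>compensated r \<mu>\<bar> \<le> (\<integral>\<^sup>+x. ennreal \<bar>r (x, \<mu>)\<bar> \<partial>\<mu>) + (\<integral>\<^sup>+x. ennreal \<bar>r (x, \<mu>)\<bar> \<partial>hpl)" .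
  qed
  also have "\<dots> = (\<integral>\<^sup>+\<mu>. \<integral>\<^sup>+x. ennreal \<bar>r (x, \<mu>)\<bar> \<partial>\<mu> \<partial>P) + (\<integral>\<^sup>+\<mu>. \<integral>\<^sup>+x. ennreal \<bar>r (x, \<mu>)\<bar> \<partial>hpl \<partial>P)"
  proof (rule nn_integral_add)
    show "(\<lambda>\<mu>. \<integral>\<^sup>+x. ennreal \<bar>r (x, \<mu>)\<bar> \<partial>\<mu>) \<in> borel_measurable P"
      using nn_integral_kernel_measurable[OF _ measurable_ident, of "\<lambda>p. ennreal \<bar>r p\<bar>"] by simp
  qed measurable
  also have "(\<integral>\<^sup>+\<mu>. \<integral>\<^sup>+x. ennreal \<bar>r (x, \<mu>)\<bar> \<partial>\<mu> \<partial>P) = (\<integral>\<^sup>+\<mu>. \<integral>\<^sup>+x. ennreal \<bar>r (x, \<mu>)\<bar> \<partial>hpl \<partial>P)"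
    using r by (intro mecke_predictable[of "\<lambda>p. ennreal \<bar>r p\<bar>"]) (auto intro!: predictableI simp: predictableD)
  finally show ?thesis
    by (simp add: mult_2)
qed

text \<open>By the Mecke formula the mean number of bad points is the integral over x of the
  probability that x is bad once it has been added. For fixed x, almost surely neither x itself nor
  any other point of its vertical line is already occupied.\<close>

lemma AE_simple_times:
  "AE \<mu> in P. AE x in \<mu>. emeasure \<mu> {x} = 1 \<and> emeasure \<mu> {y \<in> half_plane. fst y = fst x \<and> y \<noteq> x} = 0"
proof -
  let ?D = "{q \<in> space (hp_borel \<Otimes>\<^sub>M (hp_borel \<Otimes>\<^sub>M CM)). fst (fst q) = fst (fst (snd q)) \<and> snd (fst q) \<noteq> snd (fst (snd q))}"
  have "?D \<in> sets (hp_borel \<Otimes>\<^sub>M (hp_borel \<Otimes>\<^sub>M CM))"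
    by measurable
  from emeasure_kernel_measurable[OF this measurable_snd]
  have D: "(\<lambda>p. emeasure (snd p) {y \<in> half_plane. fst y = fst (fst p) \<and> y \<noteq> fst p}) \<in> borel_measurable (hp_borel \<Otimes>\<^sub>M CM)"
  proof (rule measurable_cong[THEN iffD1, rotated])
    fix p assume p: "p \<in> space (hp_borel \<Otimes>\<^sub>M CM)"
    then have "{x. (x, p) \<in> ?D} = {y \<in> half_plane. fst y = fst (fst p) \<and> y \<noteq> fst p}"
      by (auto simp: space_pair_measure prod_eq_iff)
    then show "emeasure (snd p) {x. (x, p) \<in> ?D} = emeasure (snd p) {y \<in> half_plane. fst y = fst (fst p) \<and> y \<noteq> fst p}"
      by simp
  qed
  define bad where "bad p = (if emeasure (snd p) {fst p} = 1 \<and>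
    emeasure (snd p) {y \<in> half_plane. fst y = fst (fst p) \<and> y \<noteq> fst p} = 0 then 0 else 1 :: ennreal)"
    for p :: "(real \<times> real) \<times> (real \<times> real) measure"
  have bad [measurable]: "bad \<in> borel_measurable (hp_borel \<Otimes>\<^sub>M CM)"
    unfolding bad_def[abs_def] using D emeasure_point_measurable by measurable
  have "(\<integral>\<^sup>+\<mu>. \<integral>\<^sup>+x. bad (x, \<mu>) \<partial>\<mu> \<partial>P) = (\<integral>\<^sup>+x. \<integral>\<^sup>+\<mu>. bad (x, add_point \<mu> x) \<partial>P \<partial>hpl)"
    by (rule mecke) (rule bad)
  also have "\<dots> = (\<integral>\<^sup>+x. \<integral>\<^sup>+\<mu>. 0 \<partial>P \<partial>hpl)"
  proof (rule nn_integral_cong, rule nn_integral_cong_AE)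
    fix x assume "x \<in> space hpl"
    then have x: "x \<in> half_plane"
      by simp
    have sl: "{y \<in> half_plane. fst y = fst x \<and> y \<noteq> x} \<in> sets hp_borel"
      using sets.Diff[OF time_slice_measurable singleton_sets_hp_borel[OF x], of "fst x"]
      by (rule back_subst[of "\<lambda>A. A \<in> sets hp_borel"]) auto
    have "emeasure hpl {y \<in> half_plane. fst y = fst x \<and> y \<noteq> x} \<le> emeasure hpl {y \<in> half_plane. fst y = fst x}"
      using time_slice_measurable by (intro emeasure_mono) auto
    then have "emeasure hpl {y \<in> half_plane. fst y = fst x \<and> y \<noteq> x} = 0"
      by (simp add: emeasure_hpl_time_slice)
    from AE_null[OF sl this] AE_no_point[OF x] AE_space
    show "AE \<mu> in P. bad (x, add_point \<mu> x) = 0"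
    proof eventually_elim
      case (elim \<mu>)
      then have "\<mu> \<in> counting_measures"
        by simp
      then show ?case
        using elim sl singleton_sets_hp_borel[OF x] by (simp add: bad_def emeasure_add_point counting_measures_sets)
    qed
  qed
  finally have "(\<integral>\<^sup>+\<mu>. \<integral>\<^sup>+x. bad (x, \<mu>) \<partial>\<mu> \<partial>P) = 0"
    by simp
  moreover have "(\<lambda>\<mu>. \<integral>\<^sup>+x. bad (x, \<mu>) \<partial>\<mu>) \<in> borel_measurable P"
    using nn_integral_kernel_measurable[OF bad measurable_ident] by simp
  ultimately have "AE \<mu> in P. (\<integral>\<^sup>+x. bad (x, \<mu>) \<partial>\<mu>) = 0"
    by (simp add: nn_integral_0_iff_AE)
  then show ?thesis
    using AE_space
  proof eventually_elim
    case (elim \<mu>)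
    then have "(\<lambda>x. bad (x, \<mu>)) \<in> borel_measurable \<mu>"
      using measurable_Pair1[OF bad, of \<mu>] by (simp cong: measurable_cong_sets add: counting_measures_sets)
    with elim have "AE x in \<mu>. bad (x, \<mu>) = 0"
      by (simp add: nn_integral_0_iff_AE)
    then show ?case
      by eventually_elim (auto simp: bad_def split: if_splits)
  qed
qed

text \<open>Restricting an integrand to the times at which \<open>variation_before\<close> is bounded preserves
  predictability and makes the iterated integrals in the squared compensated integral integrable.\<close>

definition variation_before :: "((real \<times> real) \<times> (real \<times> real) measure \<Rightarrow> real) \<Rightarrow>
    (real \<times> real) \<times> (real \<times> real) measure \<Rightarrow> ennreal" where
  "variation_before r = (\<lambda>(x, \<mu>). (\<integral>\<^sup>+y. ennreal \<bar>r (y, \<mu>) * of_bool (fst y < fst x)\<bar> \<partial>\<mu>)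
     + (\<integral>\<^sup>+y. ennreal \<bar>r (y, \<mu>) * of_bool (fst y < fst x)\<bar> \<partial>hpl))"

definition compensated_before :: "((real \<times> real) \<times> (real \<times> real) measure \<Rightarrow> real) \<Rightarrow>
    (real \<times> real) \<times> (real \<times> real) measure \<Rightarrow> real" where
  "compensated_before r = (\<lambda>(x, \<mu>). (\<integral>y. r (y, \<mu>) * of_bool (fst y < fst x) \<partial>\<mu>)
     - (\<integral>y. r (y, \<mu>) * of_bool (fst y < fst x) \<partial>hpl))"

lemma before_functional_measurable:
  fixes r :: "(real \<times> real) \<times> (real \<times> real) measure \<Rightarrow> real"
  assumes m [measurable]: "r \<in> borel_measurable (hp_borel \<Otimes>\<^sub>M CM)"
  shows "(\<lambda>(y, x, \<mu>). r (y, \<mu>) * of_bool (fst y < fst x)) \<in> borel_measurable (hp_borel \<Otimes>\<^sub>M (hp_borel \<Otimes>\<^sub>M CM))"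
  unfolding split_beta' by measurable

lemma variation_before_measurable:
  fixes r :: "(real \<times> real) \<times> (real \<times> real) measure \<Rightarrow> real"
  assumes m [measurable]: "r \<in> borel_measurable (hp_borel \<Otimes>\<^sub>M CM)"
  shows "variation_before r \<in> borel_measurable (hp_borel \<Otimes>\<^sub>M CM)"
proof -
  have "(\<lambda>p. \<integral>\<^sup>+y. ennreal \<bar>r (y, snd p) * of_bool (fst y < fst (fst p))\<bar> \<partial>snd p) \<in> borel_measurable (hp_borel \<Otimes>\<^sub>M CM)"
    using nn_integral_kernel_measurable[OF _ measurable_snd[of hp_borel CM],
        of "\<lambda>(y, x, \<mu>). ennreal \<bar>r (y, \<mu>) * of_bool (fst y < fst x)\<bar>"] before_functional_measurable[OF m]
    by (simp add: split_beta')
  moreover have "(\<lambda>p. \<integral>\<^sup>+y. ennreal \<bar>r (y, snd p) * of_bool (fst y < fst (fst p))\<bar> \<partial>hpl) \<in> borel_measurable (hp_borel \<Otimes>\<^sub>M CM)"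
    by measurable
  ultimately show ?thesis
    unfolding variation_before_def split_beta' by (rule borel_measurable_add)
qed

lemma compensated_before_measurable:
  fixes r :: "(real \<times> real) \<times> (real \<times> real) measure \<Rightarrow> real"
  assumes m [measurable]: "r \<in> borel_measurable (hp_borel \<Otimes>\<^sub>M CM)"
  shows "compensated_before r \<in> borel_measurable (hp_borel \<Otimes>\<^sub>M CM)"
proof -
  have "(\<lambda>p. \<integral>y. r (y, snd p) * of_bool (fst y < fst (fst p)) \<partial>snd p) \<in> borel_measurable (hp_borel \<Otimes>\<^sub>M CM)"
    using integral_kernel_measurable[OF before_functional_measurable[OF m] measurable_snd]
    by (simp add: split_beta')
  moreover have "(\<lambda>p. \<integral>y. r (y, snd p) * of_bool (fst y < fst (fst p)) \<partial>hpl) \<in> borel_measurable (hp_borel \<Otimes>\<^sub>M CM)"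
    by measurable
  ultimately show ?thesis
    unfolding compensated_before_def split_beta' by (rule borel_measurable_diff)
qed

lemma before_functional_add_point:
  fixes r :: "(real \<times> real) \<times> (real \<times> real) measure \<Rightarrow> real"
  assumes r: "predictable r" and x: "x \<in> half_plane" "y \<in> half_plane" "\<mu> \<in> counting_measures" "fst x \<le> fst y"
    and z: "z \<in> half_plane"
  shows "r (z, add_point \<mu> y) * of_bool (fst z < fst x) = r (z, \<mu>) * of_bool (fst z < fst x)"
  using predictableD[OF r z x(2,3)] x(4) by (cases "fst z < fst x") auto

text \<open>Both functionals see \<open>r\<close> only at times before x. A point y at or after x
  neither changes \<open>r\<close> there nor enters the integral against the enlarged
  measure.\<close>

lemma predictable_before:
  fixes r :: "(real \<times> real) \<times> (real \<times> real) measure \<Rightarrow> real"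
  assumes m: "r \<in> borel_measurable (hp_borel \<Otimes>\<^sub>M CM)" and r: "predictable r"
  shows "predictable (variation_before r)" "predictable (compensated_before r)"
proof -
  have *: "variation_before r (x, add_point \<mu> y) = variation_before r (x, \<mu>) \<and>
      compensated_before r (x, add_point \<mu> y) = compensated_before r (x, \<mu>)"
    if x: "x \<in> half_plane" "y \<in> half_plane" "\<mu> \<in> counting_measures" "fst x \<le> fst y" for x y \<mu>
  proof -
    let ?f = "\<lambda>\<mu> z. r (z, \<mu>) * of_bool (fst z < fst x)"
    note eq = before_functional_add_point[OF r x]
    have "(\<lambda>z. r (z, \<mu>)) \<in> borel_measurable hp_borel"
      using measurable_Pair1[OF m, of \<mu>] x(3) by simp
    then have f: "?f \<mu> \<in> borel_measurable \<mu>"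
      by (simp cong: measurable_cong_sets add: counting_measures_sets[OF x(3)])
    have sp: "space \<mu> = half_plane"
      using x(3) by (rule counting_measures_space)
    have "(\<integral>\<^sup>+z. ennreal \<bar>?f (add_point \<mu> y) z\<bar> \<partial>add_point \<mu> y) = (\<integral>\<^sup>+z. ennreal \<bar>?f \<mu> z\<bar> \<partial>add_point \<mu> y)"
      by (intro nn_integral_cong) (simp add: sp eq)
    also have "\<dots> = (\<integral>\<^sup>+z. ennreal \<bar>?f \<mu> z\<bar> \<partial>\<mu>)"
      using f x by (intro nn_integral_add_point) (auto simp: sp)
    finally have 1: "(\<integral>\<^sup>+z. ennreal \<bar>?f (add_point \<mu> y) z\<bar> \<partial>add_point \<mu> y) = (\<integral>\<^sup>+z. ennreal \<bar>?f \<mu> z\<bar> \<partial>\<mu>)" .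
    have "(\<integral>z. ?f (add_point \<mu> y) z \<partial>add_point \<mu> y) = (\<integral>z. ?f \<mu> z \<partial>add_point \<mu> y)"
      by (intro Bochner_Integration.integral_cong) (simp_all add: sp eq)
    also have "\<dots> = (\<integral>z. ?f \<mu> z \<partial>\<mu>)"
      using f x by (intro integral_add_point) (auto simp: sp)
    finally have 2: "(\<integral>z. ?f (add_point \<mu> y) z \<partial>add_point \<mu> y) = (\<integral>z. ?f \<mu> z \<partial>\<mu>)" .
    have 3: "(\<integral>\<^sup>+z. ennreal \<bar>?f (add_point \<mu> y) z\<bar> \<partial>hpl) = (\<integral>\<^sup>+z. ennreal \<bar>?f \<mu> z\<bar> \<partial>hpl)"
      by (intro nn_integral_cong) (simp add: eq)
    have 4: "(\<integral>z. ?f (add_point \<mu> y) z \<partial>hpl) = (\<integral>z. ?f \<mu> z \<partial>hpl)"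
      by (intro Bochner_Integration.integral_cong) (simp_all add: eq)
    show ?thesis
      unfolding variation_before_def compensated_before_def prod.case 1 2 3 4 by simp
  qed
  then show "predictable (variation_before r)" "predictable (compensated_before r)"
    by (auto intro!: predictableI)
qed

text \<open>Path by path, the square is twice the compensated integral of \<open>\<rho>\<close> plus
  the integral of \<open>r\<^sup>2\<close> against the measure. As \<open>\<rho>\<close> is again
  predictable, its compensated integral has mean zero once it is absolutely integrable, and the
  bound \<open>V\<close> on the variation before x secures that. The Mecke formula turns the
  remaining term into a Lebesgue integral.\<close>

lemma compensated_square_le_bounded:
  fixes r :: "(real \<times> real) \<times> (real \<times> real) measure \<Rightarrow> real"
  assumes m [measurable]: "r \<in> borel_measurable (hp_borel \<Otimes>\<^sub>M CM)" and r: "predictable r"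
    and fin: "(\<integral>\<^sup>+\<mu>. \<integral>\<^sup>+x. ennreal \<bar>r (x, \<mu>)\<bar> \<partial>hpl \<partial>P) < \<infinity>"
    and V: "\<And>x \<mu>. r (x, \<mu>) \<noteq> 0 \<Longrightarrow> variation_before r (x, \<mu>) \<le> of_nat n"
  shows "(\<integral>\<^sup>+\<mu>. ennreal ((compensated r \<mu>)\<^sup>2) \<partial>P) \<le> (\<integral>\<^sup>+\<mu>. \<integral>\<^sup>+x. ennreal ((r (x, \<mu>))\<^sup>2) \<partial>hpl \<partial>P)"
proof (cases "(\<integral>\<^sup>+\<mu>. \<integral>\<^sup>+x. ennreal ((r (x, \<mu>))\<^sup>2) \<partial>hpl \<partial>P) = \<infinity>")
  case False
  then have q: "(\<integral>\<^sup>+\<mu>. \<integral>\<^sup>+x. ennreal ((r (x, \<mu>))\<^sup>2) \<partial>hpl \<partial>P) < \<infinity>"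
    by (simp add: less_top)
  define \<rho> where "\<rho> p = r p * compensated_before r p" for p
  have \<rho>m [measurable]: "\<rho> \<in> borel_measurable (hp_borel \<Otimes>\<^sub>M CM)"
    unfolding \<rho>_def[abs_def] using compensated_before_measurable[OF m] by measurable
  have \<rho>p: "predictable \<rho>"
    using predictable_before(2)[OF m r] r by (auto intro!: predictableI simp: \<rho>_def predictableD)
  have before_le: "ennreal \<bar>compensated_before r (x, \<mu>)\<bar> \<le> variation_before r (x, \<mu>)" for x \<mu>
  proof -
    let ?a = "\<integral>y. r (y, \<mu>) * of_bool (fst y < fst x) \<partial>\<mu>" and ?b = "\<integral>y. r (y, \<mu>) * of_bool (fst y < fst x) \<partial>hpl"
    have "ennreal \<bar>compensated_before r (x, \<mu>)\<bar> \<le> ennreal (\<bar>?a\<bar> + \<bar>?b\<bar>)"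
      unfolding compensated_before_def prod.case by (intro ennreal_leI) linarith
    also have "\<dots> = ennreal \<bar>?a\<bar> + ennreal \<bar>?b\<bar>"
      by (rule ennreal_plus) auto
    also have "\<dots> \<le> variation_before r (x, \<mu>)"
      unfolding variation_before_def prod.case by (intro add_mono abs_integral_le_nn_integral)
    finally show ?thesis .
  qed
  \<comment> \<open>Where \<open>r\<close> vanishes so does \<open>\<rho>\<close>; elsewhere
    \<open>V\<close> bounds the compensated integral over earlier times by n.\<close>
  have le: "\<bar>\<rho> p\<bar> \<le> real n * \<bar>r p\<bar>" for p
  proof (cases "r p = 0")
    case False
    have "variation_before r (fst p, snd p) \<le> of_nat n"
      using False by (intro V) simp
    from order_trans[OF before_le this]
    have "\<bar>compensated_before r p\<bar> \<le> real n"
      by (simp add: ennreal_of_nat_eq_real_of_nat)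
    then show ?thesis
      unfolding \<rho>_def abs_mult by (subst mult.commute) (intro mult_right_mono, auto)
  qed (simp add: \<rho>_def)
  have "(\<integral>\<^sup>+\<mu>. \<integral>\<^sup>+x. ennreal \<bar>\<rho> (x, \<mu>)\<bar> \<partial>hpl \<partial>P) \<le> (\<integral>\<^sup>+\<mu>. \<integral>\<^sup>+x. ennreal (real n) * ennreal \<bar>r (x, \<mu>)\<bar> \<partial>hpl \<partial>P)"
    using le by (intro nn_integral_mono) (simp add: ennreal_mult[symmetric] ennreal_leI)
  also have "\<dots> = (\<integral>\<^sup>+\<mu>. ennreal (real n) * (\<integral>\<^sup>+x. ennreal \<bar>r (x, \<mu>)\<bar> \<partial>hpl) \<partial>P)"
    by (intro nn_integral_cong nn_integral_cmult) measurable
  also have "\<dots> = ennreal (real n) * (\<integral>\<^sup>+\<mu>. \<integral>\<^sup>+x. ennreal \<bar>r (x, \<mu>)\<bar> \<partial>hpl \<partial>P)"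
    by (intro nn_integral_cmult) measurable
  also have "\<dots> < \<infinity>"
    using fin by (simp add: ennreal_mult_less_top)
  finally have fin\<rho>: "(\<integral>\<^sup>+\<mu>. \<integral>\<^sup>+x. ennreal \<bar>\<rho> (x, \<mu>)\<bar> \<partial>hpl \<partial>P) < \<infinity>" .
  note C = compensated_predictable[OF \<rho>m \<rho>p fin\<rho>]
  have r2: "predictable (\<lambda>p. (r p)\<^sup>2)"
    using r by (auto intro!: predictableI simp: predictableD)
  have fin2: "(\<integral>\<^sup>+x. \<integral>\<^sup>+\<mu>. ennreal \<bar>(r (x, add_point \<mu> x))\<^sup>2\<bar> \<partial>P \<partial>hpl) < \<infinity>"
  proof -
    have "(\<integral>\<^sup>+x. \<integral>\<^sup>+\<mu>. ennreal \<bar>(r (x, add_point \<mu> x))\<^sup>2\<bar> \<partial>P \<partial>hpl) = (\<integral>\<^sup>+x. \<integral>\<^sup>+\<mu>. ennreal ((r (x, \<mu>))\<^sup>2) \<partial>P \<partial>hpl)"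
      using r by (intro nn_integral_cong) (simp add: predictableD)
    also have "\<dots> = (\<integral>\<^sup>+\<mu>. \<integral>\<^sup>+x. ennreal ((r (x, \<mu>))\<^sup>2) \<partial>hpl \<partial>P)"
      by (rule HP.Fubini'[symmetric]) measurable
    finally show ?thesis
      using q by simp
  qed
  have m2: "(\<lambda>p. (r p)\<^sup>2) \<in> borel_measurable (hp_borel \<Otimes>\<^sub>M CM)"
    by measurable
  note S = mecke_real[OF m2 fin2]
  have sq: "AE \<mu> in P. (compensated r \<mu>)\<^sup>2 = 2 * compensated \<rho> \<mu> + (\<integral>x. (r (x, \<mu>))\<^sup>2 \<partial>\<mu>)"
    using compensated_predictable(1)[OF m r fin] AE_simple_times AE_space
  proof eventually_elim
    case (elim \<mu>)
    then show ?case
      using compensated_square[of \<mu> "\<lambda>x. r (x, \<mu>)"]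
      by (simp add: compensated_def \<rho>_def compensated_before_def)
  qed
  have cm: "(\<lambda>\<mu>. (compensated r \<mu>)\<^sup>2) \<in> borel_measurable P"
    using borel_measurable_integrable[OF compensated_predictable(2)[OF m r fin]] by measurable
  have Qm: "(\<lambda>\<mu>. 2 * compensated \<rho> \<mu> + (\<integral>x. (r (x, \<mu>))\<^sup>2 \<partial>\<mu>)) \<in> borel_measurable P"
    using borel_measurable_integrable[OF C(2)] borel_measurable_integrable[OF S(2)] by measurable
  have i: "integrable P (\<lambda>\<mu>. (compensated r \<mu>)\<^sup>2)"
    using C(2) S(2) by (subst integrable_cong_AE[OF cm Qm sq]) simp
  have "(\<integral>\<mu>. (compensated r \<mu>)\<^sup>2 \<partial>P) = (\<integral>\<mu>. (\<integral>x. (r (x, \<mu>))\<^sup>2 \<partial>\<mu>) \<partial>P)"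
    using C(2,3) S(2) by (subst integral_cong_AE[OF cm Qm sq]) simp
  then have "(\<integral>\<^sup>+\<mu>. ennreal ((compensated r \<mu>)\<^sup>2) \<partial>P) = ennreal (\<integral>\<mu>. (\<integral>x. (r (x, \<mu>))\<^sup>2 \<partial>\<mu>) \<partial>P)"
    using nn_integral_eq_integral[OF i] by simp
  also have "\<dots> = (\<integral>\<^sup>+\<mu>. ennreal (\<integral>x. (r (x, \<mu>))\<^sup>2 \<partial>\<mu>) \<partial>P)"
    by (rule nn_integral_eq_integral[OF S(2), symmetric]) simp
  also have "\<dots> \<le> (\<integral>\<^sup>+\<mu>. \<integral>\<^sup>+x. ennreal ((r (x, \<mu>))\<^sup>2) \<partial>\<mu> \<partial>P)"
  proof (rule nn_integral_mono_AE)
    show "AE \<mu> in P. ennreal (\<integral>x. (r (x, \<mu>))\<^sup>2 \<partial>\<mu>) \<le> (\<integral>\<^sup>+x. ennreal ((r (x, \<mu>))\<^sup>2) \<partial>\<mu>)"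
      using S(1) by eventually_elim (simp add: nn_integral_eq_integral)
  qed
  also have "\<dots> = (\<integral>\<^sup>+\<mu>. \<integral>\<^sup>+x. ennreal ((r (x, \<mu>))\<^sup>2) \<partial>hpl \<partial>P)"
    using r by (intro mecke_predictable[of "\<lambda>p. ennreal ((r p)\<^sup>2)"]) (auto intro!: predictableI simp: predictableD)
  finally show ?thesis .
qed simp

text \<open>Cutting \<open>r\<close> off where \<open>variation_before r\<close> exceeds n makes the
  bounded case applicable. On almost every path the total variation is finite, so the truncated
  integrals are eventually equal to the full one, and Fatou's lemma transfers the bound.\<close>

theorem compensated_square_le:
  fixes r :: "(real \<times> real) \<times> (real \<times> real) measure \<Rightarrow> real"
  assumes m [measurable]: "r \<in> borel_measurable (hp_borel \<Otimes>\<^sub>M CM)" and r: "predictable r"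
    and fin: "(\<integral>\<^sup>+\<mu>. \<integral>\<^sup>+x. ennreal \<bar>r (x, \<mu>)\<bar> \<partial>hpl \<partial>P) < \<infinity>"
  shows "(\<integral>\<^sup>+\<mu>. ennreal ((compensated r \<mu>)\<^sup>2) \<partial>P) \<le> (\<integral>\<^sup>+\<mu>. \<integral>\<^sup>+x. ennreal ((r (x, \<mu>))\<^sup>2) \<partial>hpl \<partial>P)"
proof -
  note V [measurable] = variation_before_measurable[OF m]
  define rn where "rn n p = r p * of_bool (variation_before r p \<le> of_nat n)" for n :: nat and p
  have rn_le: "\<bar>rn n p\<bar> \<le> \<bar>r p\<bar>" for n p
    by (simp add: rn_def)
  have rnm [measurable]: "rn n \<in> borel_measurable (hp_borel \<Otimes>\<^sub>M CM)" for n
    unfolding rn_def[abs_def] by measurable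
  have rnp: "predictable (rn n)" for n
    using predictable_before(1)[OF m r] r by (auto intro!: predictableI simp: rn_def predictableD)
  have rnfin: "(\<integral>\<^sup>+\<mu>. \<integral>\<^sup>+x. ennreal \<bar>rn n (x, \<mu>)\<bar> \<partial>hpl \<partial>P) < \<infinity>" for n
    by (rule le_less_trans[OF _ fin]) (intro nn_integral_mono ennreal_leI rn_le)
  have rnV: "variation_before (rn n) (x, \<mu>) \<le> of_nat n" if "rn n (x, \<mu>) \<noteq> 0" for n x \<mu>
  proof -
    have "variation_before (rn n) (x, \<mu>) \<le> variation_before r (x, \<mu>)"
      unfolding variation_before_def prod.case
      by (intro add_mono nn_integral_mono ennreal_leI) (auto simp: abs_mult rn_le)
    also have "\<dots> \<le> of_nat n"
      using that by (auto simp: rn_def split: if_splits)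
    finally show ?thesis .
  qed
  have "(\<integral>\<^sup>+\<mu>. ennreal ((compensated (rn n) \<mu>)\<^sup>2) \<partial>P) \<le> (\<integral>\<^sup>+\<mu>. \<integral>\<^sup>+x. ennreal ((r (x, \<mu>))\<^sup>2) \<partial>hpl \<partial>P)" for n
  proof -
    have "(\<integral>\<^sup>+\<mu>. ennreal ((compensated (rn n) \<mu>)\<^sup>2) \<partial>P) \<le> (\<integral>\<^sup>+\<mu>. \<integral>\<^sup>+x. ennreal ((rn n (x, \<mu>))\<^sup>2) \<partial>hpl \<partial>P)"
      by (rule compensated_square_le_bounded[OF rnm rnp rnfin rnV])
    also have "\<dots> \<le> (\<integral>\<^sup>+\<mu>. \<integral>\<^sup>+x. ennreal ((r (x, \<mu>))\<^sup>2) \<partial>hpl \<partial>P)"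
      by (intro nn_integral_mono ennreal_leI abs_le_square_iff[THEN iffD1] rn_le)
    finally show ?thesis .
  qed
  note bound = this
  have K: "(\<lambda>\<mu>. \<integral>\<^sup>+x. ennreal \<bar>r (x, \<mu>)\<bar> \<partial>\<mu>) \<in> borel_measurable P"
    using nn_integral_kernel_measurable[OF _ measurable_ident, of "\<lambda>p. ennreal \<bar>r p\<bar>"] by simp
  have "AE \<mu> in P. \<forall>\<^sub>F n in sequentially. compensated (rn n) \<mu> = compensated r \<mu>"
    using compensated_predictable(1)[OF m r fin]
  proof eventually_elim
    case (elim \<mu>)
    let ?T = "(\<integral>\<^sup>+x. ennreal \<bar>r (x, \<mu>)\<bar> \<partial>\<mu>) + (\<integral>\<^sup>+x. ennreal \<bar>r (x, \<mu>)\<bar> \<partial>hpl)"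
    have "?T < \<infinity>"
      using elim by (auto simp: integrable_iff_bounded)
    \<comment> \<open>\<open>N\<close> exceeds the total variation on this path, hence the variation
      before every x, so no truncation takes place from \<open>N\<close> on.\<close>
    then obtain N :: nat where N: "?T < of_nat N"
      using ennreal_Ex_less_of_nat[of ?T] unfolding infinity_ennreal_def by blast
    have "rn n (x, \<mu>) = r (x, \<mu>)" if "n \<ge> N" for n x
    proof -
      have "variation_before r (x, \<mu>) \<le> ?T"
        unfolding variation_before_def prod.case
        by (intro add_mono nn_integral_mono ennreal_leI) (auto simp: abs_mult)
      also have "\<dots> \<le> of_nat N"
        using N by simp
      also have "\<dots> \<le> of_nat n"
        using that by simp
      finally show ?thesis
        by (simp add: rn_def)
    qed
    then show ?case
      unfolding compensated_def by (intro eventually_sequentiallyI[of N]) simp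
  qed
  then have "(\<integral>\<^sup>+\<mu>. ennreal ((compensated r \<mu>)\<^sup>2) \<partial>P) \<le> (\<integral>\<^sup>+\<mu>. liminf (\<lambda>n. ennreal ((compensated (rn n) \<mu>)\<^sup>2)) \<partial>P)"
  proof (intro nn_integral_mono_AE, eventually_elim)
    case (elim \<mu>)
    then have "(\<lambda>n. ennreal ((compensated (rn n) \<mu>)\<^sup>2)) \<longlonglongrightarrow> ennreal ((compensated r \<mu>)\<^sup>2)"
      by (intro tendsto_eventually) (auto elim!: eventually_mono)
    from lim_imp_Liminf[OF _ this] show ?case
      by simp
  qed
  also have "\<dots> \<le> liminf (\<lambda>n. \<integral>\<^sup>+\<mu>. ennreal ((compensated (rn n) \<mu>)\<^sup>2) \<partial>P)"
    using compensated_predictable(2)[OF rnm rnp rnfin]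
    by (intro nn_integral_liminf) (auto dest: borel_measurable_integrable)
  also have "\<dots> \<le> (\<integral>\<^sup>+\<mu>. \<integral>\<^sup>+x. ennreal ((r (x, \<mu>))\<^sup>2) \<partial>hpl \<partial>P)"
    using bound by (intro Liminf_le) auto
  finally show ?thesis .
qed

end

section \<open>Stein bound for functionals of the law\<close>

text \<open>Two segments that start at 0 differ exactly on the segment between their end points.
  Integrating out z thus turns \<open>U\<close> and its increments into the intensity and its
  increments.\<close>

lemma nn_integral_hpl_strip:
  fixes a b w :: "real \<Rightarrow> real"
  assumes [measurable]: "a \<in> borel_measurable borel" "b \<in> borel_measurable borel" "w \<in> borel_measurable borel"
    and nn: "\<And>t. 0 \<le> a t" "\<And>t. 0 \<le> b t"
  shows "(\<integral>\<^sup>+x. ennreal (w (fst x) * \<bar>indicator {0<..a (fst x)} (snd x) - indicator {0<..b (fst x)} (snd x)\<bar>) \<partial>hpl)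
    = (\<integral>\<^sup>+t. ennreal (w t * \<bar>a t - b t\<bar>) \<partial>lborel)"
proof -
  have "(\<integral>\<^sup>+x. ennreal (w (fst x) * \<bar>indicator {0<..a (fst x)} (snd x) - indicator {0<..b (fst x)} (snd x)\<bar>) \<partial>hpl)
    = (\<integral>\<^sup>+t. (\<integral>\<^sup>+z\<in>{0..}. ennreal (w (fst (t, z)) * \<bar>indicator {0<..a (fst (t, z))} (snd (t, z))
        - indicator {0<..b (fst (t, z))} (snd (t, z))\<bar>) \<partial>lborel) \<partial>lborel)"
  proof (rule nn_integral_hpl)
    show "(\<lambda>x. ennreal (w (fst x) * \<bar>indicator {0<..a (fst x)} (snd x) - indicator {0<..b (fst x)} (snd x)\<bar>))
      \<in> borel_measurable hp_borel"
      unfolding indicator_def greaterThanAtMost_iff by measurable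
  qed
  also have "\<dots> = (\<integral>\<^sup>+t. ennreal (w t * \<bar>a t - b t\<bar>) \<partial>lborel)"
  proof (rule nn_integral_cong)
    fix t :: real
    have "ennreal (w t * \<bar>indicator {0<..a t} z - indicator {0<..b t} z\<bar>) * indicator {0..} z
        = ennreal (w t) * indicator {min (a t) (b t)<..max (a t) (b t)} z" for z
      using nn[of t] by (auto simp: indicator_def min_def max_def)
    then have "(\<integral>\<^sup>+z\<in>{0..}. ennreal (w (fst (t, z)) * \<bar>indicator {0<..a (fst (t, z))} (snd (t, z))
        - indicator {0<..b (fst (t, z))} (snd (t, z))\<bar>) \<partial>lborel)
      = (\<integral>\<^sup>+z. ennreal (w t) * indicator {min (a t) (b t)<..max (a t) (b t)} z \<partial>lborel)"
      by (simp only: fst_conv snd_conv)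
    also have "\<dots> = ennreal (w t) * ennreal \<bar>a t - b t\<bar>"
      by (subst nn_integral_cmult_indicator) (auto simp: min_def max_def)
    also have "\<dots> = ennreal (w t * \<bar>a t - b t\<bar>)"
      by (rule ennreal_mult''[symmetric]) simp
    finally show "(\<integral>\<^sup>+z\<in>{0..}. ennreal (w (fst (t, z)) * \<bar>indicator {0<..a (fst (t, z))} (snd (t, z))
        - indicator {0<..b (fst (t, z))} (snd (t, z))\<bar>) \<partial>lborel) = ennreal (w t * \<bar>a t - b t\<bar>)" .
  qed
  finally show ?thesis .
qed

lemma nn_integral_hpl_subgraph:
  fixes a w :: "real \<Rightarrow> real"
  assumes "a \<in> borel_measurable borel" "w \<in> borel_measurable borel" "\<And>t. 0 \<le> a t"
  shows "(\<integral>\<^sup>+x. ennreal (w (fst x) * indicator {0<..a (fst x)} (snd x)) \<partial>hpl) = (\<integral>\<^sup>+t. ennreal (w t * a t) \<partial>lborel)"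
  using nn_integral_hpl_strip[of a "\<lambda>_. 0" w] assms by simp

text \<open>The nonnegative version for \<open>w\<close> and for its negative gives both parts.
  Integrability passes in either direction, so the identity also covers the case in which both
  integrals are 0 by default.\<close>

lemma integral_hpl_subgraph:
  fixes a w :: "real \<Rightarrow> real"
  assumes [measurable]: "a \<in> borel_measurable borel" "w \<in> borel_measurable borel" and a: "\<And>t. 0 \<le> a t"
  shows "(\<integral>x. w (fst x) * indicator {0<..a (fst x)} (snd x) \<partial>hpl) = (\<integral>t. w t * a t \<partial>lborel)"
proof -
  let ?f = "\<lambda>x. w (fst x) * indicator {0<..a (fst x)} (snd x)"
  have m: "?f \<in> borel_measurable hpl"
    unfolding indicator_def greaterThanAtMost_iff by measurable
  have p: "(\<integral>\<^sup>+x. ennreal (?f x) \<partial>hpl) = (\<integral>\<^sup>+t. ennreal (w t * a t) \<partial>lborel)"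
    using assms by (rule nn_integral_hpl_subgraph)
  have n: "(\<integral>\<^sup>+x. ennreal (- ?f x) \<partial>hpl) = (\<integral>\<^sup>+t. ennreal (- (w t * a t)) \<partial>lborel)"
    using nn_integral_hpl_subgraph[of a "\<lambda>t. - w t"] a by simp
  have "integrable hpl ?f \<longleftrightarrow> integrable lborel (\<lambda>t. w t * a t)"
    unfolding real_integrable_def using m p n by simp
  then show ?thesis
    using p n real_lebesgue_integral_def[of hpl ?f] real_lebesgue_integral_def[of lborel "\<lambda>t. w t * a t"]
    by (cases "integrable hpl ?f") (auto simp: not_integrable_integral_eq)
qed

section \<open>The stochastic intensity, the integrand and their increments\<close>

locale intensity_law = poisson_law P for P +
  fixes \<phi> :: "real \<Rightarrow> (real \<times> real) measure \<Rightarrow> real" and u :: "real \<Rightarrow> real"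
  assumes phi: "case_prod \<phi> \<in> borel_measurable (borel \<Otimes>\<^sub>M counting_space)"
    and phi_nonneg: "\<And>t \<mu>. \<mu> \<in> counting_measures \<Longrightarrow> \<phi> t \<mu> \<ge> 0"
    and u [measurable]: "u \<in> borel_measurable borel"
begin

abbreviation "lam \<equiv> intensity \<phi>"

lemma lam_measurable [measurable (raw)]:
  assumes [measurable]: "f \<in> borel_measurable M" "g \<in> M \<rightarrow>\<^sub>M CM"
  shows "(\<lambda>\<omega>. lam (f \<omega>) (g \<omega>)) \<in> borel_measurable M"
proof -
  have "(\<lambda>\<omega>. (f \<omega>, restrict_before (f \<omega>) (g \<omega>))) \<in> M \<rightarrow>\<^sub>M borel \<Otimes>\<^sub>M counting_space"
    by (intro measurable_Pair measurable_counting_space_CM) measurable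
  from measurable_compose[OF this phi] show ?thesis
    by (simp add: intensity_def)
qed

lemma lam_path_measurable: "\<mu> \<in> counting_measures \<Longrightarrow> (\<lambda>t. lam t \<mu>) \<in> borel_measurable borel"
  using lam_measurable[of "\<lambda>t. t" borel "\<lambda>_. \<mu>"] by simp

lemma lam_nonneg: "\<mu> \<in> counting_measures \<Longrightarrow> 0 \<le> lam t \<mu>"
  unfolding intensity_def by (intro phi_nonneg restrict_before_counting_measures)

lemma lam_add_point: "\<mu> \<in> counting_measures \<Longrightarrow> s \<le> fst y \<Longrightarrow> lam s (add_point \<mu> y) = lam s \<mu>"
  by (simp add: intensity_def restrict_before_add_point_after)

lemma lam_add_point_add_point:
  "\<mu> \<in> counting_measures \<Longrightarrow> x \<in> half_plane \<Longrightarrow> y \<in> half_plane \<Longrightarrow> s \<le> fst y \<Longrightarrow>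
    lam s (add_point (add_point \<mu> y) x) = lam s (add_point \<mu> x)"
  by (simp add: intensity_def restrict_before_add_point_add_point)

definition below :: "(real \<times> real) \<times> (real \<times> real) measure \<Rightarrow> real" where
  "below p = indicator {0<..lam (fst (fst p)) (snd p)} (snd (fst p))"

definition U :: "(real \<times> real) \<times> (real \<times> real) measure \<Rightarrow> real" where
  "U p = u (fst (fst p)) * below p"

definition DU :: "real \<times> real \<Rightarrow> (real \<times> real) \<times> (real \<times> real) measure \<Rightarrow> real" where
  "DU x p = U (fst p, add_point (snd p) x) - U p"

text \<open>This is the difference operator applied to the intensity, with \<open>add_point\<close>
  in place of \<open>add_atom\<close>; the two agree whenever the measure has no atom at x, thus
  almost surely for fixed x.\<close>

definition Dint :: "real \<times> real \<Rightarrow> real \<Rightarrow> (real \<times> real) measure \<Rightarrow> real" where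
  "Dint x s \<mu> = lam s (add_point \<mu> x) - lam s \<mu>"

definition F :: "(real \<times> real) measure \<Rightarrow> real" where
  "F = compensated U"

definition R :: "(real \<times> real) \<times> (real \<times> real) measure \<Rightarrow> real" where
  "R p = compensated (DU (fst p)) (snd p)"

lemma below_measurable [measurable]: "below \<in> borel_measurable (hp_borel \<Otimes>\<^sub>M CM)"
  unfolding below_def[abs_def] indicator_def greaterThanAtMost_iff by measurable

lemma below_01: "below p = 0 \<or> below p = 1"
  by (simp add: below_def indicator_def)

lemma U_measurable [measurable]: "U \<in> borel_measurable (hp_borel \<Otimes>\<^sub>M CM)"
  unfolding U_def[abs_def] by measurable

lemma Dint_measurable [measurable (raw)]:
  assumes [measurable]: "x \<in> M \<rightarrow>\<^sub>M hp_borel" "s \<in> borel_measurable M" "g \<in> M \<rightarrow>\<^sub>M CM"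
  shows "(\<lambda>\<omega>. Dint (x \<omega>) (s \<omega>) (g \<omega>)) \<in> borel_measurable M"
  unfolding Dint_def by measurable

lemma DU_measurable_pair: "(\<lambda>(y, x, \<mu>). DU x (y, \<mu>)) \<in> borel_measurable (hp_borel \<Otimes>\<^sub>M (hp_borel \<Otimes>\<^sub>M CM))"
  unfolding DU_def split_beta' by measurable

lemma DU_measurable [measurable]: "x \<in> half_plane \<Longrightarrow> DU x \<in> borel_measurable (hp_borel \<Otimes>\<^sub>M CM)"
  unfolding DU_def[abs_def] by measurable

lemma below_add_point:
  "\<mu> \<in> counting_measures \<Longrightarrow> fst x \<le> fst y \<Longrightarrow> below (x, add_point \<mu> y) = below (x, \<mu>)"
  by (simp add: below_def lam_add_point)

lemma U_add_point: "\<mu> \<in> counting_measures \<Longrightarrow> fst x \<le> fst y \<Longrightarrow> U (x, add_point \<mu> y) = U (x, \<mu>)"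
  by (simp add: U_def below_add_point)

lemma predictable_U: "predictable U"
  by (intro predictableI U_add_point)

lemma DU_before: "\<mu> \<in> counting_measures \<Longrightarrow> fst y \<le> fst x \<Longrightarrow> DU x (y, \<mu>) = 0"
  by (simp add: DU_def U_add_point)

lemma predictable_DU: assumes x: "x \<in> half_plane" shows "predictable (DU x)"
proof (rule predictableI)
  fix y z \<mu> assume "y \<in> half_plane" "z \<in> half_plane" "\<mu> \<in> counting_measures" "fst y \<le> fst z"
  then show "DU x (y, add_point \<mu> z) = DU x (y, \<mu>)"
    using x by (simp add: DU_def U_add_point) (simp add: U_def below_def lam_add_point_add_point)
qed

text \<open>\<open>DU x\<close> vanishes up to the time of x, and after that time
  \<open>below\<close> at x is already determined. So the indicator may stand inside the compensated
  integral without destroying predictability, and no conditional expectation is needed.\<close>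

lemma predictable_below_DU:
  assumes x: "x \<in> half_plane" shows "predictable (\<lambda>p. below (x, snd p) * DU x p)"
proof (rule predictableI)
  fix y z \<mu> assume yz: "y \<in> half_plane" "z \<in> half_plane" "\<mu> \<in> counting_measures" "fst y \<le> fst z"
  note D = predictableD[OF predictable_DU[OF x] yz]
  show "below (x, snd (y, add_point \<mu> z)) * DU x (y, add_point \<mu> z) = below (x, snd (y, \<mu>)) * DU x (y, \<mu>)"
  proof (cases "fst y \<le> fst x")
    case True
    then show ?thesis
      using yz by (simp add: D DU_before)
  next
    case False
    then show ?thesis
      using yz by (simp add: D below_add_point)
  qed
qed

lemma R_measurable [measurable]: "R \<in> borel_measurable (hp_borel \<Otimes>\<^sub>M CM)"
proof -
  have "(\<lambda>p. \<integral>y. DU (fst p) (y, snd p) \<partial>snd p) \<in> borel_measurable (hp_borel \<Otimes>\<^sub>M CM)"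
    using integral_kernel_measurable[OF DU_measurable_pair measurable_snd] by (simp add: split_beta')
  moreover have "(\<lambda>p. \<integral>y. DU (fst p) (y, snd p) \<partial>hpl) \<in> borel_measurable (hp_borel \<Otimes>\<^sub>M CM)"
    unfolding DU_def by measurable
  ultimately show ?thesis
    unfolding R_def[abs_def] compensated_def by (rule borel_measurable_diff)
qed

lemma F_measurable [measurable]: "F \<in> borel_measurable CM"
proof -
  have "(\<lambda>\<mu>. \<integral>y. U (y, \<mu>) \<partial>\<mu>) \<in> borel_measurable CM"
    using integral_kernel_measurable[OF U_measurable measurable_ident] by simp
  moreover have "(\<lambda>\<mu>. \<integral>y. U (y, \<mu>) \<partial>hpl) \<in> borel_measurable CM"
    by measurable
  ultimately show ?thesis
    unfolding F_def compensated_def[abs_def] by (rule borel_measurable_diff)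
qed

lemma nn_integral_U_power:
  assumes \<mu>: "\<mu> \<in> counting_measures" and q: "0 < q"
  shows "(\<integral>\<^sup>+x. ennreal (\<bar>U (x, \<mu>)\<bar> ^ q) \<partial>hpl) = (\<integral>\<^sup>+t. ennreal (\<bar>u t\<bar> ^ q * lam t \<mu>) \<partial>lborel)"
proof -
  have "\<bar>U (x, \<mu>)\<bar> ^ q = \<bar>u (fst x)\<bar> ^ q * indicator {0<..lam (fst x) \<mu>} (snd x)" for x
    using q by (simp add: U_def below_def indicator_def)
  moreover have "(\<lambda>t. lam t \<mu>) \<in> borel_measurable borel"
    using \<mu> by (rule lam_path_measurable)
  ultimately show ?thesis
    using nn_integral_hpl_subgraph[of "\<lambda>t. lam t \<mu>" "\<lambda>t. \<bar>u t\<bar> ^ q"] lam_nonneg[OF \<mu>] by simp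
qed

lemma integral_U:
  assumes \<mu>: "\<mu> \<in> counting_measures"
  shows "(\<integral>x. U (x, \<mu>) \<partial>hpl) = (\<integral>t. u t * lam t \<mu> \<partial>lborel)"
    and "(\<integral>x. (U (x, \<mu>))\<^sup>2 \<partial>hpl) = (\<integral>t. \<bar>u t\<bar>\<^sup>2 * lam t \<mu> \<partial>lborel)"
proof -
  have l: "(\<lambda>t. lam t \<mu>) \<in> borel_measurable borel"
    using \<mu> by (rule lam_path_measurable)
  show "(\<integral>x. U (x, \<mu>) \<partial>hpl) = (\<integral>t. u t * lam t \<mu> \<partial>lborel)"
    using integral_hpl_subgraph[OF l u] lam_nonneg[OF \<mu>] by (simp add: U_def below_def)
  have "(U (x, \<mu>))\<^sup>2 = \<bar>u (fst x)\<bar>\<^sup>2 * indicator {0<..lam (fst x) \<mu>} (snd x)" for x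
    by (simp add: U_def below_def indicator_def)
  then show "(\<integral>x. (U (x, \<mu>))\<^sup>2 \<partial>hpl) = (\<integral>t. \<bar>u t\<bar>\<^sup>2 * lam t \<mu> \<partial>lborel)"
    using integral_hpl_subgraph[OF l, of "\<lambda>t. \<bar>u t\<bar>\<^sup>2"] lam_nonneg[OF \<mu>] by simp
qed

text \<open>\<open>DU x\<close> takes only the values 0, u and -u. The exponent therefore lands on u
  alone, and the increment of the intensity enters linearly for every positive q.\<close>

lemma nn_integral_DU_power:
  assumes \<mu>: "\<mu> \<in> counting_measures" and x: "x \<in> half_plane" and q: "0 < q"
  shows "(\<integral>\<^sup>+y. ennreal (\<bar>DU x (y, \<mu>)\<bar> ^ q) \<partial>hpl)
    = (\<integral>\<^sup>+s\<in>{fst x<..}. ennreal (\<bar>u s\<bar> ^ q * \<bar>Dint x s \<mu>\<bar>) \<partial>lborel)"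
proof -
  have a: "add_point \<mu> x \<in> counting_measures"
    using \<mu> x by (rule add_point_counting_measures)
  have l: "(\<lambda>t. lam t \<mu>) \<in> borel_measurable borel" "(\<lambda>t. lam t (add_point \<mu> x)) \<in> borel_measurable borel"
    using \<mu> a by (auto intro: lam_path_measurable)
  have "\<bar>DU x (y, \<mu>)\<bar> ^ q = \<bar>u (fst y)\<bar> ^ q * \<bar>indicator {0<..lam (fst y) (add_point \<mu> x)} (snd y)
      - indicator {0<..lam (fst y) \<mu>} (snd y)\<bar>" for y
    using q by (simp add: DU_def U_def below_def indicator_def)
  then have "(\<integral>\<^sup>+y. ennreal (\<bar>DU x (y, \<mu>)\<bar> ^ q) \<partial>hpl) = (\<integral>\<^sup>+s. ennreal (\<bar>u s\<bar> ^ q * \<bar>Dint x s \<mu>\<bar>) \<partial>lborel)"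
    using nn_integral_hpl_strip[OF l(2,1), of "\<lambda>t. \<bar>u t\<bar> ^ q"] lam_nonneg[OF \<mu>] lam_nonneg[OF a]
    by (simp add: Dint_def)
  also have "\<dots> = (\<integral>\<^sup>+s\<in>{fst x<..}. ennreal (\<bar>u s\<bar> ^ q * \<bar>Dint x s \<mu>\<bar>) \<partial>lborel)"
    using \<mu> by (intro nn_integral_cong) (auto simp: indicator_def Dint_def lam_add_point not_less)
  finally show ?thesis .
qed

text \<open>A weight with values 0 and 1 is its own positive power. It is used with the constant 1
  and with the indicator \<open>below\<close>.\<close>

lemma nn_integral_DU_power_P:
  fixes k :: "(real \<times> real) measure \<Rightarrow> real"
  assumes x: "x \<in> half_plane" and q: "0 < q"
    and k [measurable]: "k \<in> borel_measurable CM" and k01: "\<And>\<mu>. k \<mu> = 0 \<or> k \<mu> = 1"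
  shows "(\<integral>\<^sup>+\<mu>. \<integral>\<^sup>+y. ennreal (\<bar>k \<mu> * DU x (y, \<mu>)\<bar> ^ q) \<partial>hpl \<partial>P)
    = (\<integral>\<^sup>+s\<in>{fst x<..}. ennreal (\<bar>u s\<bar> ^ q) * (\<integral>\<^sup>+\<mu>. ennreal (k \<mu> * \<bar>Dint x s \<mu>\<bar>) \<partial>P) \<partial>lborel)"
proof -
  interpret LP: pair_sigma_finite lborel P ..
  note [measurable] = DU_measurable[OF x]
  have [measurable]: "x \<in> space hp_borel"
    using x by simp
  have k0: "0 \<le> k \<mu>" for \<mu>
    using k01[of \<mu>] by auto
  have kq: "\<bar>k \<mu> * a\<bar> ^ q = k \<mu> * \<bar>a\<bar> ^ q" for \<mu> a
    using k01[of \<mu>] q by auto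
  have "(\<integral>\<^sup>+\<mu>. \<integral>\<^sup>+y. ennreal (\<bar>k \<mu> * DU x (y, \<mu>)\<bar> ^ q) \<partial>hpl \<partial>P)
    = (\<integral>\<^sup>+\<mu>. \<integral>\<^sup>+s. ennreal (k \<mu> * (\<bar>u s\<bar> ^ q * \<bar>Dint x s \<mu>\<bar>)) * indicator {fst x<..} s \<partial>lborel \<partial>P)"
  proof (rule nn_integral_cong)
    fix \<mu> assume "\<mu> \<in> space P"
    then have \<mu>: "\<mu> \<in> counting_measures"
      by simp
    have \<mu>' [measurable]: "\<mu> \<in> space CM"
      using \<mu> by simp
    have "(\<integral>\<^sup>+y. ennreal (\<bar>k \<mu> * DU x (y, \<mu>)\<bar> ^ q) \<partial>hpl) = (\<integral>\<^sup>+y. ennreal (k \<mu>) * ennreal (\<bar>DU x (y, \<mu>)\<bar> ^ q) \<partial>hpl)"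
      using k0 by (simp add: kq ennreal_mult)
    also have "\<dots> = ennreal (k \<mu>) * (\<integral>\<^sup>+y. ennreal (\<bar>DU x (y, \<mu>)\<bar> ^ q) \<partial>hpl)"
      by (rule nn_integral_cmult) measurable
    also have "\<dots> = ennreal (k \<mu>) * (\<integral>\<^sup>+s\<in>{fst x<..}. ennreal (\<bar>u s\<bar> ^ q * \<bar>Dint x s \<mu>\<bar>) \<partial>lborel)"
      by (simp add: nn_integral_DU_power[OF \<mu> x q])
    also have "\<dots> = (\<integral>\<^sup>+s. ennreal (k \<mu>) * (ennreal (\<bar>u s\<bar> ^ q * \<bar>Dint x s \<mu>\<bar>) * indicator {fst x<..} s) \<partial>lborel)"
      by (rule nn_integral_cmult[symmetric]) measurable
    also have "\<dots> = (\<integral>\<^sup>+s. ennreal (k \<mu> * (\<bar>u s\<bar> ^ q * \<bar>Dint x s \<mu>\<bar>)) * indicator {fst x<..} s \<partial>lborel)"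
      using k0[of \<mu>] by (intro nn_integral_cong) (subst ennreal_mult, auto simp: mult.assoc)
    finally show "(\<integral>\<^sup>+y. ennreal (\<bar>k \<mu> * DU x (y, \<mu>)\<bar> ^ q) \<partial>hpl)
      = (\<integral>\<^sup>+s. ennreal (k \<mu> * (\<bar>u s\<bar> ^ q * \<bar>Dint x s \<mu>\<bar>)) * indicator {fst x<..} s \<partial>lborel)" .
  qed
  also have "\<dots> = (\<integral>\<^sup>+s. \<integral>\<^sup>+\<mu>. ennreal (k \<mu> * (\<bar>u s\<bar> ^ q * \<bar>Dint x s \<mu>\<bar>)) * indicator {fst x<..} s \<partial>P \<partial>lborel)"
    by (rule LP.Fubini') measurable
  also have "\<dots> = (\<integral>\<^sup>+s\<in>{fst x<..}. ennreal (\<bar>u s\<bar> ^ q) * (\<integral>\<^sup>+\<mu>. ennreal (k \<mu> * \<bar>Dint x s \<mu>\<bar>) \<partial>P) \<partial>lborel)"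
  proof (rule nn_integral_cong)
    fix s :: real
    have "(\<integral>\<^sup>+\<mu>. ennreal (k \<mu> * (\<bar>u s\<bar> ^ q * \<bar>Dint x s \<mu>\<bar>)) * indicator {fst x<..} s \<partial>P)
      = (\<integral>\<^sup>+\<mu>. (ennreal (\<bar>u s\<bar> ^ q) * indicator {fst x<..} s) * ennreal (k \<mu> * \<bar>Dint x s \<mu>\<bar>) \<partial>P)"
      using k0 by (intro nn_integral_cong) (simp add: ennreal_mult mult_ac)
    also have "\<dots> = (ennreal (\<bar>u s\<bar> ^ q) * indicator {fst x<..} s) * (\<integral>\<^sup>+\<mu>. ennreal (k \<mu> * \<bar>Dint x s \<mu>\<bar>) \<partial>P)"
      by (rule nn_integral_cmult) measurable
    finally show "(\<integral>\<^sup>+\<mu>. ennreal (k \<mu> * (\<bar>u s\<bar> ^ q * \<bar>Dint x s \<mu>\<bar>)) * indicator {fst x<..} s \<partial>P)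
      = ennreal (\<bar>u s\<bar> ^ q) * (\<integral>\<^sup>+\<mu>. ennreal (k \<mu> * \<bar>Dint x s \<mu>\<bar>) \<partial>P) * indicator {fst x<..} s"
      by (simp add: mult_ac)
  qed
  finally show ?thesis .
qed

lemma compensated_below:
  "compensated (\<lambda>p. below (x, snd p) * DU x p) \<mu> = below (x, \<mu>) * R (x, \<mu>)"
  by (simp add: compensated_def R_def right_diff_distrib)

text \<open>The interaction terms of the bound: \<open>a\<close> is the weight of the earlier time, \<open>q\<close> the exponent
  of the later one.\<close>

definition interaction :: "nat \<Rightarrow> nat \<Rightarrow> ennreal" where
  "interaction a q = (\<integral>\<^sup>+x. ennreal (\<bar>u (fst x)\<bar> ^ a) * (\<integral>\<^sup>+s\<in>{fst x<..}. ennreal (\<bar>u s\<bar> ^ q) *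
     (\<integral>\<^sup>+\<mu>. ennreal (below (x, \<mu>) * \<bar>Dint x s \<mu>\<bar>) \<partial>P) \<partial>lborel) \<partial>hpl)"

lemma below_DU_measurable: "x \<in> half_plane \<Longrightarrow> (\<lambda>p. below (x, snd p) * DU x p) \<in> borel_measurable (hp_borel \<Otimes>\<^sub>M CM)"
  by measurable

lemma interaction_eq:
  assumes "0 < q"
  shows "interaction a q = (\<integral>\<^sup>+x. ennreal (\<bar>u (fst x)\<bar> ^ a) *
    (\<integral>\<^sup>+\<mu>. \<integral>\<^sup>+y. ennreal (\<bar>below (x, \<mu>) * DU x (y, \<mu>)\<bar> ^ q) \<partial>hpl \<partial>P) \<partial>hpl)"
  unfolding interaction_def
proof (rule nn_integral_cong)
  fix x assume "x \<in> space hpl"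
  then have x: "x \<in> half_plane" by simp
  have "(\<lambda>\<mu>. below (x, \<mu>)) \<in> borel_measurable CM"
    using measurable_Pair2[OF below_measurable, of x] x by simp
  from nn_integral_DU_power_P[OF x assms this below_01]
  show "ennreal (\<bar>u (fst x)\<bar> ^ a) * (\<integral>\<^sup>+s\<in>{fst x<..}. ennreal (\<bar>u s\<bar> ^ q) *
     (\<integral>\<^sup>+\<mu>. ennreal (below (x, \<mu>) * \<bar>Dint x s \<mu>\<bar>) \<partial>P) \<partial>lborel) = ennreal (\<bar>u (fst x)\<bar> ^ a) *
    (\<integral>\<^sup>+\<mu>. \<integral>\<^sup>+y. ennreal (\<bar>below (x, \<mu>) * DU x (y, \<mu>)\<bar> ^ q) \<partial>hpl \<partial>P)"
    by simp
qed

text \<open>The power of \<open>U\<close> is a deterministic weight times \<open>below\<close>,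
  which moves into the compensated integral; there the estimate with factor 2 applies. The case a =
  1 gives the third term of the bound, a = 2 the integrability of the mixed term.\<close>

lemma nn_integral_U_R:
  assumes a: "0 < a"
  shows "(\<integral>\<^sup>+p. ennreal (\<bar>U p\<bar> ^ a * \<bar>R p\<bar>) \<partial>(hpl \<Otimes>\<^sub>M P)) \<le> 2 * interaction a 1"
proof -
  have "(\<integral>\<^sup>+p. ennreal (\<bar>U p\<bar> ^ a * \<bar>R p\<bar>) \<partial>(hpl \<Otimes>\<^sub>M P)) = (\<integral>\<^sup>+x. \<integral>\<^sup>+\<mu>. ennreal (\<bar>U (x, \<mu>)\<bar> ^ a * \<bar>R (x, \<mu>)\<bar>) \<partial>P \<partial>hpl)"
    by (rule nn_integral_fst[symmetric]) measurable
  also have "\<dots> \<le> (\<integral>\<^sup>+x. 2 * (ennreal (\<bar>u (fst x)\<bar> ^ a) *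
      (\<integral>\<^sup>+\<mu>. \<integral>\<^sup>+y. ennreal (\<bar>below (x, \<mu>) * DU x (y, \<mu>)\<bar> ^ 1) \<partial>hpl \<partial>P)) \<partial>hpl)"
  proof (rule nn_integral_mono)
    fix x assume "x \<in> space hpl"
    then have x: "x \<in> half_plane" by simp
    then have [measurable]: "x \<in> space hp_borel" by simp
    have "\<bar>U (x, \<mu>)\<bar> ^ a * \<bar>R (x, \<mu>)\<bar> = \<bar>u (fst x)\<bar> ^ a * \<bar>below (x, \<mu>) * R (x, \<mu>)\<bar>" for \<mu>
      using below_01[of "(x, \<mu>)"] a by (auto simp: U_def)
    then have "(\<integral>\<^sup>+\<mu>. ennreal (\<bar>U (x, \<mu>)\<bar> ^ a * \<bar>R (x, \<mu>)\<bar>) \<partial>P)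
      = (\<integral>\<^sup>+\<mu>. ennreal (\<bar>u (fst x)\<bar> ^ a) * ennreal \<bar>below (x, \<mu>) * R (x, \<mu>)\<bar> \<partial>P)"
      by (simp add: ennreal_mult)
    also have "\<dots> = ennreal (\<bar>u (fst x)\<bar> ^ a) * (\<integral>\<^sup>+\<mu>. ennreal \<bar>below (x, \<mu>) * R (x, \<mu>)\<bar> \<partial>P)"
      by (rule nn_integral_cmult) measurable
    also have "\<dots> \<le> ennreal (\<bar>u (fst x)\<bar> ^ a) * (2 * (\<integral>\<^sup>+\<mu>. \<integral>\<^sup>+y. ennreal \<bar>below (x, \<mu>) * DU x (y, \<mu>)\<bar> \<partial>hpl \<partial>P))"
      using nn_integral_compensated_le[OF below_DU_measurable[OF x] predictable_below_DU[OF x]]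
      by (intro mult_left_mono) (simp_all add: compensated_below)
    finally show "(\<integral>\<^sup>+\<mu>. ennreal (\<bar>U (x, \<mu>)\<bar> ^ a * \<bar>R (x, \<mu>)\<bar>) \<partial>P) \<le> 2 * (ennreal (\<bar>u (fst x)\<bar> ^ a) *
      (\<integral>\<^sup>+\<mu>. \<integral>\<^sup>+y. ennreal (\<bar>below (x, \<mu>) * DU x (y, \<mu>)\<bar> ^ 1) \<partial>hpl \<partial>P))"
      by (simp add: mult_ac)
  qed
  also have "\<dots> = 2 * interaction a 1"
    unfolding interaction_eq[OF zero_less_one] DU_def by (rule nn_integral_cmult) measurable
  finally show ?thesis .
qed

end

section \<open>Comparison with the normal law through Stein's equation\<close>

locale stein_bound = intensity_law +
  assumes u1: "(\<integral>\<^sup>+\<mu>. (\<integral>\<^sup>+t. ennreal (\<bar>u t\<bar> * lam t \<mu>) \<partial>lborel) \<partial>P) < \<infinity>"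
    and u2: "(\<integral>\<^sup>+\<mu>. (\<integral>\<^sup>+t. ennreal (\<bar>u t\<bar>\<^sup>2 * lam t \<mu>) \<partial>lborel) \<partial>P) < \<infinity>"
    and D1: "(\<integral>\<^sup>+x. (\<integral>\<^sup>+s\<in>{fst x<..}. ennreal \<bar>u s\<bar> * (\<integral>\<^sup>+\<mu>. ennreal \<bar>Dint x s \<mu>\<bar> \<partial>P) \<partial>lborel) \<partial>hpl) < \<infinity>"
    and D3: "interaction 2 1 < \<infinity>"
begin

lemma nn_integral_U_power_P:
  assumes "0 < q"
  shows "(\<integral>\<^sup>+p. ennreal (\<bar>U p\<bar> ^ q) \<partial>(hpl \<Otimes>\<^sub>M P)) = (\<integral>\<^sup>+\<mu>. (\<integral>\<^sup>+t. ennreal (\<bar>u t\<bar> ^ q * lam t \<mu>) \<partial>lborel) \<partial>P)"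
proof -
  have "(\<integral>\<^sup>+p. ennreal (\<bar>U p\<bar> ^ q) \<partial>(hpl \<Otimes>\<^sub>M P)) = (\<integral>\<^sup>+\<mu>. \<integral>\<^sup>+x. ennreal (\<bar>U (x, \<mu>)\<bar> ^ q) \<partial>hpl \<partial>P)"
    by (rule HP.nn_integral_snd[symmetric, of "\<lambda>p. ennreal (\<bar>U p\<bar> ^ q)", simplified]) measurable
  also have "\<dots> = (\<integral>\<^sup>+\<mu>. (\<integral>\<^sup>+t. ennreal (\<bar>u t\<bar> ^ q * lam t \<mu>) \<partial>lborel) \<partial>P)"
    using assms by (intro nn_integral_cong) (simp add: nn_integral_U_power)
  finally show ?thesis .
qed

lemma integrable_U: "integrable (hpl \<Otimes>\<^sub>M P) U"
  unfolding integrable_iff_bounded using nn_integral_U_power_P[of 1] u1 by simp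

lemma integrable_U2: "integrable (hpl \<Otimes>\<^sub>M P) (\<lambda>p. (U p)\<^sup>2)"
  unfolding integrable_iff_bounded using nn_integral_U_power_P[of 2] u2 by simp

lemma U_fin: "(\<integral>\<^sup>+\<mu>. \<integral>\<^sup>+x. ennreal \<bar>U (x, \<mu>)\<bar> \<partial>hpl \<partial>P) < \<infinity>"
proof -
  have "(\<integral>\<^sup>+\<mu>. \<integral>\<^sup>+x. ennreal \<bar>U (x, \<mu>)\<bar> \<partial>hpl \<partial>P) = (\<integral>\<^sup>+\<mu>. (\<integral>\<^sup>+t. ennreal (\<bar>u t\<bar> * lam t \<mu>) \<partial>lborel) \<partial>P)"
    using nn_integral_U_power[of _ 1] by (intro nn_integral_cong) simp
  then show ?thesis
    using u1 by simp
qed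

lemmas U_compensated = compensated_predictable[OF U_measurable predictable_U U_fin]

lemma integrable_F: "integrable P F"
  unfolding F_def by (rule U_compensated)

lemma AE_DU_fin: "AE x in hpl. (\<integral>\<^sup>+\<mu>. \<integral>\<^sup>+y. ennreal \<bar>DU x (y, \<mu>)\<bar> \<partial>hpl \<partial>P) < \<infinity>"
proof -
  have "(\<integral>\<^sup>+x. \<integral>\<^sup>+\<mu>. \<integral>\<^sup>+y. ennreal \<bar>DU x (y, \<mu>)\<bar> \<partial>hpl \<partial>P \<partial>hpl)
    = (\<integral>\<^sup>+x. (\<integral>\<^sup>+s\<in>{fst x<..}. ennreal \<bar>u s\<bar> * (\<integral>\<^sup>+\<mu>. ennreal \<bar>Dint x s \<mu>\<bar> \<partial>P) \<partial>lborel) \<partial>hpl)"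
    using nn_integral_DU_power_P[where k = "\<lambda>_. 1" and q = 1] by (intro nn_integral_cong) simp
  with D1 have "(\<integral>\<^sup>+x. \<integral>\<^sup>+\<mu>. \<integral>\<^sup>+y. ennreal \<bar>DU x (y, \<mu>)\<bar> \<partial>hpl \<partial>P \<partial>hpl) \<noteq> \<infinity>"
    by simp
  then have "AE x in hpl. (\<integral>\<^sup>+\<mu>. \<integral>\<^sup>+y. ennreal \<bar>DU x (y, \<mu>)\<bar> \<partial>hpl \<partial>P) \<noteq> \<infinity>"
    unfolding DU_def by (rule nn_integral_PInf_AE[rotated]) measurable
  then show ?thesis
    by eventually_elim (simp add: less_top)
qed

text \<open>Almost surely x carries no atom, so integrating over the enlarged measure adds the value
  of the integrand at x, which predictability identifies with \<open>U (x, \<mu>)\<close>. At the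
  other points, and in the Lebesgue integral, the integrand changes by \<open>DU x\<close>.\<close>

lemma shift_F: "AE p in hpl \<Otimes>\<^sub>M P. F (add_point (snd p) (fst p)) = F (snd p) + (U p + R p)"
proof (rule HP.AE_pair_measure)
  show "{p \<in> space (hpl \<Otimes>\<^sub>M P). F (add_point (snd p) (fst p)) = F (snd p) + (U p + R p)} \<in> sets (hpl \<Otimes>\<^sub>M P)"
    by measurable
  show "AE x in hpl. AE \<mu> in P. F (add_point (snd (x, \<mu>)) (fst (x, \<mu>))) = F (snd (x, \<mu>)) + (U (x, \<mu>) + R (x, \<mu>))"
    using AE_DU_fin AE_space
  proof eventually_elim
    case (elim x)
    then have x: "x \<in> half_plane"
      by simp
    show ?case
      using compensated_predictable(1)[OF DU_measurable[OF x] predictable_DU[OF x] elim(1)]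
        U_compensated(1) AE_no_point[OF x] AE_space
    proof eventually_elim
      case (elim \<mu>)
      then have \<mu>: "\<mu> \<in> counting_measures"
        by simp
      have sp: "x \<in> space \<mu>"
        using x \<mu> by (simp add: counting_measures_space)
      let ?V = "\<lambda>y. U (y, add_point \<mu> x)"
      have V: "?V y = U (y, \<mu>) + DU x (y, \<mu>)" for y
        by (simp add: DU_def)
      have i: "integrable \<mu> ?V" "integrable hpl ?V"
        unfolding V using elim by auto
      have "F (add_point \<mu> x) = (\<integral>y. ?V y \<partial>add_atom \<mu> x) - (\<integral>y. ?V y \<partial>hpl)"
        using elim by (simp add: F_def compensated_def add_point_def)
      also have "\<dots> = (\<integral>y. ?V y \<partial>\<mu>) + ?V x - (\<integral>y. ?V y \<partial>hpl)"
        by (simp add: integral_add_atom(2)[OF i(1) sp])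
      also have "?V x = U (x, \<mu>)"
        using \<mu> by (simp add: U_add_point)
      also have "(\<integral>y. ?V y \<partial>\<mu>) = (\<integral>y. U (y, \<mu>) \<partial>\<mu>) + (\<integral>y. DU x (y, \<mu>) \<partial>\<mu>)"
        unfolding V using elim by simp
      also have "(\<integral>y. ?V y \<partial>hpl) = (\<integral>y. U (y, \<mu>) \<partial>hpl) + (\<integral>y. DU x (y, \<mu>) \<partial>hpl)"
        unfolding V using elim by simp
      finally show ?case
        by (simp add: F_def R_def compensated_def)
    qed
  qed
qed

text \<open>With \<open>below\<close> inside, the product is the compensated integral of a
  predictable integrand and is therefore centred. Almost every x is needed because only there is
  \<open>DU x\<close> known to be absolutely integrable.\<close>

lemma AE_R_mean_zero: "AE x in hpl. (\<integral>\<mu>. below (x, \<mu>) * R (x, \<mu>) \<partial>P) = 0"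
  using AE_DU_fin AE_space
proof eventually_elim
  case (elim x)
  then have x: "x \<in> half_plane"
    by simp
  have "(\<integral>\<^sup>+\<mu>. \<integral>\<^sup>+y. ennreal \<bar>below (x, snd (y, \<mu>)) * DU x (y, \<mu>)\<bar> \<partial>hpl \<partial>P) \<le> (\<integral>\<^sup>+\<mu>. \<integral>\<^sup>+y. ennreal \<bar>DU x (y, \<mu>)\<bar> \<partial>hpl \<partial>P)"
    using below_01[of "(x, _)"] by (intro nn_integral_mono ennreal_leI) (auto simp: abs_mult below_def indicator_def)
  also note elim(1)
  finally show ?case
    using compensated_predictable(3)[OF below_DU_measurable[OF x] predictable_below_DU[OF x]]
    by (simp add: compensated_below)
qed

text \<open>Squaring leaves the indicator unchanged, so for almost every x the second moment
  inequality applies to \<open>below\<close> times \<open>R\<close> as one compensated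
  integral.\<close>

lemma nn_integral_U_R2: "(\<integral>\<^sup>+p. ennreal (\<bar>U p\<bar> * (R p)\<^sup>2) \<partial>(hpl \<Otimes>\<^sub>M P)) \<le> interaction 1 2"
proof -
  have "(\<integral>\<^sup>+p. ennreal (\<bar>U p\<bar> * (R p)\<^sup>2) \<partial>(hpl \<Otimes>\<^sub>M P)) = (\<integral>\<^sup>+x. \<integral>\<^sup>+\<mu>. ennreal (\<bar>U (x, \<mu>)\<bar> * (R (x, \<mu>))\<^sup>2) \<partial>P \<partial>hpl)"
    by (rule nn_integral_fst[symmetric]) measurable
  also have "\<dots> \<le> interaction 1 2"
    unfolding interaction_eq[OF zero_less_numeral]
  proof (rule nn_integral_mono_AE)
    show "AE x in hpl. (\<integral>\<^sup>+\<mu>. ennreal (\<bar>U (x, \<mu>)\<bar> * (R (x, \<mu>))\<^sup>2) \<partial>P) \<le> ennreal (\<bar>u (fst x)\<bar> ^ 1) *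
      (\<integral>\<^sup>+\<mu>. \<integral>\<^sup>+y. ennreal (\<bar>below (x, \<mu>) * DU x (y, \<mu>)\<bar>\<^sup>2) \<partial>hpl \<partial>P)"
      using AE_DU_fin AE_space
    proof eventually_elim
      case (elim x)
      then have x: "x \<in> half_plane"
        by simp
      then have [measurable]: "x \<in> space hp_borel"
        by simp
      have "(\<integral>\<^sup>+\<mu>. \<integral>\<^sup>+y. ennreal \<bar>below (x, snd (y, \<mu>)) * DU x (y, \<mu>)\<bar> \<partial>hpl \<partial>P) \<le> (\<integral>\<^sup>+\<mu>. \<integral>\<^sup>+y. ennreal \<bar>DU x (y, \<mu>)\<bar> \<partial>hpl \<partial>P)"
        by (intro nn_integral_mono ennreal_leI) (auto simp: abs_mult below_def indicator_def)
      also note elim(1)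
      finally have fin: "(\<integral>\<^sup>+\<mu>. \<integral>\<^sup>+y. ennreal \<bar>below (x, snd (y, \<mu>)) * DU x (y, \<mu>)\<bar> \<partial>hpl \<partial>P) < \<infinity>" .
      have "(\<integral>\<^sup>+\<mu>. ennreal (\<bar>U (x, \<mu>)\<bar> * (R (x, \<mu>))\<^sup>2) \<partial>P)
        = (\<integral>\<^sup>+\<mu>. ennreal \<bar>u (fst x)\<bar> * ennreal ((below (x, \<mu>) * R (x, \<mu>))\<^sup>2) \<partial>P)"
        by (intro nn_integral_cong) (auto simp: ennreal_mult[symmetric] U_def below_def indicator_def)
      also have "\<dots> = ennreal \<bar>u (fst x)\<bar> * (\<integral>\<^sup>+\<mu>. ennreal ((below (x, \<mu>) * R (x, \<mu>))\<^sup>2) \<partial>P)"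
        by (rule nn_integral_cmult) measurable
      also have "\<dots> \<le> ennreal \<bar>u (fst x)\<bar> * (\<integral>\<^sup>+\<mu>. \<integral>\<^sup>+y. ennreal ((below (x, \<mu>) * DU x (y, \<mu>))\<^sup>2) \<partial>hpl \<partial>P)"
        using compensated_square_le[OF below_DU_measurable[OF x] predictable_below_DU[OF x] fin]
        by (intro mult_left_mono) (simp_all add: compensated_below)
      finally show ?case
        by simp
    qed
  qed
  finally show ?thesis .
qed

theorem stein_equation_bound:
  fixes f f' f'' :: "real \<Rightarrow> real"
  assumes f: "\<And>x. (f has_real_derivative f' x) (at x)" and f': "\<And>x. (f' has_real_derivative f'' x) (at x)"
    and f_le: "\<And>x. \<bar>f x\<bar> \<le> 1" and f'_le: "\<And>x. \<bar>f' x\<bar> \<le> c" and f''_le: "\<And>x. \<bar>f'' x\<bar> \<le> 2"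
  shows "ennreal \<bar>\<integral>\<mu>. f' (F \<mu>) - F \<mu> * f (F \<mu>) \<partial>P\<bar> \<le>
      ennreal c * (\<integral>\<^sup>+\<mu>. ennreal \<bar>1 - (\<integral>t. \<bar>u t\<bar>\<^sup>2 * lam t \<mu> \<partial>lborel)\<bar> \<partial>P)
    + (\<integral>\<^sup>+\<mu>. (\<integral>\<^sup>+t. ennreal (\<bar>u t\<bar> ^ 3 * lam t \<mu>) \<partial>lborel) \<partial>P)
    + ennreal (2 * c) * interaction 1 1 + interaction 1 2"
    (is "?L \<le> ?A + ?B + ?C + ?D")
\<comment> \<open>An infinite term on the right leaves nothing to prove. Otherwise finiteness of
  these three terms supplies the integrability of the cube of \<open>U\<close>, of
  \<open>U * R * f'\<close> and of \<open>\<bar>U\<bar> * R\<^sup>2\<close>.\<close>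
proof (cases "?B = \<infinity> \<or> ?C = \<infinity> \<or> ?D = \<infinity>")
  case True
  then show ?thesis
    by auto
next
  case False
  then have fin: "?B < \<infinity>" "?C < \<infinity>" "?D < \<infinity>"
    by (auto simp: less_top)
  have c0: "0 \<le> c"
    using f'_le[of 0] by linarith
  let ?HP = "hpl \<Otimes>\<^sub>M P"
  have [measurable]: "f \<in> borel_measurable borel" "f' \<in> borel_measurable borel"
    using f f' by (auto intro!: borel_measurable_continuous_onI DERIV_continuous_on[of UNIV]
        intro: has_field_derivative_at_within)
  define \<Delta> where "\<Delta> p = f (F (add_point (snd p) (fst p))) - f (F (snd p))" for p
  have \<Delta>m [measurable]: "\<Delta> \<in> borel_measurable ?HP"
    unfolding \<Delta>_def[abs_def] by measurable
  have iUf: "integrable ?HP (\<lambda>p. U p * f (F (snd p)))"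
    by (rule Bochner_Integration.integrable_bound[OF integrable_U])
      (auto simp: abs_mult intro!: mult_left_le f_le)
  have iUf': "integrable ?HP (\<lambda>p. U p * f (F (add_point (snd p) (fst p))))"
    by (rule Bochner_Integration.integrable_bound[OF integrable_U])
      (auto simp: abs_mult intro!: mult_left_le f_le)
  have iU\<Delta>: "integrable ?HP (\<lambda>p. U p * \<Delta> p)"
    using Bochner_Integration.integrable_diff[OF iUf' iUf] by (simp add: \<Delta>_def right_diff_distrib)
  \<comment> \<open>The Mecke formula moves the integral against the measure to the enlarged
    measure, where \<open>U\<close> itself is unchanged. Because \<open>f\<close> is bounded,
    integrability of \<open>U\<close> is enough here.\<close>
  have parts: "(\<integral>\<mu>. F \<mu> * f (F \<mu>) \<partial>P) = (\<integral>p. U p * \<Delta> p \<partial>?HP)"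
    and iFf: "integrable P (\<lambda>\<mu>. F \<mu> * f (F \<mu>))"
  proof -
    let ?h = "\<lambda>p. U p * f (F (snd p))"
    have hm: "?h \<in> borel_measurable (hp_borel \<Otimes>\<^sub>M CM)"
      by measurable
    have "(\<integral>\<^sup>+x. \<integral>\<^sup>+\<mu>. ennreal \<bar>?h (x, add_point \<mu> x)\<bar> \<partial>P \<partial>hpl) \<le> (\<integral>\<^sup>+x. \<integral>\<^sup>+\<mu>. ennreal \<bar>U (x, \<mu>)\<bar> \<partial>P \<partial>hpl)"
      by (intro nn_integral_mono ennreal_leI) (auto simp: abs_mult U_add_point intro!: mult_left_le f_le)
    also have "\<dots> = (\<integral>\<^sup>+\<mu>. \<integral>\<^sup>+x. ennreal \<bar>U (x, \<mu>)\<bar> \<partial>hpl \<partial>P)"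
      by (rule HP.Fubini'[symmetric]) measurable
    also note U_fin
    finally have "(\<integral>\<^sup>+x. \<integral>\<^sup>+\<mu>. ennreal \<bar>?h (x, add_point \<mu> x)\<bar> \<partial>P \<partial>hpl) < \<infinity>" .
    note M = mecke_real[OF hm this]
    have i2: "integrable P (\<lambda>\<mu>. \<integral>x. ?h (x, \<mu>) \<partial>hpl)"
      using HP.integrable_snd[of "\<lambda>x \<mu>. ?h (x, \<mu>)"] iUf by (simp add: split_beta')
    have e: "F \<mu> * f (F \<mu>) = (\<integral>x. ?h (x, \<mu>) \<partial>\<mu>) - (\<integral>x. ?h (x, \<mu>) \<partial>hpl)" for \<mu>
      by (simp add: F_def compensated_def left_diff_distrib)
    show "integrable P (\<lambda>\<mu>. F \<mu> * f (F \<mu>))"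
      unfolding e using M(2) i2 by (rule Bochner_Integration.integrable_diff)
    have "(\<integral>\<mu>. F \<mu> * f (F \<mu>) \<partial>P) = (\<integral>\<mu>. (\<integral>x. ?h (x, \<mu>) \<partial>\<mu>) \<partial>P) - (\<integral>\<mu>. (\<integral>x. ?h (x, \<mu>) \<partial>hpl) \<partial>P)"
      unfolding e using M(2) i2 by (rule Bochner_Integration.integral_diff)
    also have "(\<integral>\<mu>. (\<integral>x. ?h (x, \<mu>) \<partial>\<mu>) \<partial>P) = (\<integral>p. U p * f (F (add_point (snd p) (fst p))) \<partial>?HP)"
      unfolding M(4) by (intro Bochner_Integration.integral_cong) (auto simp: space_pair_measure U_add_point)
    also have "(\<integral>\<mu>. (\<integral>x. ?h (x, \<mu>) \<partial>hpl) \<partial>P) = (\<integral>p. U p * f (F (snd p)) \<partial>?HP)"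
      using HP.integral_snd[of "\<lambda>x \<mu>. ?h (x, \<mu>)"] iUf by (simp add: split_beta')
    also have "(\<integral>p. U p * f (F (add_point (snd p) (fst p))) \<partial>?HP) - (\<integral>p. U p * f (F (snd p)) \<partial>?HP)
      = (\<integral>p. U p * \<Delta> p \<partial>?HP)"
      using iUf iUf' by (subst Bochner_Integration.integral_diff[symmetric]) (auto simp: \<Delta>_def right_diff_distrib)
    finally show "(\<integral>\<mu>. F \<mu> * f (F \<mu>) \<partial>P) = (\<integral>p. U p * \<Delta> p \<partial>?HP)" .
  qed
  have if': "integrable P (\<lambda>\<mu>. f' (F \<mu>))"
    by (rule integrable_const_bound[of _ c]) (auto simp: f'_le)
  have iU2f': "integrable ?HP (\<lambda>p. (U p)\<^sup>2 * f' (F (snd p)))"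
    by (rule Bochner_Integration.integrable_bound[OF integrable_mult_right[OF integrable_U2, of c]])
      (auto simp: abs_mult c0 mult.commute[of c] intro!: mult_left_mono f'_le)
  have fin11: "ennreal (2 * c) * interaction 1 1 < \<infinity>"
    using fin by simp
  have URbound: "(\<integral>\<^sup>+p. ennreal \<bar>U p * R p * f' (F (snd p))\<bar> \<partial>?HP) \<le> ?C"
  proof -
    have "(\<integral>\<^sup>+p. ennreal \<bar>U p * R p * f' (F (snd p))\<bar> \<partial>?HP) \<le> (\<integral>\<^sup>+p. ennreal c * ennreal (\<bar>U p\<bar> ^ 1 * \<bar>R p\<bar>) \<partial>?HP)"
      by (intro nn_integral_mono)
        (auto simp: abs_mult c0 ennreal_mult[symmetric] mult.commute[of c] intro!: ennreal_leI mult_left_mono f'_le)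
    also have "\<dots> = ennreal c * (\<integral>\<^sup>+p. ennreal (\<bar>U p\<bar> ^ 1 * \<bar>R p\<bar>) \<partial>?HP)"
      by (rule nn_integral_cmult) measurable
    also have "\<dots> \<le> ennreal c * (2 * interaction 1 1)"
      using nn_integral_U_R[of 1] by (intro mult_left_mono) auto
    also have "\<dots> = ?C"
      using c0 by (simp add: ennreal_mult mult_ac)
    finally show ?thesis .
  qed
  have iUR: "integrable ?HP (\<lambda>p. U p * R p * f' (F (snd p)))"
    unfolding integrable_iff_bounded using URbound fin11 by (auto intro: le_less_trans)
  \<comment> \<open>Up to a null set, \<open>W\<close> is \<open>U\<close> times the second order
    Taylor remainder of \<open>f\<close> at \<open>F\<close> for the increment
    \<open>U + R\<close>.\<close>
  define W where "W p = U p * \<Delta> p - (U p)\<^sup>2 * f' (F (snd p)) - U p * R p * f' (F (snd p))" for p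
  have iW: "integrable ?HP W"
    unfolding W_def[abs_def] by (intro Bochner_Integration.integrable_diff iU\<Delta> iU2f' iUR)
  \<comment> \<open>The bound 2 on \<open>f''\<close> cancels the usual 1/2. Since
    \<open>f''\<close> may be discontinuous, the remainder is controlled along the segment through
    the Lipschitz bound of \<open>f'\<close>, by two monotone auxiliary functions.\<close>
  have taylor: "\<bar>f (a + d) - f a - f' a * d\<bar> \<le> d\<^sup>2" for a d
  proof (cases "d = 0")
    case False
    have f'_lip: "\<bar>f' x - f' y\<bar> \<le> 2 * \<bar>x - y\<bar>" for x y
      using field_differentiable_bound[of UNIV f' f'' 2 x y] f' f''_le
      by (auto intro: has_field_derivative_at_within)
    define g where "g s = f (a + s * d) - f' a * (s * d) - s\<^sup>2 * d\<^sup>2" for s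
    define h where "h s = f (a + s * d) - f' a * (s * d) + s\<^sup>2 * d\<^sup>2" for s
    have g: "(g has_real_derivative (f' (a + s * d) - f' a) * d - 2 * s * d\<^sup>2) (at s)" for s
      unfolding g_def by (auto intro!: derivative_eq_intros DERIV_chain2[OF f] simp: algebra_simps)
    have h: "(h has_real_derivative (f' (a + s * d) - f' a) * d + 2 * s * d\<^sup>2) (at s)" for s
      unfolding h_def by (auto intro!: derivative_eq_intros DERIV_chain2[OF f] simp: algebra_simps)
    have b: "\<bar>(f' (a + s * d) - f' a) * d\<bar> \<le> 2 * s * d\<^sup>2" if "0 \<le> s" for s
      using mult_right_mono[OF f'_lip[of "a + s * d" a], of "\<bar>d\<bar>"] that
      by (simp add: abs_mult power2_eq_square mult.assoc)
    have "g 1 \<le> g 0"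
    proof (rule DERIV_nonpos_imp_nonincreasing[of 0 1 g])
      show "\<exists>y. (g has_real_derivative y) (at s) \<and> y \<le> 0" if "0 \<le> s" for s
        using g[of s] b[OF that] by (intro exI conjI) auto
    qed simp
    moreover have "h 0 \<le> h 1"
    proof (rule DERIV_nonneg_imp_nondecreasing[of 0 1 h])
      show "\<exists>y. (h has_real_derivative y) (at s) \<and> y \<ge> 0" if "0 \<le> s" for s
        using h[of s] b[OF that] by (intro exI conjI) (auto simp: abs_le_iff)
    qed simp
    ultimately show ?thesis
      by (simp add: g_def h_def abs_le_iff)
  qed simp
  have W_le: "AE p in ?HP. \<bar>W p\<bar> \<le> \<bar>U p\<bar> * (U p + R p)\<^sup>2"
    using shift_F
  proof eventually_elim
    case (elim p)
    have "W p = U p * (f (F (snd p) + (U p + R p)) - f (F (snd p)) - f' (F (snd p)) * (U p + R p))"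
      by (simp add: W_def \<Delta>_def elim power2_eq_square algebra_simps)
    then show ?case
      using taylor[of "F (snd p)" "U p + R p"] by (simp add: abs_mult mult_left_mono)
  qed
  have iU3: "integrable ?HP (\<lambda>p. \<bar>U p\<bar> ^ 3)"
    unfolding integrable_iff_bounded using nn_integral_U_power_P[of 3] fin(1) by simp
  \<comment> \<open>Finiteness of \<open>interaction 2 1\<close> makes the mixed term integrable by
    itself, so that Fubini's theorem can show that it vanishes.\<close>
  have iUUR: "integrable ?HP (\<lambda>p. U p * \<bar>U p\<bar> * R p)"
  proof -
    have "(\<integral>\<^sup>+p. ennreal (norm (U p * \<bar>U p\<bar> * R p)) \<partial>?HP) = (\<integral>\<^sup>+p. ennreal (\<bar>U p\<bar> ^ 2 * \<bar>R p\<bar>) \<partial>?HP)"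
      by (simp add: abs_mult power2_eq_square)
    also have "\<dots> \<le> 2 * interaction 2 1"
      by (rule nn_integral_U_R) simp
    also have "\<dots> < \<infinity>"
      using D3 by (simp add: ennreal_mult_less_top)
    finally show ?thesis
      unfolding integrable_iff_bounded by simp
  qed
  have iUR2: "integrable ?HP (\<lambda>p. \<bar>U p\<bar> * (R p)\<^sup>2)"
    unfolding integrable_iff_bounded using nn_integral_U_R2 fin(3) by (auto simp: abs_mult intro: le_less_trans)
  \<comment> \<open>\<open>U * \<bar>U\<bar>\<close> is a function of time alone times
    \<open>below\<close>. Hence for almost every x the inner integral is a multiple of the mean of
    \<open>below\<close> times \<open>R\<close>.\<close>
  have UUR0: "(\<integral>p. U p * \<bar>U p\<bar> * R p \<partial>?HP) = 0"
  proof -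
    have "(\<integral>p. U p * \<bar>U p\<bar> * R p \<partial>?HP) = (\<integral>x. (\<integral>\<mu>. U (x, \<mu>) * \<bar>U (x, \<mu>)\<bar> * R (x, \<mu>) \<partial>P) \<partial>hpl)"
      by (rule HP.integral_fst'[OF iUUR, symmetric])
    also have "\<dots> = 0"
    proof (rule integral_eq_zero_AE)
      show "AE x in hpl. (\<integral>\<mu>. U (x, \<mu>) * \<bar>U (x, \<mu>)\<bar> * R (x, \<mu>) \<partial>P) = 0"
        using AE_R_mean_zero
      proof eventually_elim
        case (elim x)
        have "U (x, \<mu>) * \<bar>U (x, \<mu>)\<bar> * R (x, \<mu>) = u (fst x) * \<bar>u (fst x)\<bar> * (below (x, \<mu>) * R (x, \<mu>))" for \<mu>
          by (simp add: U_def below_def indicator_def)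
        then show ?case
          by (simp only: elim integral_mult_right_zero mult_zero_right)
      qed
    qed
    finally show ?thesis .
  qed
  have rem: "ennreal \<bar>\<integral>p. W p \<partial>?HP\<bar> \<le> ?B + ?D"
  proof -
    \<comment> \<open>Expanding the square before integrating keeps the sign of the mixed term, and
      it is this sign that lets it cancel.\<close>
    have sq: "\<bar>U p\<bar> * (U p + R p)\<^sup>2 = \<bar>U p\<bar> ^ 3 + 2 * (U p * \<bar>U p\<bar> * R p) + \<bar>U p\<bar> * (R p)\<^sup>2" for p
      by (simp add: power2_eq_square power3_eq_cube algebra_simps)
    have isq: "integrable ?HP (\<lambda>p. \<bar>U p\<bar> * (U p + R p)\<^sup>2)"
      unfolding sq using iU3 iUUR iUR2 by simp
    have "\<bar>\<integral>p. W p \<partial>?HP\<bar> \<le> (\<integral>p. \<bar>U p\<bar> * (U p + R p)\<^sup>2 \<partial>?HP)"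
      using W_le by (intro order_trans[OF integral_abs_bound] integral_mono_AE integrable_abs iW isq) auto
    also have "\<dots> = (\<integral>p. \<bar>U p\<bar> ^ 3 \<partial>?HP) + (\<integral>p. \<bar>U p\<bar> * (R p)\<^sup>2 \<partial>?HP)"
      unfolding sq using iU3 iUUR iUR2 UUR0 by simp
    finally have "ennreal \<bar>\<integral>p. W p \<partial>?HP\<bar> \<le> ennreal (\<integral>p. \<bar>U p\<bar> ^ 3 \<partial>?HP) + ennreal (\<integral>p. \<bar>U p\<bar> * (R p)\<^sup>2 \<partial>?HP)"
      by (simp add: ennreal_leI flip: ennreal_plus)
    also have "ennreal (\<integral>p. \<bar>U p\<bar> ^ 3 \<partial>?HP) = ?B"
      using nn_integral_eq_integral[OF iU3] nn_integral_U_power_P[of 3] by simp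
    also have "ennreal (\<integral>p. \<bar>U p\<bar> * (R p)\<^sup>2 \<partial>?HP) \<le> ?D"
      using nn_integral_eq_integral[OF iUR2] nn_integral_U_R2 by simp
    finally show ?thesis
      by simp
  qed
  have first: "ennreal \<bar>(\<integral>\<mu>. f' (F \<mu>) \<partial>P) - (\<integral>p. (U p)\<^sup>2 * f' (F (snd p)) \<partial>?HP)\<bar> \<le> ?A"
  proof -
    have i2: "integrable P (\<lambda>\<mu>. \<integral>x. (U (x, \<mu>))\<^sup>2 * f' (F \<mu>) \<partial>hpl)"
      using HP.integrable_snd[of "\<lambda>x \<mu>. (U (x, \<mu>))\<^sup>2 * f' (F \<mu>)"] iU2f' by (simp add: split_beta')
    have "(\<integral>p. (U p)\<^sup>2 * f' (F (snd p)) \<partial>?HP) = (\<integral>\<mu>. (\<integral>x. (U (x, \<mu>))\<^sup>2 * f' (F \<mu>) \<partial>hpl) \<partial>P)"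
      using HP.integral_snd[of "\<lambda>x \<mu>. (U (x, \<mu>))\<^sup>2 * f' (F \<mu>)"] iU2f' by (simp add: split_beta')
    then have "(\<integral>\<mu>. f' (F \<mu>) \<partial>P) - (\<integral>p. (U p)\<^sup>2 * f' (F (snd p)) \<partial>?HP)
      = (\<integral>\<mu>. f' (F \<mu>) - (\<integral>x. (U (x, \<mu>))\<^sup>2 * f' (F \<mu>) \<partial>hpl) \<partial>P)"
      using if' i2 by simp
    also have "\<dots> = (\<integral>\<mu>. f' (F \<mu>) * (1 - (\<integral>t. \<bar>u t\<bar>\<^sup>2 * lam t \<mu> \<partial>lborel)) \<partial>P)"
    proof (rule Bochner_Integration.integral_cong[OF refl])
      fix \<mu> assume "\<mu> \<in> space P"
      then have "(\<integral>x. (U (x, \<mu>))\<^sup>2 \<partial>hpl) = (\<integral>t. \<bar>u t\<bar>\<^sup>2 * lam t \<mu> \<partial>lborel)"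
        by (intro integral_U(2)) simp
      then have "(\<integral>x. (U (x, \<mu>))\<^sup>2 * f' (F \<mu>) \<partial>hpl) = (\<integral>t. \<bar>u t\<bar>\<^sup>2 * lam t \<mu> \<partial>lborel) * f' (F \<mu>)"
        by (simp only: integral_mult_left_zero)
      then show "f' (F \<mu>) - (\<integral>x. (U (x, \<mu>))\<^sup>2 * f' (F \<mu>) \<partial>hpl)
        = f' (F \<mu>) * (1 - (\<integral>t. \<bar>u t\<bar>\<^sup>2 * lam t \<mu> \<partial>lborel))"
        by (simp only: right_diff_distrib mult_1_right mult.commute)
    qed
    finally have "ennreal \<bar>(\<integral>\<mu>. f' (F \<mu>) \<partial>P) - (\<integral>p. (U p)\<^sup>2 * f' (F (snd p)) \<partial>?HP)\<bar>
      = ennreal (norm (\<integral>\<mu>. f' (F \<mu>) * (1 - (\<integral>t. \<bar>u t\<bar>\<^sup>2 * lam t \<mu> \<partial>lborel)) \<partial>P))"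
      by simp
    also have "\<dots> \<le> (\<integral>\<^sup>+\<mu>. ennreal (norm (f' (F \<mu>) * (1 - (\<integral>t. \<bar>u t\<bar>\<^sup>2 * lam t \<mu> \<partial>lborel)))) \<partial>P)"
      unfolding real_norm_def by (rule abs_integral_le_nn_integral)
    also have "\<dots> \<le> (\<integral>\<^sup>+\<mu>. ennreal c * ennreal \<bar>1 - (\<integral>t. \<bar>u t\<bar>\<^sup>2 * lam t \<mu> \<partial>lborel)\<bar> \<partial>P)"
      by (intro nn_integral_mono)
        (auto simp: abs_mult c0 ennreal_mult[symmetric] intro!: ennreal_leI mult_right_mono f'_le)
    also have "\<dots> = ?A"
      by (rule nn_integral_cmult) measurable
    finally show ?thesis .
  qed
  have second: "ennreal \<bar>\<integral>p. U p * R p * f' (F (snd p)) \<partial>?HP\<bar> \<le> ?C"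
    using integral_norm_bound_ennreal[OF iUR] URbound by (auto intro: order_trans)
  have "(\<integral>\<mu>. f' (F \<mu>) - F \<mu> * f (F \<mu>) \<partial>P) = ((\<integral>\<mu>. f' (F \<mu>) \<partial>P) - (\<integral>p. (U p)\<^sup>2 * f' (F (snd p)) \<partial>?HP))
      - (\<integral>p. U p * R p * f' (F (snd p)) \<partial>?HP) - (\<integral>p. W p \<partial>?HP)"
    unfolding W_def using if' iFf iU\<Delta> iU2f' iUR by (simp add: parts)
  then have "?L \<le> ennreal (\<bar>(\<integral>\<mu>. f' (F \<mu>) \<partial>P) - (\<integral>p. (U p)\<^sup>2 * f' (F (snd p)) \<partial>?HP)\<bar>
      + \<bar>\<integral>p. U p * R p * f' (F (snd p)) \<partial>?HP\<bar> + \<bar>\<integral>p. W p \<partial>?HP\<bar>)"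
    by (intro ennreal_leI) linarith
  also have "\<dots> = ennreal \<bar>(\<integral>\<mu>. f' (F \<mu>) \<partial>P) - (\<integral>p. (U p)\<^sup>2 * f' (F (snd p)) \<partial>?HP)\<bar>
      + ennreal \<bar>\<integral>p. U p * R p * f' (F (snd p)) \<partial>?HP\<bar> + ennreal \<bar>\<integral>p. W p \<partial>?HP\<bar>"
    by simp
  also have "\<dots> \<le> ?A + ?C + (?B + ?D)"
    by (intro add_mono first second rem)
  finally show ?thesis
    by (simp add: ac_simps)
qed

end

section \<open>Transfer to a Poisson process on a probability space\<close>

lemma emeasure_CM_measurable:
  assumes A: "A \<in> sets hp_borel" shows "(\<lambda>\<mu>. emeasure \<mu> A) \<in> borel_measurable CM"
proof -
  have "A \<times> space CM \<in> sets (hp_borel \<Otimes>\<^sub>M CM)"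
    using A sets.top by (rule pair_measureI)
  from emeasure_kernel_measurable[OF this measurable_ident]
  show ?thesis
    by (rule measurable_cong[THEN iffD1, rotated]) simp
qed

lemma cell_nonempty: assumes "i \<in> idx n" shows "cell n i \<noteq> {}"
proof -
  have "(of_int (fst i) / 2 ^ n, of_int (snd i) / 2 ^ n) \<in> cell n i"
    using assms by (auto simp: cell_def grid_def mem_half_plane idx_def)
  then show ?thesis
    by blast
qed

text \<open>Independence of the counts is indexed by sets and the count maps by cell indices;
  injectivity translates between the two.\<close>

lemma inj_on_cell: "inj_on (cell n) (idx n)"
  using cell_nonempty disjoint_cell by (intro inj_onI) (metis Int_absorb)

lemma poisson_process_law:
  assumes M: "prob_space M" and N: "poisson_process M half_plane_lebesgue N"
  shows "N \<in> M \<rightarrow>\<^sub>M CM" and "poisson_law (distr M CM N)"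
proof -
  interpret M: prob_space M by (rule M)
  have Nm: "N \<omega> \<in> counting_measures" if "\<omega> \<in> space M" for \<omega>
    using N measurable_space[of N M counting_space \<omega>] that by (simp add: poisson_process_def space_counting_space)
  have prob: "M.prob {\<omega> \<in> space M. emeasure (N \<omega>) A = of_nat k} = exp (- measure hpl A) * measure hpl A ^ k / fact k"
    if "A \<in> sets hp_borel" "emeasure hpl A < \<infinity>" for A k
    using N that by (simp add: poisson_process_def)
  have indep: "M.indep_vars (\<lambda>_. borel) (\<lambda>A \<omega>. emeasure (N \<omega>) A) F"
    if "finite F" "F \<subseteq> sets hp_borel" "disjoint F" for F
    using N that by (simp add: poisson_process_def)
  \<comment> \<open>Measurability of a single count is part of the independence of a one-element
    family.\<close>
  have meas: "(\<lambda>\<omega>. emeasure (N \<omega>) A) \<in> borel_measurable M" if "A \<in> sets hp_borel" for A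
    using indep[of "{A}"] that by (simp add: M.indep_vars_def)
  show N_CM: "N \<in> M \<rightarrow>\<^sub>M CM"
    by (rule measurable_CM[OF Nm meas]) auto
  let ?P = "distr M CM N"
  interpret P: prob_space ?P
    by (rule M.prob_space_distr[OF N_CM])
  show "poisson_law ?P"
  proof
    show "sets ?P = sets CM"
      by simp
    fix A assume A: "A \<in> sets hp_borel" "emeasure hpl A = 0"
    \<comment> \<open>A Poisson variable of mean 0 vanishes with probability exp 0 = 1.\<close>
    have "M.prob {\<omega> \<in> space M. emeasure (N \<omega>) A = 0} = 1"
      using prob[OF A(1), of 0] A(2) by (simp add: measure_def)
    then have "AE \<omega> in M. \<omega> \<in> {\<omega> \<in> space M. emeasure (N \<omega>) A = 0}"
      using meas[OF A(1)] by (subst M.AE_in_set_eq_1) auto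
    then have "AE \<omega> in M. emeasure (N \<omega>) A = 0"
      by eventually_elim simp
    moreover have "{\<mu> \<in> space CM. emeasure \<mu> A = 0} \<in> sets CM"
      using emeasure_CM_measurable[OF A(1)] by measurable
    ultimately show "AE \<mu> in ?P. emeasure \<mu> A = 0"
      by (subst AE_distr_iff[OF N_CM])
  next
    fix n k
    \<comment> \<open>The value prescribed for a cell, looked up through its index and written as an
      event for the independence formula.\<close>
    define g where "g C = {of_nat (k (inv_into (idx n) (cell n) C)) :: ennreal}" for C
    have g: "g (cell n i) = {of_nat (k i)}" if "i \<in> idx n" for i
      using that by (simp add: g_def inj_on_cell)
    have "measure ?P (counts_are n k) = M.prob (N -` counts_are n k \<inter> space M)"
      by (rule measure_distr[OF N_CM]) simp
    also have "\<dots> = (\<Prod>i\<in>idx n. M.prob {\<omega> \<in> space M. emeasure (N \<omega>) (cell n i) = of_nat (k i)})"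
    proof (cases "idx n = {}")
      \<comment> \<open>Level 0 has no cells, while the independence formula requires a nonempty
        family; here both sides are 1.\<close>
      case True
      then have "N -` counts_are n k \<inter> space M = space M"
        using Nm by (auto simp: counts_are_def)
      then show ?thesis
        using True by (simp add: M.prob_space)
    next
      case False
      have "disjoint (cell n ` idx n)"
        unfolding disjoint_def by (auto simp: cell_def)
      then have "M.indep_vars (\<lambda>_. borel) (\<lambda>A \<omega>. emeasure (N \<omega>) A) (cell n ` idx n)"
        by (intro indep) auto
      moreover have "g C \<in> sets borel" for C
        by (simp add: g_def)
      ultimately have "M.prob (\<Inter>C\<in>cell n ` idx n. (\<lambda>\<omega>. emeasure (N \<omega>) C) -` g C \<inter> space M)
        = (\<Prod>C\<in>cell n ` idx n. M.prob ((\<lambda>\<omega>. emeasure (N \<omega>) C) -` g C \<inter> space M))"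
        using False by (intro M.indep_varsD[of "\<lambda>_. borel"]) auto
      also have "(\<Inter>C\<in>cell n ` idx n. (\<lambda>\<omega>. emeasure (N \<omega>) C) -` g C \<inter> space M) = N -` counts_are n k \<inter> space M"
        using False Nm by (auto simp: g counts_are_def)
      also have "(\<Prod>C\<in>cell n ` idx n. M.prob ((\<lambda>\<omega>. emeasure (N \<omega>) C) -` g C \<inter> space M))
        = (\<Prod>i\<in>idx n. M.prob {\<omega> \<in> space M. emeasure (N \<omega>) (cell n i) = of_nat (k i)})"
        unfolding prod.reindex[OF inj_on_cell] by (intro prod.cong) (auto simp: g intro!: arg_cong[where f = M.prob])
      finally show ?thesis .
    qed
    also have "\<dots> = (\<Prod>i\<in>idx n. exp (- measure hpl (cell n i)) * measure hpl (cell n i) ^ k i / fact (k i))"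
      by (intro prod.cong refl prob) (auto simp: emeasure_hpl_cell)
    finally show "measure ?P (counts_are n k) =
        (\<Prod>i\<in>idx n. exp (- measure hpl (cell n i)) * measure hpl (cell n i) ^ k i / fact (k i))" .
  qed
qed

lemma integral_thinning:
  assumes \<mu>: "\<mu> \<in> counting_measures" and [measurable]: "l \<in> borel_measurable borel" "u \<in> borel_measurable borel"
  shows "(\<integral>t. u t \<partial>thinning l \<mu>) = (\<integral>x. u (fst x) * indicator {0<..l (fst x)} (snd x) \<partial>\<mu> :: real)"
proof -
  note [measurable_cong] = counting_measures_sets[OF \<mu>]
  let ?g = "\<lambda>x. indicator {0<..l (fst x)} (snd x) :: real"
  have [measurable]: "?g \<in> borel_measurable \<mu>"
    unfolding indicator_def greaterThanAtMost_iff by measurable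
  have "thinning l \<mu> = distr (density \<mu> (\<lambda>x. ennreal (?g x))) borel fst"
    unfolding thinning_def split_beta' by (simp add: ennreal_indicator)
  then have "(\<integral>t. u t \<partial>thinning l \<mu>) = (\<integral>x. u (fst x) \<partial>density \<mu> (\<lambda>x. ennreal (?g x)))"
    by (simp only:) (rule integral_distr, measurable)
  also have "\<dots> = (\<integral>x. ?g x *\<^sub>R u (fst x) \<partial>\<mu>)"
    by (intro integral_density AE_I2) (measurable, auto)
  finally show ?thesis
    by (simp add: mult.commute)
qed

text \<open>\<open>g\<close> grows at most linearly, hence is integrable along X, and
  \<open>h - g\<close> is bounded; \<open>h\<close> inherits integrability from these two.\<close>

lemma expectation_close:
  fixes g h :: "real \<Rightarrow> real"
  assumes Q: "prob_space Q" and X: "integrable Q X" and g: "1-lipschitz_on UNIV g"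
    and h: "h \<in> borel_measurable borel" and le: "\<And>x. \<bar>h x - g x\<bar> \<le> e"
  shows "integrable Q (\<lambda>\<omega>. h (X \<omega>))" "\<bar>(\<integral>\<omega>. g (X \<omega>) \<partial>Q) - (\<integral>\<omega>. h (X \<omega>) \<partial>Q)\<bar> \<le> e"
proof -
  interpret Q: prob_space Q by (rule Q)
  have [measurable]: "g \<in> borel_measurable borel" "X \<in> borel_measurable Q"
    using lipschitz_on_continuous_on[OF g] X by (auto intro: borel_measurable_continuous_onI)
  note [measurable] = h
  have "integrable Q (\<lambda>\<omega>. g (X \<omega>))"
  proof (rule Bochner_Integration.integrable_bound)
    show "integrable Q (\<lambda>\<omega>. \<bar>X \<omega>\<bar> + \<bar>g 0\<bar>)"
      using X by simp
    have "\<bar>g x\<bar> \<le> \<bar>x\<bar> + \<bar>g 0\<bar>" for x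
      using lipschitz_onD[OF g, of x 0] by (simp add: dist_real_def)
    then show "AE \<omega> in Q. norm (g (X \<omega>)) \<le> norm (\<bar>X \<omega>\<bar> + \<bar>g 0\<bar>)"
      by simp
  qed measurable
  moreover have d: "integrable Q (\<lambda>\<omega>. h (X \<omega>) - g (X \<omega>))"
    by (rule Q.integrable_const_bound[of _ e]) (auto simp: le)
  ultimately show i: "integrable Q (\<lambda>\<omega>. h (X \<omega>))"
    using Bochner_Integration.integrable_add[of Q "\<lambda>\<omega>. h (X \<omega>) - g (X \<omega>)" "\<lambda>\<omega>. g (X \<omega>)"] by simp
  have "\<bar>(\<integral>\<omega>. g (X \<omega>) \<partial>Q) - (\<integral>\<omega>. h (X \<omega>) \<partial>Q)\<bar> = \<bar>\<integral>\<omega>. h (X \<omega>) - g (X \<omega>) \<partial>Q\<bar>"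
    using i \<open>integrable Q (\<lambda>\<omega>. g (X \<omega>))\<close> by (simp add: abs_minus_commute)
  also have "\<dots> \<le> (\<integral>\<omega>. \<bar>h (X \<omega>) - g (X \<omega>)\<bar> \<partial>Q)"
    by (rule integral_abs_bound)
  also have "\<dots> \<le> (\<integral>\<omega>. e \<partial>Q)"
    using d by (intro integral_mono) (auto simp: le)
  finally show "\<bar>(\<integral>\<omega>. g (X \<omega>) \<partial>Q) - (\<integral>\<omega>. h (X \<omega>) \<partial>Q)\<bar> \<le> e"
    by (simp add: Q.prob_space)
qed

text \<open>Stein's equation is solved for differentiable test functions, so a Lipschitz function is
  first replaced by an average. The replacement costs e / 2 under each of the two laws, and e is
  arbitrary.\<close>

lemma (in stein_bound) wasserstein_F_le:
  assumes M': "prob_space M'" and Z: "distributed M' lborel Z std_normal_density"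
  shows "wasserstein_dist P F M' Z \<le>
      ennreal (sqrt (2 / pi)) * (\<integral>\<^sup>+\<mu>. ennreal \<bar>1 - (\<integral>t. \<bar>u t\<bar>\<^sup>2 * lam t \<mu> \<partial>lborel)\<bar> \<partial>P)
    + (\<integral>\<^sup>+\<mu>. (\<integral>\<^sup>+t. ennreal (\<bar>u t\<bar> ^ 3 * lam t \<mu>) \<partial>lborel) \<partial>P)
    + ennreal (2 * sqrt (2 / pi)) * interaction 1 1 + interaction 1 2"
    (is "_ \<le> ?B")
  unfolding wasserstein_dist_def
proof (rule SUP_least)
  fix g :: "real \<Rightarrow> real" assume "g \<in> {g. 1-lipschitz_on UNIV g}"
  then have g: "1-lipschitz_on UNIV g"
    by simp
  have iZ: "integrable M' Z"
    using distributed_integrable[OF Z, of "\<lambda>x. x"] integrable_std_normal_moment[of 1] by simp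
  show "ennreal \<bar>(\<integral>\<mu>. g (F \<mu>) \<partial>P) - (\<integral>\<omega>. g (Z \<omega>) \<partial>M')\<bar> \<le> ?B"
  proof (rule ennreal_le_epsilon)
    fix e :: real assume e: "0 < e"
    then have e2: "0 < e / 2"
      by simp
    obtain h h' where h: "\<And>x. (h has_real_derivative h' x) (at x)" "\<And>x. \<bar>h' x\<bar> \<le> 1"
      "\<And>x. \<bar>h x - g x\<bar> \<le> e / 2"
      using smooth_lipschitz_approx[OF g e2] by blast
    obtain f f' f'' where f: "\<And>x. (f has_real_derivative f' x) (at x)"
      "\<And>x. (f' has_real_derivative f'' x) (at x)"
      "\<And>x. \<bar>f x\<bar> \<le> 1" "\<And>x. \<bar>f' x\<bar> \<le> sqrt (2 / pi)" "\<And>x. \<bar>f'' x\<bar> \<le> 2"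
      "\<And>x. f' x - x * f x = h x - (\<integral>y. npdf y * h y \<partial>lborel)"
      using stein_solution[OF h(1,2)] by blast
    have [measurable]: "h \<in> borel_measurable borel"
      using h(1) by (auto intro!: borel_measurable_continuous_onI DERIV_continuous_on[of UNIV]
          intro: has_field_derivative_at_within)
    have hF: "integrable P (\<lambda>\<mu>. h (F \<mu>))" "\<bar>(\<integral>\<mu>. g (F \<mu>) \<partial>P) - (\<integral>\<mu>. h (F \<mu>) \<partial>P)\<bar> \<le> e / 2"
      by (rule expectation_close[OF prob_space_axioms integrable_F g _ h(3)], measurable)+
    have hZ: "\<bar>(\<integral>\<omega>. g (Z \<omega>) \<partial>M') - (\<integral>\<omega>. h (Z \<omega>) \<partial>M')\<bar> \<le> e / 2"
      by (rule expectation_close(2)[OF M' iZ g _ h(3)]) measurable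
    have "(\<integral>\<omega>. h (Z \<omega>) \<partial>M') = (\<integral>y. npdf y * h y \<partial>lborel)"
      by (rule distributed_integral[OF Z, symmetric]) auto
    then have "(\<integral>\<mu>. h (F \<mu>) \<partial>P) - (\<integral>\<omega>. h (Z \<omega>) \<partial>M') = (\<integral>\<mu>. f' (F \<mu>) - F \<mu> * f (F \<mu>) \<partial>P)"
      unfolding f(6) using hF(1) by (simp add: prob_space del: space_P)
    then have "\<bar>(\<integral>\<mu>. g (F \<mu>) \<partial>P) - (\<integral>\<omega>. g (Z \<omega>) \<partial>M')\<bar> \<le> \<bar>\<integral>\<mu>. f' (F \<mu>) - F \<mu> * f (F \<mu>) \<partial>P\<bar> + e"
      using hF(2) hZ by linarith
    then have "ennreal \<bar>(\<integral>\<mu>. g (F \<mu>) \<partial>P) - (\<integral>\<omega>. g (Z \<omega>) \<partial>M')\<bar>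
        \<le> ennreal \<bar>\<integral>\<mu>. f' (F \<mu>) - F \<mu> * f (F \<mu>) \<partial>P\<bar> + ennreal e"
      using e by (simp add: ennreal_leI flip: ennreal_plus)
    also have "\<dots> \<le> ?B + ennreal e"
      by (intro add_mono order_refl stein_equation_bound[OF f(1-5)])
    finally show "ennreal \<bar>(\<integral>\<mu>. g (F \<mu>) \<partial>P) - (\<integral>\<omega>. g (Z \<omega>) \<partial>M')\<bar> \<le> ?B + ennreal e" .
  qed
qed

theorem theorem3p1:
  fixes M :: "'a measure" and M' :: "'b measure"
    and Nbar :: "'a \<Rightarrow> (real \<times> real) measure"
    and \<phi> :: "real \<Rightarrow> (real \<times> real) measure \<Rightarrow> real"
    and lam :: "real \<Rightarrow> 'a \<Rightarrow> real"
    and Dlam :: "real \<Rightarrow> real \<Rightarrow> real \<Rightarrow> 'a \<Rightarrow> real"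
    and N :: "'a \<Rightarrow> real measure"
    and u :: "real \<Rightarrow> real" and \<delta> :: "'a \<Rightarrow> real" and Z :: "'b \<Rightarrow> real"
  assumes M: "prob_space M"
    and Nbar: "poisson_process M half_plane_lebesgue Nbar"
    and phi_measurable: "case_prod \<phi> \<in> borel_measurable (borel \<Otimes>\<^sub>M counting_space)"
    and phi_nonneg: "\<And>t \<mu>. \<mu> \<in> counting_measures \<Longrightarrow> \<phi> t \<mu> \<ge> 0"
    and lam: "\<And>t \<omega>. lam t \<omega> = intensity \<phi> t (Nbar \<omega>)"
    and Dlam: "\<And>t z s \<omega>. Dlam t z s \<omega> = difference_operator (t, z) (intensity \<phi> s) (Nbar \<omega>)"
    and lam_locally_integrable:
      "\<And>a b. AE \<omega> in M. (\<integral>\<^sup>+s\<in>{a..b}. ennreal (lam s \<omega>) \<partial>lborel) < \<infinity>"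
    and N: "\<And>\<omega>. N \<omega> = thinning (\<lambda>t. lam t \<omega>) (Nbar \<omega>)"
    and u: "u \<in> borel_measurable borel"
    and u1: "(\<integral>\<^sup>+\<omega>. (\<integral>\<^sup>+t. ennreal (\<bar>u t\<bar> * lam t \<omega>) \<partial>lborel) \<partial>M) < \<infinity>"
    and u2: "(\<integral>\<^sup>+\<omega>. (\<integral>\<^sup>+t. ennreal (\<bar>u t\<bar>\<^sup>2 * lam t \<omega>) \<partial>lborel) \<partial>M) < \<infinity>"
    and D1: "(\<integral>\<^sup>+(t, z). (\<integral>\<^sup>+s\<in>{t<..}. ennreal \<bar>u s\<bar> *
        (\<integral>\<^sup>+\<omega>. ennreal \<bar>Dlam t z s \<omega>\<bar> \<partial>M) \<partial>lborel) \<partial>half_plane_lebesgue) < \<infinity>"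
    and D2: "(\<integral>\<^sup>+(t, z). (\<integral>\<^sup>+s\<in>{t<..}. ennreal (\<bar>u s\<bar>\<^sup>2) *
        (\<integral>\<^sup>+\<omega>. ennreal \<bar>Dlam t z s \<omega>\<bar> \<partial>M) \<partial>lborel) \<partial>half_plane_lebesgue) < \<infinity>"
    and D3: "(\<integral>\<^sup>+(t, z). ennreal (\<bar>u t\<bar>\<^sup>2) * (\<integral>\<^sup>+s\<in>{t<..}. ennreal \<bar>u s\<bar> *
        (\<integral>\<^sup>+\<omega>. ennreal (indicator {0<..lam t \<omega>} z * \<bar>Dlam t z s \<omega>\<bar>) \<partial>M)
        \<partial>lborel) \<partial>half_plane_lebesgue) < \<infinity>"
    and D_locally_integrable:
      "AE (t, z) in half_plane_lebesgue. AE \<omega> in M.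
         locally_integrable_on {t<..} (\<lambda>s. \<bar>Dlam t z s \<omega>\<bar>)"
    and delta: "\<And>\<omega>. \<delta> \<omega> = (\<integral>t. u t \<partial>N \<omega>) - (\<integral>t. u t * lam t \<omega> \<partial>lborel)"
    and M': "prob_space M'"
    and Z: "distributed M' lborel Z std_normal_density"
  shows "wasserstein_dist M \<delta> M' Z \<le>
      ennreal (sqrt (2 / pi)) *
        (\<integral>\<^sup>+\<omega>. ennreal \<bar>1 - (\<integral>t. \<bar>u t\<bar>\<^sup>2 * lam t \<omega> \<partial>lborel)\<bar> \<partial>M)
    + (\<integral>\<^sup>+\<omega>. (\<integral>\<^sup>+t. ennreal (\<bar>u t\<bar> ^ 3 * lam t \<omega>) \<partial>lborel) \<partial>M)
    + ennreal (2 * sqrt (2 / pi)) *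
        (\<integral>\<^sup>+(t, z). ennreal \<bar>u t\<bar> * (\<integral>\<^sup>+s\<in>{t<..}. ennreal \<bar>u s\<bar> *
          (\<integral>\<^sup>+\<omega>. ennreal (indicator {0<..lam t \<omega>} z * \<bar>Dlam t z s \<omega>\<bar>) \<partial>M)
          \<partial>lborel) \<partial>half_plane_lebesgue)
    + (\<integral>\<^sup>+(t, z). ennreal \<bar>u t\<bar> * (\<integral>\<^sup>+s\<in>{t<..}. ennreal (\<bar>u s\<bar>\<^sup>2) *
          (\<integral>\<^sup>+\<omega>. ennreal (indicator {0<..lam t \<omega>} z * \<bar>Dlam t z s \<omega>\<bar>) \<partial>M)
          \<partial>lborel) \<partial>half_plane_lebesgue)"
proof -
  note poisson = poisson_process_law[OF M Nbar]
  note Nbar_CM = poisson(1)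
  let ?P = "distr M CM Nbar"
  interpret L: intensity_law ?P \<phi> u
    by (intro intensity_law.intro poisson(2) intensity_law_axioms.intro phi_measurable phi_nonneg u)
  have Nbar_cm: "Nbar \<omega> \<in> counting_measures" if "\<omega> \<in> space M" for \<omega>
    using measurable_space[OF Nbar_CM that] by simp
  \<comment> \<open>All quantities of the statement are integrals of functionals of the process, so
    the probability space can be exchanged for the image law.\<close>
  have tr: "(\<integral>\<^sup>+\<mu>. h \<mu> \<partial>?P) = (\<integral>\<^sup>+\<omega>. h (Nbar \<omega>) \<partial>M)" if "h \<in> borel_measurable CM" for h
    by (rule nn_integral_distr[OF Nbar_CM]) (use that in \<open>simp cong: measurable_cong_sets\<close>)
  \<comment> \<open>\<open>difference_operator\<close> adds an atom even where one is present and
    may leave the simple measures. For fixed (t, z) this has probability zero, which suffices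
    because it is only used under an expectation with (t, z) fixed.\<close>
  have Dlam_eq: "AE \<omega> in M. Dlam t z s \<omega> = L.Dint (t, z) s (Nbar \<omega>)" if x: "(t, z) \<in> half_plane" for t z s
  proof -
    have "{\<mu> \<in> space CM. emeasure \<mu> {(t, z)} = 0} \<in> sets CM"
      using emeasure_CM_measurable[OF singleton_sets_hp_borel[OF x]] by measurable
    with L.AE_no_point[OF x] have "AE \<omega> in M. emeasure (Nbar \<omega>) {(t, z)} = 0"
      by (subst (asm) AE_distr_iff[OF Nbar_CM]) auto
    then show ?thesis
      by eventually_elim (simp add: Dlam L.Dint_def difference_operator_def add_point_def)
  qed
  have D_int: "(\<integral>\<^sup>+\<omega>. ennreal \<bar>Dlam t z s \<omega>\<bar> \<partial>M) = (\<integral>\<^sup>+\<mu>. ennreal \<bar>L.Dint (t, z) s \<mu>\<bar> \<partial>?P)"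
    if x: "(t, z) \<in> half_plane" for t z s
  proof -
    have [measurable]: "(t, z) \<in> space hp_borel"
      using x by simp
    have "(\<integral>\<^sup>+\<omega>. ennreal \<bar>Dlam t z s \<omega>\<bar> \<partial>M) = (\<integral>\<^sup>+\<omega>. ennreal \<bar>L.Dint (t, z) s (Nbar \<omega>)\<bar> \<partial>M)"
    proof (rule nn_integral_cong_AE)
      show "AE \<omega> in M. ennreal \<bar>Dlam t z s \<omega>\<bar> = ennreal \<bar>L.Dint (t, z) s (Nbar \<omega>)\<bar>"
        using Dlam_eq[OF x, of s] by eventually_elim simp
    qed
    also have "\<dots> = (\<integral>\<^sup>+\<mu>. ennreal \<bar>L.Dint (t, z) s \<mu>\<bar> \<partial>?P)"
      by (rule tr[symmetric]) measurable
    finally show ?thesis .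
  qed
  have B_int: "(\<integral>\<^sup>+\<omega>. ennreal (indicator {0<..lam t \<omega>} z * \<bar>Dlam t z s \<omega>\<bar>) \<partial>M)
      = (\<integral>\<^sup>+\<mu>. ennreal (L.below ((t, z), \<mu>) * \<bar>L.Dint (t, z) s \<mu>\<bar>) \<partial>?P)"
    if x: "(t, z) \<in> half_plane" for t z s
  proof -
    have [measurable]: "(t, z) \<in> space hp_borel"
      using x by simp
    have "(\<integral>\<^sup>+\<omega>. ennreal (indicator {0<..lam t \<omega>} z * \<bar>Dlam t z s \<omega>\<bar>) \<partial>M)
      = (\<integral>\<^sup>+\<omega>. ennreal (L.below ((t, z), Nbar \<omega>) * \<bar>L.Dint (t, z) s (Nbar \<omega>)\<bar>) \<partial>M)"
    proof (rule nn_integral_cong_AE)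
      show "AE \<omega> in M. ennreal (indicator {0<..lam t \<omega>} z * \<bar>Dlam t z s \<omega>\<bar>)
          = ennreal (L.below ((t, z), Nbar \<omega>) * \<bar>L.Dint (t, z) s (Nbar \<omega>)\<bar>)"
        using Dlam_eq[OF x, of s] by eventually_elim (simp add: L.below_def lam)
    qed
    also have "\<dots> = (\<integral>\<^sup>+\<mu>. ennreal (L.below ((t, z), \<mu>) * \<bar>L.Dint (t, z) s \<mu>\<bar>) \<partial>?P)"
      by (rule tr[symmetric]) measurable
    finally show ?thesis .
  qed
  have interaction: "L.interaction a q = (\<integral>\<^sup>+(t, z). ennreal (\<bar>u t\<bar> ^ a) * (\<integral>\<^sup>+s\<in>{t<..}. ennreal (\<bar>u s\<bar> ^ q) *
        (\<integral>\<^sup>+\<omega>. ennreal (indicator {0<..lam t \<omega>} z * \<bar>Dlam t z s \<omega>\<bar>) \<partial>M)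
        \<partial>lborel) \<partial>half_plane_lebesgue)" for a q
    unfolding L.interaction_def by (intro nn_integral_cong) (auto simp: B_int)
  have moment: "(\<integral>\<^sup>+\<mu>. (\<integral>\<^sup>+t. ennreal (\<bar>u t\<bar> ^ q * intensity \<phi> t \<mu>) \<partial>lborel) \<partial>?P)
      = (\<integral>\<^sup>+\<omega>. (\<integral>\<^sup>+t. ennreal (\<bar>u t\<bar> ^ q * lam t \<omega>) \<partial>lborel) \<partial>M)" for q
    unfolding lam by (rule tr) measurable
  interpret S: stein_bound ?P \<phi> u
  proof
    show "(\<integral>\<^sup>+\<mu>. (\<integral>\<^sup>+t. ennreal (\<bar>u t\<bar> * intensity \<phi> t \<mu>) \<partial>lborel) \<partial>?P) < \<infinity>"
      using moment[of 1] u1 by simp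
    show "(\<integral>\<^sup>+\<mu>. (\<integral>\<^sup>+t. ennreal (\<bar>u t\<bar>\<^sup>2 * intensity \<phi> t \<mu>) \<partial>lborel) \<partial>?P) < \<infinity>"
      using moment[of 2] u2 by simp
    have "(\<integral>\<^sup>+x. (\<integral>\<^sup>+s\<in>{fst x<..}. ennreal \<bar>u s\<bar> * (\<integral>\<^sup>+\<mu>. ennreal \<bar>L.Dint x s \<mu>\<bar> \<partial>?P) \<partial>lborel) \<partial>hpl)
      = (\<integral>\<^sup>+(t, z). (\<integral>\<^sup>+s\<in>{t<..}. ennreal \<bar>u s\<bar> * (\<integral>\<^sup>+\<omega>. ennreal \<bar>Dlam t z s \<omega>\<bar> \<partial>M) \<partial>lborel) \<partial>hpl)"
      by (intro nn_integral_cong) (auto simp: D_int)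
    with D1 show "(\<integral>\<^sup>+x. (\<integral>\<^sup>+s\<in>{fst x<..}. ennreal \<bar>u s\<bar> * (\<integral>\<^sup>+\<mu>. ennreal \<bar>L.Dint x s \<mu>\<bar> \<partial>?P) \<partial>lborel) \<partial>hpl) < \<infinity>"
      by simp
    show "L.interaction 2 1 < \<infinity>"
      using D3 by (simp add: interaction)
  qed
  have delta_eq: "\<delta> \<omega> = L.F (Nbar \<omega>)" if "\<omega> \<in> space M" for \<omega>
  proof -
    note cm = Nbar_cm[OF that]
    have "(\<integral>t. u t \<partial>N \<omega>) = (\<integral>x. L.U (x, Nbar \<omega>) \<partial>Nbar \<omega>)"
      unfolding N lam using integral_thinning[OF cm L.lam_path_measurable[OF cm] u]
      by (simp add: L.U_def L.below_def)
    moreover have "(\<integral>t. u t * lam t \<omega> \<partial>lborel) = (\<integral>x. L.U (x, Nbar \<omega>) \<partial>hpl)"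
      unfolding lam by (rule L.integral_U(1)[OF cm, symmetric])
    ultimately show ?thesis
      by (simp add: delta L.F_def compensated_def)
  qed
  \<comment> \<open>The distance depends on \<open>\<delta>\<close> only through its law, which is
    the law of \<open>L.F\<close> under the image measure.\<close>
  have "wasserstein_dist M \<delta> M' Z = wasserstein_dist ?P L.F M' Z"
    unfolding wasserstein_dist_def
  proof (rule SUP_cong[OF refl])
    fix g :: "real \<Rightarrow> real" assume "g \<in> {g. 1-lipschitz_on UNIV g}"
    then have [measurable]: "g \<in> borel_measurable borel"
      using lipschitz_on_continuous_on by (auto intro: borel_measurable_continuous_onI)
    have "(\<integral>\<omega>. g (\<delta> \<omega>) \<partial>M) = (\<integral>\<omega>. g (L.F (Nbar \<omega>)) \<partial>M)"
      by (intro Bochner_Integration.integral_cong) (auto simp: delta_eq)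
    also have "\<dots> = (\<integral>\<mu>. g (L.F \<mu>) \<partial>?P)"
      by (rule integral_distr[OF Nbar_CM, symmetric]) measurable
    finally show "ennreal \<bar>(\<integral>\<omega>. g (\<delta> \<omega>) \<partial>M) - (\<integral>\<omega>. g (Z \<omega>) \<partial>M')\<bar>
        = ennreal \<bar>(\<integral>\<mu>. g (L.F \<mu>) \<partial>?P) - (\<integral>\<omega>. g (Z \<omega>) \<partial>M')\<bar>"
      by simp
  qed
  also note S.wasserstein_F_le[OF M' Z]
  also have "(\<integral>\<^sup>+\<mu>. ennreal \<bar>1 - (\<integral>t. \<bar>u t\<bar>\<^sup>2 * intensity \<phi> t \<mu> \<partial>lborel)\<bar> \<partial>?P)
      = (\<integral>\<^sup>+\<omega>. ennreal \<bar>1 - (\<integral>t. \<bar>u t\<bar>\<^sup>2 * lam t \<omega> \<partial>lborel)\<bar> \<partial>M)"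
    unfolding lam by (rule tr) measurable
  finally show ?thesis
    unfolding moment interaction by (simp only: power_one_right)
qed

end
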